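(* Let $(G_1,v_1),\dots,(G_k,v_k)$ be basic pairs of order $n$ with corresponding integer partitions $p_1,\dots,p_k$ of $n$. For each $i$ let $Z_{p_i}:=\bigcup_{\sigma\in S_n}\sigma\cdot Z_{G_i}$, where $Z_{G_i}$ is the atomic extremal assignment generated by $(G_i,v_i)$. Then $Z:=\bigcup_{i=1}^k Z_{p_i}$ is an ($S_n$-invariant) extremal assignment if and only if $\mathcal{F}=\{p_1,\dots,p_k\}$ is a special family.
   Context: $[n]=\{1,\dots,n\}$. A stable $n$-labeled tree is a finite tree with $n$ leaves labeled bijectively by $[n]$, all internal vertices of degree $\ge 3$; $V(G)$ its internal vertices; $S(n)$ the set of such trees up to label-preserving isomorphism. $G\rightsquigarrow G'$: $G'$ obtained by collapsing connected sets of internal vertices, inducing surjection $\pi:V(G)\to V(G')$. An extremal assignment of order $n$: rule $Z(G)\subset V(G)$ for $G\in S(n)$ with (a) $Z(G)\ne V(G)$, (b) if $G\rightsquigarrow G'$ and $\pi^{-1}(v')=\{v_1,\dots,v_k\}$ then $v'\in Z(G')\iff v_1,\dots,v_k\in Z(G)$. Unions are vertexwise. A basic pair $(G,v)$: $G\in S(n)$ with at least two internal vertices and $v\in V(G)$ adjacent to all other internal vertices; its set partition has as blocks the label sets of the connected components of $G$ minus $v$, and its integer partition is the multiset of block sizes. The atomic extremal assignment generated by $(G,v)$ is the smallest extremal assignment with $v$ assigned. $S_n$ acts on $S(n)$ by relabeling leaves ($\sigma\cdot G$ relabels leaf $i$ as $\sigma(i)$, with $V(\sigma\cdot G)$ identified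 with $V(G)$), and on assignments by $(\sigma\cdot Z)(\sigma\cdot G)=Z(G)$. Integer partitions of $n$: $p\le q$ if $q$ is a refinement of $p$ (the parts of $q$ can be grouped so that the group sums are exactly the parts of $p$). Given a family $\mathcal{F}=\{p_1,\dots,p_k\}$, a one-step replacement of an integer partition $q$ is obtained by removing a sub-multiset $\{\lambda_i\}_{i\in I}$ of parts of $q$ and adding a sub-multiset $\{\mu_j\}_{j\in J}$ of parts of some $p_t\in\mathcal{F}$ with $\sum_{i\in I}\lambda_i=\sum_{j\in J}\mu_j$. A replacement in $\mathcal{F}$ is any partition obtained by finitely many one-step replacements starting from some $q\le p_s$, $p_s\in\mathcal{F}$. $\mathcal{F}$ is a special family if every replacement $r$ in $\mathcal{F}$ satisfies $r\le p_j$ for some $p_j\in\mathcal{F}$. *)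

theory Defs
  imports "HOL-Library.Multiset" "HOL-Combinatorics.Permutations"
begin

text \<open>A stable n-labeled tree (with at least one internal vertex) is represented by
  (V, E, l): V = finite set of internal vertices, E = edges between internal vertices
  (as doubleton sets), l i = internal vertex to which leaf i is attached (i in {1..n}).
  Trees up to isomorphism are handled by the contraction relation, which includes
  label-preserving isomorphisms.\<close>

type_synonym ltree = "nat set \<times> nat set set \<times> (nat \<Rightarrow> nat)"

definition iv :: "ltree \<Rightarrow> nat set" where "iv G = fst G"
definition ie :: "ltree \<Rightarrow> nat set set" where "ie G = fst (snd G)"
definition lf :: "ltree \<Rightarrow> nat \<Rightarrow> nat" where "lf G = snd (snd G)"

definition adj :: "nat set set \<Rightarrow> nat set \<Rightarrow> (nat \<times> nat) set" where
  "adj E S = {(a, b). a \<in> S \<and> b \<in> S \<and> {a, b} \<in> E}"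

definition connected_on :: "nat set set \<Rightarrow> nat set \<Rightarrow> bool" where
  "connected_on E S \<longleftrightarrow> (\<forall>a\<in>S. \<forall>b\<in>S. (a, b) \<in> (adj E S)\<^sup>*)"

definition stable_tree :: "nat \<Rightarrow> ltree \<Rightarrow> bool" where
  "stable_tree n G \<longleftrightarrow>
     finite (iv G) \<and> iv G \<noteq> {} \<and>
     (\<forall>e\<in>ie G. \<exists>a b. a \<noteq> b \<and> a \<in> iv G \<and> b \<in> iv G \<and> e = {a, b}) \<and>
     connected_on (ie G) (iv G) \<and> card (ie G) + 1 = card (iv G) \<and>
     (\<forall>i\<in>{1..n}. lf G i \<in> iv G) \<and>
     (\<forall>v\<in>iv G. card {e\<in>ie G. v \<in> e} + card {i\<in>{1..n}. lf G i = v} \<ge> 3)"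

text \<open>G contracts to G' via pi : V(G) -> V(G') (collapsing connected sets of internal vertices).\<close>
definition contracts :: "nat \<Rightarrow> ltree \<Rightarrow> ltree \<Rightarrow> (nat \<Rightarrow> nat) \<Rightarrow> bool" where
  "contracts n G G' \<pi> \<longleftrightarrow>
     stable_tree n G \<and> stable_tree n G' \<and>
     \<pi> ` iv G = iv G' \<and>
     (\<forall>v'\<in>iv G'. connected_on (ie G) {v\<in>iv G. \<pi> v = v'}) \<and>
     ie G' = {{\<pi> a, \<pi> b} | a b. {a, b} \<in> ie G \<and> \<pi> a \<noteq> \<pi> b} \<and>
     (\<forall>i\<in>{1..n}. lf G' i = \<pi> (lf G i))"

definition extremal :: "nat \<Rightarrow> (ltree \<Rightarrow> nat set) \<Rightarrow> bool" where
  "extremal n Z \<longleftrightarrow>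
     (\<forall>G. stable_tree n G \<longrightarrow> Z G \<subseteq> iv G \<and> Z G \<noteq> iv G) \<and>
     (\<forall>G G' \<pi>. contracts n G G' \<pi> \<longrightarrow>
        (\<forall>v'\<in>iv G'. v' \<in> Z G' \<longleftrightarrow> (\<forall>v\<in>iv G. \<pi> v = v' \<longrightarrow> v \<in> Z G)))"

text \<open>Z is the atomic extremal assignment generated by (G, v): the smallest one with v assigned.\<close>
definition atomic :: "nat \<Rightarrow> ltree \<Rightarrow> nat \<Rightarrow> (ltree \<Rightarrow> nat set) \<Rightarrow> bool" where
  "atomic n G v Z \<longleftrightarrow> extremal n Z \<and> v \<in> Z G \<and>
     (\<forall>Z'. extremal n Z' \<and> v \<in> Z' G \<longrightarrow> (\<forall>H. stable_tree n H \<longrightarrow> Z H \<subseteq> Z' H))"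

definition basic_pair :: "nat \<Rightarrow> ltree \<Rightarrow> nat \<Rightarrow> bool" where
  "basic_pair n G v \<longleftrightarrow> stable_tree n G \<and> card (iv G) \<ge> 2 \<and> v \<in> iv G \<and>
     (\<forall>u\<in>iv G - {v}. {u, v} \<in> ie G)"

text \<open>Blocks = label sets of the connected components of G minus v.\<close>
definition bp_blocks :: "nat \<Rightarrow> ltree \<Rightarrow> nat \<Rightarrow> nat set set" where
  "bp_blocks n G v =
     (\<lambda>u. {j\<in>{1..n}. lf G j \<in> iv G - {v} \<and> (u, lf G j) \<in> (adj (ie G) (iv G - {v}))\<^sup>*})
        ` (iv G - {v})
     \<union> (\<lambda>i. {i}) ` {i\<in>{1..n}. lf G i = v}"

definition bp_partition :: "nat \<Rightarrow> ltree \<Rightarrow> nat \<Rightarrow> nat multiset" where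
  "bp_partition n G v = image_mset card (mset_set (bp_blocks n G v))"

text \<open>Relabeling: leaf i becomes leaf sigma(i).\<close>
definition relabel :: "(nat \<Rightarrow> nat) \<Rightarrow> ltree \<Rightarrow> ltree" where
  "relabel \<sigma> G = (iv G, ie G, lf G \<circ> inv \<sigma>)"

text \<open>pleq p q: q is a refinement of p.\<close>
definition pleq :: "nat multiset \<Rightarrow> nat multiset \<Rightarrow> bool" where
  "pleq p q \<longleftrightarrow> (\<exists>Q. sum_mset Q = q \<and> image_mset sum_mset Q = p)"

definition one_step :: "nat multiset set \<Rightarrow> nat multiset \<Rightarrow> nat multiset \<Rightarrow> bool" where
  "one_step F q r \<longleftrightarrow> (\<exists>L M p. p \<in> F \<and> L \<subseteq># q \<and> M \<subseteq># p \<and>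
       sum_mset L = sum_mset M \<and> r = q - L + M)"

definition replacement :: "nat multiset set \<Rightarrow> nat multiset \<Rightarrow> bool" where
  "replacement F r \<longleftrightarrow> (\<exists>p\<in>F. \<exists>q. pleq q p \<and> (one_step F)\<^sup>*\<^sup>* q r)"

definition special_family :: "nat multiset set \<Rightarrow> bool" where
  "special_family F \<longleftrightarrow> (\<forall>r. replacement F r \<longrightarrow> (\<exists>p\<in>F. pleq r p))"

end

theory Submission
  imports Defs "HOL-Library.Disjoint_Sets" "HOL-Library.Nat_Bijection"
begin

text \<open>An internal vertex \<open>w\<close> of a stable tree \<open>H\<close> induces a set partition of \<open>{1..n}\<close>, the label sets of
  the branches at \<open>w\<close>. Collapsing the branches turns \<open>H\<close> into a star with the same partition, so an
  extremal assignment amounts to a set of partitions, and the contraction of an edge shows that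
  \<open>A\<^sub>1, \<dots>, A\<^sub>r, B\<^sub>1, \<dots>, B\<^sub>s\<close> belongs to it iff both \<open>A\<^sub>1, \<dots>, A\<^sub>r, \<Union>B\<close> and
  \<open>\<Union>A, B\<^sub>1, \<dots>, B\<^sub>s\<close> do. The coarsenings of a fixed partition satisfy this condition,
  so they form the atomic assignment. Up to permutations, the union of the orbits consists of the
  partitions whose type is \<open>\<le> p\<^sub>i\<close> for some \<open>i\<close>. For that set, the edge condition is exactly closure under
  one-step replacements, which exchange the part \<open>card (\<Union>B)\<close> for the block sizes of \<open>B\<close>.\<close>

section \<open>Refinement of integer partitions\<close>

text \<open>Partitions are handled through the equivalence relation \<open>sep n G F\<close>,
  defined for a set \<open>F\<close> of vertices because a contracted vertex has to be compared with
  its whole fibre. The relation of a fibre is the intersection of those of its members. Hence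
  containing a fixed relation \<open>R\<close> is a property that satisfies condition (b), and it is
  proper once \<open>R\<close> leaves the diagonal, since all vertices together separate all leaves.
  The two directions meet different obstacles. Condition (b) concerns fibres of any size while a
  replacement sees one edge, so fibres are built up vertex by vertex in a rooted tree. Conversely, a
  replacement must be realised by a stable tree, whose edge needs three branches at both ends. This
  fails when one side of the exchange has fewer than two parts, but then the result stays below a
  member of the family anyway. Finally, \<open>pleq\<close> allows empty groups, so a coarser
  partition may have parts zero, to which no block corresponds; they are stripped before passing to
  set partitions.\<close>

lemma pleqI: "image_mset sum_mset Q = p \<Longrightarrow> sum_mset Q = q \<Longrightarrow> pleq p q"
  unfolding pleq_def by blast

lemma pleq_refl: "pleq p p"
  by (rule pleqI[of "image_mset (\<lambda>x. {#x#}) p"]) (simp_all add: image_mset.compositionality o_def)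

lemma pleq_add: "pleq p q \<Longrightarrow> pleq p' q' \<Longrightarrow> pleq (p + p') (q + q')"
  unfolding pleq_def by (metis image_mset_union sum_mset.union)

text \<open>\<open>pleq\<close> admits empty groups, so parts zero may occur on the coarser side at
  no cost.\<close>

lemma pleq_replicate_zero: "pleq (replicate_mset m 0) {#}"
  by (rule pleqI[of "replicate_mset m {#}"]) (induction m; simp)+

lemma pleq_single: "sum_mset q = s \<Longrightarrow> pleq {#s#} q"
  by (rule pleqI[of "{#q#}"]) simp_all

lemma sum_mset_concat: "sum_mset (sum_mset Q) = sum_mset (image_mset sum_mset Q)"
  by (induction Q) auto

lemma pleq_sum: "pleq p q \<Longrightarrow> sum_mset p = sum_mset q"
  unfolding pleq_def using sum_mset_concat by metis

text \<open>A grouping of the image is pulled back to a grouping of \<open>R\<close> itself. For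
  transitivity, \<open>R\<close> is a multiset of groups and \<open>f\<close> is their sum.\<close>

lemma image_mset_eq_sum_msetD:
  "image_mset f R = sum_mset Q \<Longrightarrow> \<exists>S. sum_mset S = R \<and> image_mset (image_mset f) S = Q"
proof (induction Q arbitrary: R)
  case empty
  then show ?case by (intro exI[of _ "{#}"]) auto
next
  case (add q Q)
  then obtain R1 R2 where R: "R = R1 + R2" "q = image_mset f R1" "sum_mset Q = image_mset f R2"
    using image_mset_eq_plusD[of f R q "sum_mset Q"] by auto
  then obtain S where "sum_mset S = R2" "image_mset (image_mset f) S = Q"
    using add.IH[of R2] by auto
  with R show ?case by (intro exI[of _ "add_mset R1 S"]) auto
qed

lemma pleq_trans:
  assumes "pleq p q" "pleq q r"
  shows "pleq p r"
proof -
  from assms obtain Q R where Q: "sum_mset Q = q" "image_mset sum_mset Q = p"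
    and R: "sum_mset R = r" "image_mset sum_mset R = q"
    unfolding pleq_def by blast
  \<comment> \<open>\<open>S\<close> clusters the groups of \<open>R\<close> the way
    \<open>Q\<close> clusters their sums, so merging each cluster groups the parts of
    \<open>r\<close> directly.\<close>
  obtain S where S: "sum_mset S = R" "image_mset (image_mset sum_mset) S = Q"
    using image_mset_eq_sum_msetD[of sum_mset R Q] Q R by auto
  have "sum_mset (image_mset sum_mset S) = r"
    using S R sum_mset_concat[of S] by simp
  moreover have "image_mset sum_mset (image_mset sum_mset S) = p"
    using S(2) Q(2) sum_mset_concat
    by (auto simp: image_mset.compositionality o_def intro!: image_mset_cong)
  ultimately show ?thesis by (rule pleqI[rotated])
qed

text \<open>The groups that sum to parts of \<open>a\<close> and those that sum to parts of
  \<open>b\<close> consume complementary portions of \<open>r\<close>.\<close>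

lemma pleq_addD:
  assumes "pleq (a + b) r"
  obtains r1 r2 where "r = r1 + r2" "pleq a r1" "pleq b r2"
proof -
  from assms obtain Q where Q: "sum_mset Q = r" "image_mset sum_mset Q = a + b"
    unfolding pleq_def by blast
  then obtain Q1 Q2 where "Q = Q1 + Q2" "a = image_mset sum_mset Q1" "b = image_mset sum_mset Q2"
    using image_mset_eq_plusD by blast
  with Q that[of "sum_mset Q1" "sum_mset Q2"] show ?thesis
    unfolding pleq_def by (metis sum_mset.union)
qed

lemma sum_zero_empty: "sum_mset r = (0::nat) \<Longrightarrow> 0 \<notin># r \<Longrightarrow> r = {#}"
  by (cases r) auto

lemma filter_nonzero_split:
  fixes p :: "nat multiset"
  shows "p = filter_mset (\<lambda>x. x \<noteq> 0) p + replicate_mset (count p 0) 0"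
  by (rule multiset_eqI) simp

lemma sum_filter_nonzero: "sum_mset (filter_mset (\<lambda>x. x \<noteq> 0) p) = sum_mset (p :: nat multiset)"
  by (induction p) auto

text \<open>A group with sum zero must be empty when \<open>q\<close> has no part zero, so
  discarding it loses nothing of \<open>q\<close>.\<close>

lemma pleq_drop_zeros:
  assumes "pleq p q" "0 \<notin># q"
  shows "pleq (filter_mset (\<lambda>x. x \<noteq> 0) p) q"
proof -
  have "pleq (filter_mset (\<lambda>x. x \<noteq> 0) p + replicate_mset (count p 0) 0) q"
    using assms(1) filter_nonzero_split[of p] by simp
  then obtain r1 r2 where r: "q = r1 + r2" "pleq (filter_mset (\<lambda>x. x \<noteq> 0) p) r1"
    "pleq (replicate_mset (count p 0) 0) r2" by (rule pleq_addD)
  have "sum_mset r2 = 0" using pleq_sum[OF r(3)] by simp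
  then have "r2 = {#}" using assms(2) r(1) by (intro sum_zero_empty) auto
  then show ?thesis using r by simp
qed

lemma pleq_nonzero:
  fixes p q :: "nat multiset"
  assumes "pleq (filter_mset (\<lambda>x. x \<noteq> 0) p) q"
  shows "pleq p q"
  using pleq_add[OF assms pleq_replicate_zero, of "count p 0"] filter_nonzero_split[of p]
  by (metis add.right_neutral)

text \<open>A group of positive parts with sum one is a single part one. In the end this rules out
  that every vertex of a tree is assigned.\<close>

lemma pleq_ones:
  assumes "pleq p q" "\<forall>x\<in>#p. x = 1" "0 \<notin># q"
  shows "\<forall>x\<in>#q. x = 1"
proof
  fix x assume x: "x \<in># q"
  from assms(1) obtain Q where Q: "sum_mset Q = q" "image_mset sum_mset Q = p"
    unfolding pleq_def by blast
  then obtain g where g: "g \<in># Q" "x \<in># g" using x by (auto simp: in_Union_mset_iff)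
  then have "sum_mset g = 1" using Q assms(2) by auto
  moreover have "x \<le> sum_mset g" using g(2) by (metis le_add1 multi_member_split sum_mset.add_mset)
  moreover have "x \<noteq> 0" using x assms(3) by metis
  ultimately show "x = 1" by linarith
qed

section \<open>Set partitions and their types\<close>

definition ptype :: "'a set set \<Rightarrow> nat multiset" where
  "ptype P = image_mset card (mset_set P)"

lemma ptype_union:
  "finite P \<Longrightarrow> finite Q \<Longrightarrow> P \<inter> Q = {} \<Longrightarrow> ptype (P \<union> Q) = ptype P + ptype Q"
  by (simp add: ptype_def mset_set_Union)

lemma ptype_insert: "finite P \<Longrightarrow> B \<notin> P \<Longrightarrow> ptype (insert B P) = add_mset (card B) (ptype P)"
  by (simp add: ptype_def)

lemma size_ptype: "size (ptype P) = card P"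
  by (simp add: ptype_def)

lemma zero_notin_ptype:
  assumes "finite A" "partition_on A P"
  shows "0 \<notin># ptype P"
proof -
  have "finite P" using assms finite_elements by blast
  moreover have "\<forall>B\<in>P. finite B \<and> B \<noteq> {}"
    using assms partition_onD1 partition_onD3 by (metis Sup_upper finite_subset)
  ultimately show ?thesis by (auto simp: ptype_def)
qed

lemma sum_ptype:
  assumes "finite A" "partition_on A P"
  shows "sum_mset (ptype P) = card A"
proof -
  have "card A = (\<Sum>p\<in>P. card p)"
    using assms product_partition by (metis Sup_upper finite_subset partition_onD1)
  then show ?thesis by (simp add: ptype_def sum_unfold_sum_mset)
qed

text \<open>Sizes may repeat but blocks do not: a sub-multiset of \<open>mset_set P\<close> is
  \<open>mset_set\<close> of a set of blocks, so a splitting of the sizes is induced by a splitting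
  of the blocks.\<close>

lemma ptype_subset:
  assumes "finite P" "ptype P = a + b"
  obtains S where "S \<subseteq> P" "ptype (P - S) = a" "ptype S = b"
proof -
  obtain A B where AB: "mset_set P = A + B" "a = image_mset card A" "b = image_mset card B"
    using assms(2) image_mset_eq_plusD unfolding ptype_def by metis
  have "B \<subseteq># mset_set P" using AB by simp
  then have "\<And>x. count B x \<le> 1"
    by (metis count_mset_set(1,2,3) le_zero_eq mset_subset_eq_count order_trans zero_le_one order_refl)
  then have B: "B = mset_set (set_mset B)"
    by (intro multiset_eqI) (metis One_nat_def count_eq_zero_iff count_mset_set(1,3) finite_set_mset
        le_Suc_eq le_zero_eq)
  have sub: "set_mset B \<subseteq> P"
    using \<open>B \<subseteq># mset_set P\<close> assms(1) by (metis elem_mset_set mset_subset_eqD subsetI)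
  have "mset_set (P - set_mset B) = A"
    using mset_set_Diff[OF assms(1) sub] B AB(1) by simp
  then show ?thesis using that[OF sub] AB B by (metis ptype_def)
qed

lemma exists_partition_of_type:
  assumes "finite A" "sum_mset q = card A" "0 \<notin># q"
  shows "\<exists>P. partition_on A P \<and> ptype P = q"
  using assms
proof (induction q arbitrary: A)
  case empty
  then show ?case by (intro exI[of _ "{}"]) (auto simp: partition_on_def ptype_def)
next
  case (add x q)
  then have "x \<le> card A" by simp
  then obtain B where B: "B \<subseteq> A" "card B = x" "finite B"
    by (metis obtain_subset_with_card_n)
  have "sum_mset q = card (A - B)" using add.prems B by (simp add: card_Diff_subset)
  then obtain P where P: "partition_on (A - B) P" "ptype P = q"
    using add.IH[of "A - B"] add.prems by auto
  have "B \<noteq> {}" using B add.prems by auto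
  have dis: "disjnt B (\<Union>P)" using partition_onD1[OF P(1)] by (auto simp: disjnt_def)
  then have "partition_on A (insert B P)"
    using partition_on_insert P(1) B(1) \<open>B \<noteq> {}\<close> by blast
  moreover have "B \<notin> P" using dis \<open>B \<noteq> {}\<close> by (auto simp: disjnt_def)
  moreover have "finite P" using P(1) add.prems(1) finite_elements by blast
  ultimately show ?case using P(2) B(2) ptype_insert by metis
qed

section \<open>Refinement of types as refinement up to a permutation\<close>

lemma partition_on_subset_Union:
  "partition_on A P \<Longrightarrow> S \<subseteq> P \<Longrightarrow> partition_on (\<Union>S) S"
  by (auto simp: partition_on_def disjoint_def)

lemma partition_on_Diff:
  "partition_on A P \<Longrightarrow> S \<subseteq> P \<Longrightarrow> partition_on (A - \<Union>S) (P - S)"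
  unfolding partition_on_def disjoint_def by fastforce

text \<open>Induction over the grouping. A group \<open>g\<close> singles out one block
  \<open>B\<close> of \<open>P\<close> and a set of blocks of \<open>P0\<close> whose union
  \<open>D\<close> has the same cardinality, so any bijection from \<open>D\<close> to
  \<open>B\<close> can be glued to the one for the rest. There are two ground sets because the
  remainders \<open>A - B\<close> and \<open>A0 - D\<close> differ.\<close>

lemma pleq_ptype_imp_bij:
  assumes "finite A" "finite A0" "partition_on A P" "partition_on A0 P0"
    and "image_mset sum_mset Q = ptype P" "sum_mset Q = ptype P0"
  shows "\<exists>f. bij_betw f A0 A \<and> (\<forall>C\<in>P0. \<exists>B\<in>P. f ` C \<subseteq> B)"
  using assms
proof (induction Q arbitrary: A A0 P P0)
  case empty
  have "finite P" "finite P0" using empty.prems finite_elements by blast+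
  then have "P = {}" "P0 = {}"
    using empty.prems(5,6) by (auto simp: ptype_def mset_set_empty_iff)
  then show ?case using partition_onD1[OF empty.prems(3)] partition_onD1[OF empty.prems(4)]
    by (auto simp: bij_betw_def)
next
  case (add g Q)
  have fin: "finite P" "finite P0" using add.prems finite_elements by blast+
  have "ptype P = {#sum_mset g#} + image_mset sum_mset Q" using add.prems(5) by simp
  then obtain T where T: "T \<subseteq> P" "ptype T = image_mset sum_mset Q" "ptype (P - T) = {#sum_mset g#}"
    using ptype_subset[OF fin(1)] by blast
  have "card (P - T) = 1" using T(3) by (metis size_ptype size_single)
  then obtain B where B: "P - T = {B}" using card_1_singletonE by blast
  have cB: "card B = sum_mset g" using T(3) B by (simp add: ptype_def)
  have "ptype P0 = g + sum_mset Q" using add.prems(6) by simp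
  then obtain S where S: "S \<subseteq> P0" "ptype S = sum_mset Q" "ptype (P0 - S) = g"
    using ptype_subset[OF fin(2)] by blast
  have pT: "partition_on (\<Union>T) T" and pS: "partition_on (\<Union>S) S"
    using partition_on_subset_Union T S add.prems by blast+
  have "A = \<Union>P" "A0 = \<Union>P0" using add.prems(3,4) partition_onD1 by blast+
  have dP: "\<And>X Y. X \<in> P \<Longrightarrow> Y \<in> P \<Longrightarrow> X \<noteq> Y \<Longrightarrow> X \<inter> Y = {}"
    using partition_onD2[OF add.prems(3)] unfolding disjoint_def by blast
  have dP0: "\<And>X Y. X \<in> P0 \<Longrightarrow> Y \<in> P0 \<Longrightarrow> X \<noteq> Y \<Longrightarrow> X \<inter> Y = {}"
    using partition_onD2[OF add.prems(4)] unfolding disjoint_def by blast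
  have PB: "P = insert B T" "B \<notin> T" "B \<in> P" using B T(1) by blast+
  have "B \<inter> \<Union>T = {}" using dP T(1) PB(2,3) by blast
  then have AB: "\<Union>T = A - B" "B \<subseteq> A" unfolding \<open>A = \<Union>P\<close> using PB(1) by blast+
  define D where "D = \<Union>(P0 - S)"
  have "\<Union>S \<inter> D = {}" using dP0 S(1) unfolding D_def by blast
  then have AD: "\<Union>S = A0 - D" "D \<subseteq> A0" unfolding \<open>A0 = \<Union>P0\<close> D_def using S(1) by blast+
  have "finite (\<Union>T)" "finite (\<Union>S)" using AB AD add.prems by auto
  then obtain f where f: "bij_betw f (A0 - D) (A - B)" "\<forall>C\<in>S. \<exists>B\<in>T. f ` C \<subseteq> B"
    using add.IH[OF _ _ pT pS] T S AB AD by metis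
  have "partition_on D (P0 - S)" unfolding D_def
    using partition_on_subset_Union[OF add.prems(4)] by blast
  then have "card D = sum_mset g" using sum_ptype[of D "P0 - S"] S(3) AD add.prems(2)
    by (metis finite_subset)
  then obtain h where h: "bij_betw h D B"
    using cB AB AD add.prems by (metis finite_same_card_bij finite_subset)
  define k where "k x = (if x \<in> D then h x else f x)" for x
  have "bij_betw k (D \<union> (A0 - D)) (B \<union> (A - B))"
  proof (rule bij_betw_combine)
    show "bij_betw k D B" using h by (rule bij_betw_cong[THEN iffD1, rotated]) (simp add: k_def)
    show "bij_betw k (A0 - D) (A - B)" using f(1)
      by (rule bij_betw_cong[THEN iffD1, rotated]) (simp add: k_def)
  qed auto
  then have "bij_betw k A0 A" using AB AD by (simp add: Un_absorb1)
  moreover have "\<exists>B\<in>P. k ` C \<subseteq> B" if "C \<in> P0" for C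
  proof (cases "C \<in> S")
    case True
    then have "C \<subseteq> A0 - D" using AD by auto
    then have "k ` C = f ` C" by (intro image_cong) (auto simp: k_def)
    moreover obtain B' where "B' \<in> T" "f ` C \<subseteq> B'" using f(2) True by blast
    ultimately show ?thesis using T(1) by (metis subsetD)
  next
    case False
    then have "C \<subseteq> D" using that by (auto simp: D_def)
    then have "k ` C = h ` C" by (intro image_cong) (auto simp: k_def)
    then have "k ` C \<subseteq> B" using \<open>C \<subseteq> D\<close> h by (auto simp: bij_betw_def)
    then show ?thesis using PB(3) by blast
  qed
  ultimately show ?case by blast
qed

text \<open>The witness for \<open>pleq\<close> groups, for each block \<open>B\<close> of
  \<open>P\<close>, the sizes of the blocks of \<open>P0\<close> inside \<open>B\<close>.\<close>

lemma pleq_ptype_refines: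
  assumes "finite A" "partition_on A P" "partition_on A P0" "\<And>C. C \<in> P0 \<Longrightarrow> \<exists>B\<in>P. C \<subseteq> B"
  shows "pleq (ptype P) (ptype P0)"
proof (rule pleqI)
  have fin: "finite P" "finite P0" using assms finite_elements by blast+
  let ?f = "\<lambda>B. {C \<in> P0. C \<subseteq> B}"
  have part: "partition_on B (?f B)" if "B \<in> P" for B
  proof (rule partition_onI)
    show "\<Union>(?f B) = B"
    proof
      show "B \<subseteq> \<Union>(?f B)"
      proof
        fix x assume x: "x \<in> B"
        then have "x \<in> A" using that partition_onD1[OF assms(2)] by auto
        then obtain C where C: "C \<in> P0" "x \<in> C" using partition_onD1[OF assms(3)] by auto
        then obtain B' where "B' \<in> P" "C \<subseteq> B'" using assms(4) by blast
        then have "B' = B" using x C that partition_onD2[OF assms(2)] by (auto simp: disjoint_def)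
        then show "x \<in> \<Union>(?f B)" using C \<open>C \<subseteq> B'\<close> by auto
      qed
    qed auto
    show "disjnt p q" if "p \<in> ?f B" "q \<in> ?f B" "p \<noteq> q" for p q
      using that partition_onD2[OF assms(3)] by (auto simp: disjoint_def disjnt_def)
    show "{} \<notin> ?f B" using partition_onD3[OF assms(3)] by auto
  qed
  have finB: "finite B" if "B \<in> P" for B
    using that assms(1) partition_onD1[OF assms(2)] by (metis Sup_upper finite_subset)
  show "image_mset sum_mset (image_mset (\<lambda>B. ptype (?f B)) (mset_set P)) = ptype P"
  proof -
    have "sum_mset (ptype (?f B)) = card B" if "B \<in> P" for B
      using sum_ptype[OF finB part] that by blast
    then show ?thesis using fin(1)
      by (auto simp: ptype_def[of P] image_mset.compositionality o_def intro!: image_mset_cong)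
  qed
  \<comment> \<open>Stated for subfamilies to allow induction; different \<open>B\<close> collect
    disjoint sets of subblocks because the blocks of \<open>P0\<close> are nonempty.\<close>
  have sub: "sum_mset (image_mset (\<lambda>B. ptype (?f B)) (mset_set P')) = ptype (\<Union>(?f ` P'))"
    if "P' \<subseteq> P" for P'
    using finite_subset[OF that fin(1)] that
  proof (induction P' rule: finite_induct)
    case empty
    then show ?case by (simp add: ptype_def)
  next
    case (insert B P')
    have "?f B \<inter> \<Union>(?f ` P') = {}"
    proof (rule ccontr)
      assume "?f B \<inter> \<Union>(?f ` P') \<noteq> {}"
      then obtain C B' where C: "C \<in> P0" "C \<subseteq> B" "B' \<in> P'" "C \<subseteq> B'" by auto
      then have "C \<noteq> {}" using partition_onD3[OF assms(3)] by auto
      then have "B \<inter> B' \<noteq> {}" using C by blast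
      then have "B = B'" using C(3) insert.prems partition_onD2[OF assms(2)]
        unfolding disjoint_def by blast
      then show False using C insert.hyps by auto
    qed
    then show ?case using insert fin(2)
      by (subst image_insert, subst Union_insert, subst ptype_union)
        (auto intro: finite_subset[of _ P0])
  qed
  have "\<Union>(?f ` P) = P0" using assms(4) by blast
  then show "sum_mset (image_mset (\<lambda>B. ptype (?f B)) (mset_set P)) = ptype P0"
    using sub[OF subset_refl] by simp
qed

lemma ptype_image:
  assumes "inj_on f (\<Union>P)"
  shows "ptype ((`) f ` P) = ptype P"
proof -
  have "inj_on ((`) f) P"
    using assms by (intro inj_onI) (metis Sup_upper inj_on_image_eq_iff)
  moreover have "\<forall>B\<in>P. card (f ` B) = card B"
    using assms by (metis Sup_upper card_image inj_on_subset)
  ultimately show ?thesis unfolding ptype_def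
    by (cases "finite P") (auto simp: image_mset_mset_set[symmetric] image_mset.compositionality o_def
       finite_image_iff intro!: image_mset_cong)
qed

text \<open>Comparing types means comparing set partitions after moving one of them by some
  \<open>\<sigma>\<close>. This is what turns the union over all relabellings into a condition on
  integer partitions.\<close>

lemma pleq_ptype_iff:
  assumes "finite A" "partition_on A P" "partition_on A P0"
  shows "pleq (ptype P) (ptype P0) \<longleftrightarrow> (\<exists>\<sigma>. \<sigma> permutes A \<and> (\<forall>C\<in>P0. \<exists>B\<in>P. \<sigma> ` C \<subseteq> B))"
proof
  assume "pleq (ptype P) (ptype P0)"
  then obtain f where f: "bij_betw f A A" "\<forall>C\<in>P0. \<exists>B\<in>P. f ` C \<subseteq> B"
    using pleq_ptype_imp_bij[OF assms(1,1,2,3)] unfolding pleq_def by blast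
  \<comment> \<open>\<open>permutes\<close> demands the identity outside \<open>A\<close>.\<close>
  define \<sigma> where "\<sigma> x = (if x \<in> A then f x else x)" for x
  have "bij_betw \<sigma> A A" using f(1)
    by (rule bij_betw_cong[THEN iffD1, rotated]) (simp add: \<sigma>_def)
  then have "\<sigma> permutes A" by (rule bij_imp_permutes) (simp add: \<sigma>_def)
  moreover have "\<sigma> ` C = f ` C" if "C \<in> P0" for C
    using that partition_onD1[OF assms(3)] by (intro image_cong) (auto simp: \<sigma>_def)
  ultimately show "\<exists>\<sigma>. \<sigma> permutes A \<and> (\<forall>C\<in>P0. \<exists>B\<in>P. \<sigma> ` C \<subseteq> B)" using f(2) by metis
next
  assume "\<exists>\<sigma>. \<sigma> permutes A \<and> (\<forall>C\<in>P0. \<exists>B\<in>P. \<sigma> ` C \<subseteq> B)"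
  then obtain \<sigma> where \<sigma>: "\<sigma> permutes A" "\<forall>C\<in>P0. \<exists>B\<in>P. \<sigma> ` C \<subseteq> B" by blast
  have inj: "inj_on \<sigma> A" using \<sigma>(1) by (meson permutes_inj_on)
  have "partition_on (\<sigma> ` A) ((`) \<sigma> ` P0 - {{}})" using partition_on_inj_image[OF assms(3) inj] .
  moreover have "(`) \<sigma> ` P0 - {{}} = (`) \<sigma> ` P0" using partition_onD3[OF assms(3)] by auto
  ultimately have "partition_on A ((`) \<sigma> ` P0)" using \<sigma>(1) by (simp add: permutes_image)
  then have "pleq (ptype P) (ptype ((`) \<sigma> ` P0))"
    using \<sigma>(2) by (intro pleq_ptype_refines[OF assms(1,2)]) auto
  then show "pleq (ptype P) (ptype P0)"
    using ptype_image[of \<sigma> P0] inj partition_onD1[OF assms(3)] by simp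
qed

section \<open>Partitions and equivalence classes\<close>

lemma partition_mem:
  assumes "partition_on A P"
  shows "B \<in> P \<Longrightarrow> B \<subseteq> A" "B \<in> P \<Longrightarrow> B \<noteq> {}"
    "B \<in> P \<Longrightarrow> C \<in> P \<Longrightarrow> B \<inter> C \<noteq> {} \<Longrightarrow> B = C"
proof -
  show "B \<in> P \<Longrightarrow> B \<subseteq> A" using partition_onD1[OF assms] by blast
  show "B \<in> P \<Longrightarrow> B \<noteq> {}" using partition_onD3[OF assms] by blast
  show "B \<in> P \<Longrightarrow> C \<in> P \<Longrightarrow> B \<inter> C \<noteq> {} \<Longrightarrow> B = C"
    using partition_onD2[OF assms] unfolding disjoint_def by blast
qed

lemma quotient_eqI:
  assumes "partition_on A P" "equiv A R"
    and "\<And>x y. (x, y) \<in> R \<longleftrightarrow> (\<exists>B\<in>P. x \<in> B \<and> y \<in> B)"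
  shows "A // R = P"
proof -
  have "R = {(x, y). \<exists>B\<in>P. x \<in> B \<and> y \<in> B}" using assms(3) by auto
  then show ?thesis using partition_on_eq_quotient[OF assms(1)] by simp
qed

lemma quotient_rel:
  assumes "equiv A R"
  shows "(x, y) \<in> R \<longleftrightarrow> (\<exists>B\<in>A // R. x \<in> B \<and> y \<in> B)"
proof
  assume xy: "(x, y) \<in> R"
  then have "x \<in> A" using assms unfolding equiv_def by blast
  then show "\<exists>B\<in>A // R. x \<in> B \<and> y \<in> B"
    using xy equiv_class_self[OF assms] by (intro bexI[of _ "R `` {x}"]) (auto intro: quotientI)
next
  assume "\<exists>B\<in>A // R. x \<in> B \<and> y \<in> B"
  then show "(x, y) \<in> R" using in_quotient_imp_in_rel[OF assms] by blast
qed

lemma quotient_relI: "equiv A R \<Longrightarrow> B \<in> A // R \<Longrightarrow> x \<in> B \<Longrightarrow> y \<in> B \<Longrightarrow> (x, y) \<in> R"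
  using quotient_rel by metis

lemma quotient_relE:
  assumes "equiv A R" "(x, y) \<in> R"
  obtains B where "B \<in> A // R" "x \<in> B" "y \<in> B"
  using assms quotient_rel by metis

lemma refines_iff:
  assumes "equiv A R" "equiv A R0"
  shows "(\<forall>C\<in>A // R0. \<exists>B\<in>A // R. C \<subseteq> B) \<longleftrightarrow> R0 \<subseteq> R"
proof
  assume *: "\<forall>C\<in>A // R0. \<exists>B\<in>A // R. C \<subseteq> B"
  show "R0 \<subseteq> R"
  proof (rule subrelI)
    fix x y assume "(x, y) \<in> R0"
    then obtain C where C: "C \<in> A // R0" "x \<in> C" "y \<in> C" using quotient_rel[OF assms(2)] by blast
    then obtain B where "B \<in> A // R" "C \<subseteq> B" using * by blast
    then show "(x, y) \<in> R" using C quotient_rel[OF assms(1)] by blast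
  qed
next
  assume *: "R0 \<subseteq> R"
  show "\<forall>C\<in>A // R0. \<exists>B\<in>A // R. C \<subseteq> B"
  proof
    fix C assume "C \<in> A // R0"
    then obtain x where "x \<in> A" "C = R0 `` {x}" by (rule quotientE)
    then show "\<exists>B\<in>A // R. C \<subseteq> B" using * by (intro bexI[of _ "R `` {x}"]) (auto intro: quotientI)
  qed
qed

section \<open>Rooted trees\<close>

lemma adj_mono: "S \<subseteq> T \<Longrightarrow> (adj E S)\<^sup>* \<subseteq> (adj E T)\<^sup>*"
  by (rule rtrancl_mono) (auto simp: adj_def)

lemma adj_mono': "(x, y) \<in> (adj E S)\<^sup>* \<Longrightarrow> S \<subseteq> T \<Longrightarrow> (x, y) \<in> (adj E T)\<^sup>*"
  using adj_mono by (rule subsetD)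

lemma adj_sym: "(x, y) \<in> (adj E S)\<^sup>* \<Longrightarrow> (y, x) \<in> (adj E S)\<^sup>*"
proof -
  have "sym (adj E S)" by (auto simp: adj_def sym_def insert_commute)
  then show "(x, y) \<in> (adj E S)\<^sup>* \<Longrightarrow> (y, x) \<in> (adj E S)\<^sup>*"
    by (metis sym_rtrancl symD)
qed

lemma adj_rtrancl_in: "(x, y) \<in> (adj E S)\<^sup>* \<Longrightarrow> x \<in> S \<Longrightarrow> y \<in> S"
  by (induction rule: rtrancl_induct) (auto simp: adj_def)

lemma adj_rtrancl_closed:
  assumes "(x, y) \<in> (adj E S)\<^sup>*" "x \<in> C"
    and "\<And>u v. (u, v) \<in> adj E S \<Longrightarrow> u \<in> C \<Longrightarrow> v \<in> C"
  shows "y \<in> C"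
  using assms(1,2) by (induction rule: rtrancl_induct) (auto intro: assms(3))

text \<open>The tree oriented towards \<open>w\<close>. The values \<open>d\<close> need not be
  distances: they only have to drop from a vertex to its parent, which permits induction along
  parent chains. The value \<open>par w\<close> is left open.\<close>

locale rooted =
  fixes V :: "nat set" and E :: "nat set set" and w :: nat and par d :: "nat \<Rightarrow> nat"
  assumes fin_V: "finite V" and root_in: "w \<in> V"
    and par_in: "v \<in> V \<Longrightarrow> v \<noteq> w \<Longrightarrow> par v \<in> V"
    and par_less: "v \<in> V \<Longrightarrow> v \<noteq> w \<Longrightarrow> d (par v) < d v"
    and edges: "E = (\<lambda>v. {v, par v}) ` (V - {w})"
begin

definition up :: "(nat \<times> nat) set" where "up = {(v, par v) | v. v \<in> V \<and> v \<noteq> w}"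

definition desc :: "nat \<Rightarrow> nat set" where "desc a = {u \<in> V. (u, a) \<in> up\<^sup>*}"

lemma par_neq: "v \<in> V \<Longrightarrow> v \<noteq> w \<Longrightarrow> par v \<noteq> v"
  using par_less by fastforce

lemma adj_iff: "S \<subseteq> V \<Longrightarrow> (a, b) \<in> adj E S \<longleftrightarrow> a \<in> S \<and> b \<in> S \<and> ((a, b) \<in> up \<or> (b, a) \<in> up)"
  unfolding adj_def edges up_def by (auto simp: doubleton_eq_iff)

lemma desc_sub: "desc a \<subseteq> V" by (auto simp: desc_def)

lemma desc_self: "a \<in> V \<Longrightarrow> a \<in> desc a" by (simp add: desc_def)

lemma up_first: "(u, a) \<in> up\<^sup>* \<Longrightarrow> u \<noteq> a \<Longrightarrow> (par u, a) \<in> up\<^sup>* \<and> u \<noteq> w \<and> u \<in> V"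
  by (erule converse_rtranclE) (auto simp: up_def)

lemma root_notin_desc: "a \<noteq> w \<Longrightarrow> w \<notin> desc a"
  using up_first by (auto simp: desc_def)

lemma desc_par: "u \<in> desc a \<Longrightarrow> u \<noteq> a \<Longrightarrow> par u \<in> desc a"
  using up_first par_in by (auto simp: desc_def)

text \<open>The subtree below \<open>a\<close> can be left only through the edge from
  \<open>a\<close> to its parent, so deleting the parent traps every walk.\<close>

lemma desc_closed:
  assumes "(x, y) \<in> (adj E (V - {par a}))\<^sup>*" "x \<in> desc a"
  shows "y \<in> desc a"
proof (rule adj_rtrancl_closed[OF assms])
  fix u v assume uv: "(u, v) \<in> adj E (V - {par a})" and u: "u \<in> desc a"
  from uv have v: "v \<in> V" "v \<noteq> par a" "(u, v) \<in> up \<or> (v, u) \<in> up"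
    by (auto simp: adj_iff)
  from v(3) show "v \<in> desc a"
  proof
    assume "(u, v) \<in> up"
    then have "v = par u" by (auto simp: up_def)
    then show ?thesis using desc_par[OF u] v(2) by auto
  next
    assume "(v, u) \<in> up"
    then show ?thesis using u v(1) by (auto simp: desc_def intro: converse_rtrancl_into_rtrancl)
  qed
qed

lemma desc_minus_closed:
  assumes "(x, y) \<in> (adj E (V - {a}))\<^sup>*" "x \<in> desc a - {a}"
  shows "y \<in> desc a - {a}"
proof (rule adj_rtrancl_closed[OF assms])
  fix u v assume uv: "(u, v) \<in> adj E (V - {a})" and u: "u \<in> desc a - {a}"
  from uv have v: "v \<in> V" "v \<noteq> a" "(u, v) \<in> up \<or> (v, u) \<in> up" by (auto simp: adj_iff)
  from v(3) show "v \<in> desc a - {a}"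
  proof
    assume "(u, v) \<in> up"
    then have "v = par u" by (auto simp: up_def)
    then show ?thesis using desc_par[of u a] u v(2) by auto
  next
    assume "(v, u) \<in> up"
    then show ?thesis using u v by (auto simp: desc_def intro: converse_rtrancl_into_rtrancl)
  qed
qed

lemma desc_connected:
  assumes "x \<in> desc a"
  shows "(x, a) \<in> (adj E (desc a))\<^sup>*"
proof -
  have "(x, a) \<in> up\<^sup>*" using assms by (simp add: desc_def)
  then show ?thesis
  proof (induction rule: converse_rtrancl_induct)
    case (step y z)
    then have "y \<in> V" "z \<in> V" by (auto simp: up_def par_in)
    then have "y \<in> desc a" "z \<in> desc a"
      using step by (auto simp: desc_def intro: converse_rtrancl_into_rtrancl)
    then have "(y, z) \<in> adj E (desc a)" using step(1) by (simp add: adj_iff[OF desc_sub])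
    then show ?case using step.IH by (rule converse_rtrancl_into_rtrancl)
  qed simp
qed

text \<open>The parent of a vertex outside the subtree of \<open>v\<close> is again outside, so the
  climb to the root avoids that subtree.\<close>

lemma outside_desc_connected:
  assumes "v \<in> V" "v \<noteq> w" "u \<in> V - desc v"
  shows "(u, w) \<in> (adj E (V - desc v))\<^sup>*"
  using assms(3)
proof (induction "d u" arbitrary: u rule: less_induct)
  case less
  show ?case
  proof (cases "u = w")
    case False
    then have up: "(u, par u) \<in> up" using less.prems by (auto simp: up_def)
    then have "par u \<notin> desc v" using less.prems
      by (auto simp: desc_def intro: converse_rtrancl_into_rtrancl)
    then have *: "par u \<in> V - desc v" using par_in less.prems False by auto
    then have "(u, par u) \<in> adj E (V - desc v)" using up less.prems
      by (subst adj_iff) auto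
    then show ?thesis using less.hyps[OF _ *] par_less less.prems False
      by (auto intro: converse_rtrancl_into_rtrancl)
  qed simp
qed

text \<open>If \<open>par f\<close> were missing from \<open>F\<close>, a walk in \<open>F\<close>
  from \<open>f\<close> would be trapped below \<open>f\<close> and could not reach the
  root.\<close>

lemma connected_imp_par_closed:
  assumes "F \<subseteq> V" "w \<in> F" "connected_on E F" "f \<in> F" "f \<noteq> w"
  shows "par f \<in> F"
proof (rule ccontr)
  assume "par f \<notin> F"
  then have "F \<subseteq> V - {par f}" using assms(1) by auto
  moreover have "(f, w) \<in> (adj E F)\<^sup>*" using assms by (auto simp: connected_on_def)
  ultimately have "(f, w) \<in> (adj E (V - {par f}))\<^sup>*" using adj_mono by blast
  moreover have "f \<in> desc f" using assms desc_self by auto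
  ultimately show False using desc_closed root_notin_desc assms(5) by blast
qed

lemma desc_avoids:
  assumes "\<And>f. f \<in> F \<Longrightarrow> f \<noteq> w \<Longrightarrow> par f \<in> F" "a \<notin> F" "a \<noteq> w"
  shows "desc a \<inter> F = {}"
proof -
  have "(u, a) \<in> up\<^sup>* \<Longrightarrow> u \<notin> F" for u
    by (induction rule: converse_rtrancl_induct) (use assms in \<open>auto simp: up_def\<close>)
  then show ?thesis by (auto simp: desc_def)
qed

text \<open>Separation by a connected set is separation by one of its vertices. The witness is the
  parent of the last vertex outside \<open>F\<close> on the way from \<open>x\<close> up to the root.\<close>

lemma connected_avoiding:
  assumes "w \<in> F" "\<And>f. f \<in> F \<Longrightarrow> f \<noteq> w \<Longrightarrow> par f \<in> F" "x \<in> V - F"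
    and "\<And>v. v \<in> F \<Longrightarrow> (x, y) \<in> (adj E (V - {v}))\<^sup>*"
  shows "(x, y) \<in> (adj E (V - F))\<^sup>*"
proof -
  have "\<exists>a. a \<in> V \<and> a \<notin> F \<and> a \<noteq> w \<and> par a \<in> F \<and> x \<in> desc a"
    using assms(3)
  proof (induction "d x" arbitrary: x rule: less_induct)
    case less
    then have x: "x \<in> V" "x \<notin> F" "x \<noteq> w" using assms(1) by auto
    show ?case
    proof (cases "par x \<in> F")
      case True
      then show ?thesis using x desc_self by blast
    next
      case False
      then obtain a where a: "a \<in> V" "a \<notin> F" "a \<noteq> w" "par a \<in> F" "par x \<in> desc a"
        using less.hyps[of "par x"] par_less par_in x by blast
      then have "x \<in> desc a" using x
        by (auto simp: desc_def up_def intro: converse_rtrancl_into_rtrancl)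
      then show ?thesis using a by blast
    qed
  qed
  then obtain a where a: "a \<in> V" "a \<notin> F" "a \<noteq> w" "par a \<in> F" "x \<in> desc a" by blast
  then have y: "y \<in> desc a" using desc_closed assms(4) by blast
  have "desc a \<subseteq> V - F" using desc_avoids[of F a] assms(2) a desc_sub by blast
  then have "(x, a) \<in> (adj E (V - F))\<^sup>*" "(y, a) \<in> (adj E (V - F))\<^sup>*"
    using desc_connected a(5) y adj_mono by blast+
  then show ?thesis using adj_sym by (meson rtrancl_trans)
qed

text \<open>Take a descendant with maximal \<open>d\<close>: a child of it would be a descendant
  with a larger value.\<close>

lemma desc_has_childless:
  assumes "a \<in> V"
  obtains u where "u \<in> desc a" "\<And>v. v \<in> V \<Longrightarrow> v \<noteq> w \<Longrightarrow> par v \<noteq> u"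
proof -
  have "finite (desc a)" using desc_sub fin_V finite_subset by blast
  moreover have "desc a \<noteq> {}" using desc_self assms by auto
  ultimately have "Max (d ` desc a) \<in> d ` desc a" by simp
  then obtain u where "u \<in> desc a" and du: "d u = Max (d ` desc a)" by auto
  then have u: "u \<in> desc a" "\<And>v. v \<in> desc a \<Longrightarrow> d v \<le> d u"
    using \<open>finite (desc a)\<close> by auto
  have "par v \<noteq> u" if "v \<in> V" "v \<noteq> w" for v
  proof
    assume p: "par v = u"
    then have "v \<in> desc a" using u(1) that
      by (auto simp: desc_def up_def intro: converse_rtrancl_into_rtrancl)
    then show False using u(2) par_less that p by force
  qed
  then show ?thesis using that u(1) by blast
qed

lemma edge_inj: "inj_on (\<lambda>v. {v, par v}) (V - {w})"
proof (rule inj_onI, rule ccontr)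
  fix u v assume uv: "u \<in> V - {w}" "v \<in> V - {w}" "{u, par u} = {v, par v}" "u \<noteq> v"
  then have "u = par v" "v = par u" by (auto simp: doubleton_eq_iff)
  then have "d u < d v" "d v < d u" using par_less uv by (metis DiffE singletonI)+
  then show False by simp
qed

end

text \<open>Breadth-first parents: the edge count forces every edge to join a vertex to its parent.\<close>

lemma tree_rooted:
  assumes fin: "finite V"
    and edge: "\<forall>e\<in>E. \<exists>a b. a \<noteq> b \<and> a \<in> V \<and> b \<in> V \<and> e = {a, b}"
    and conn: "connected_on E V" and cnt: "card E + 1 = card V" and w: "w \<in> V"
  obtains par d where "rooted V E w par d"
proof -
  define d where "d v = (LEAST k. (w, v) \<in> adj E V ^^ k)" for v
  have ex: "\<exists>u. u \<in> V \<and> {v, u} \<in> E \<and> d u < d v" if v: "v \<in> V" "v \<noteq> w" for v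
  proof -
    have "\<exists>k. (w, v) \<in> adj E V ^^ k"
      using conn v w unfolding connected_on_def by (meson rtrancl_imp_relpow)
    then have dv: "(w, v) \<in> adj E V ^^ d v" unfolding d_def by (rule LeastI_ex)
    with v obtain m where m: "d v = Suc m" by (cases "d v") auto
    then obtain u where u: "(w, u) \<in> adj E V ^^ m" "(u, v) \<in> adj E V"
      using dv by auto
    have "d u \<le> m" unfolding d_def by (rule Least_le) (rule u(1))
    then show ?thesis using u(2) m by (auto simp: adj_def insert_commute intro!: exI[of _ u])
  qed
  define par where "par v = (SOME u. u \<in> V \<and> {v, u} \<in> E \<and> d u < d v)" for v
  have par: "par v \<in> V" "{v, par v} \<in> E" "d (par v) < d v" if "v \<in> V" "v \<noteq> w" for v
    using someI_ex[OF ex[OF that]] unfolding par_def by blast+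
  have inj: "inj_on (\<lambda>v. {v, par v}) (V - {w})"
  proof (rule inj_onI, rule ccontr)
    fix u v assume uv: "u \<in> V - {w}" "v \<in> V - {w}" "{u, par u} = {v, par v}" "u \<noteq> v"
    then have "u = par v" "v = par u" by (auto simp: doubleton_eq_iff)
    then have "d u < d v" "d v < d u" using par(3) uv by (metis DiffE singletonI)+
    then show False by simp
  qed
  have "E \<subseteq> Pow V" using edge by auto
  then have "finite E" using fin by (simp add: finite_subset)
  moreover have "(\<lambda>v. {v, par v}) ` (V - {w}) \<subseteq> E" using par by auto
  moreover have "card ((\<lambda>v. {v, par v}) ` (V - {w})) = card E"
    using card_image[OF inj] cnt fin w by simp
  ultimately have "E = (\<lambda>v. {v, par v}) ` (V - {w})" using card_subset_eq by blast
  then have "rooted V E w par d" using fin w par by unfold_locales auto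
  then show ?thesis by (rule that)
qed

lemma stable_rooted:
  assumes "stable_tree n G" "w \<in> iv G"
  obtains par d where "rooted (iv G) (ie G) w par d"
  using assms tree_rooted[of "iv G" "ie G" w] unfolding stable_tree_def by blast

section \<open>Separation of leaves by internal vertices\<close>

text \<open>The clause \<open>i = j\<close> makes a leaf attached to \<open>F\<close> itself a
  singleton class, in agreement with the singleton blocks of \<open>bp_blocks\<close>.\<close>

definition sep :: "nat \<Rightarrow> ltree \<Rightarrow> nat set \<Rightarrow> (nat \<times> nat) set" where
  "sep n G F = {(i, j). i \<in> {1..n} \<and> j \<in> {1..n} \<and> (i = j \<or>
     lf G i \<notin> F \<and> lf G j \<notin> F \<and> (lf G i, lf G j) \<in> (adj (ie G) (iv G - F))\<^sup>*)}"

lemma sep_equiv: "equiv {1..n} (sep n G F)"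
proof (rule equivI)
  show "sep n G F \<subseteq> {1..n} \<times> {1..n}" by (auto simp: sep_def)
  show "refl_on {1..n} (sep n G F)" by (auto simp: sep_def refl_on_def)
  show "sym (sep n G F)" by (auto simp: sep_def sym_def intro: adj_sym)
  show "trans (sep n G F)" unfolding trans_def sep_def by (auto intro: rtrancl_trans)
qed

lemma stable_lf: "stable_tree n G \<Longrightarrow> i \<in> {1..n} \<Longrightarrow> lf G i \<in> iv G"
  by (simp add: stable_tree_def)

lemma stable_edge:
  assumes "stable_tree n G" "{a, b} \<in> ie G"
  shows "a \<in> iv G \<and> b \<in> iv G \<and> a \<noteq> b"
proof -
  have "\<forall>e\<in>ie G. \<exists>a b. a \<noteq> b \<and> a \<in> iv G \<and> b \<in> iv G \<and> e = {a, b}"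
    using assms(1) unfolding stable_tree_def by (elim conjE)
  then obtain c d where "c \<noteq> d" "c \<in> iv G" "d \<in> iv G" "{a, b} = {c, d}"
    using assms(2) by (metis (no_types))
  then show ?thesis by (auto simp: doubleton_eq_iff)
qed

text \<open>Two leaves are separated by \<open>F\<close> as soon as one vertex of \<open>F\<close>
  lies between them. Rooting the tree inside \<open>F\<close> makes the connected set
  \<open>F\<close> closed under parents, the form that \<open>connected_avoiding\<close> works
  with.\<close>

lemma sep_Inter:
  assumes st: "stable_tree n G" and F: "F \<subseteq> iv G" "F \<noteq> {}" "connected_on (ie G) F"
  shows "(i, j) \<in> sep n G F \<longleftrightarrow> (\<forall>v\<in>F. (i, j) \<in> sep n G {v})"
proof
  assume ij: "(i, j) \<in> sep n G F"
  show "\<forall>v\<in>F. (i, j) \<in> sep n G {v}"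
  proof
    fix v assume "v \<in> F"
    then have "(adj (ie G) (iv G - F))\<^sup>* \<subseteq> (adj (ie G) (iv G - {v}))\<^sup>*"
      by (intro adj_mono) auto
    then show "(i, j) \<in> sep n G {v}" using ij \<open>v \<in> F\<close> by (auto simp: sep_def)
  qed
next
  assume *: "\<forall>v\<in>F. (i, j) \<in> sep n G {v}"
  obtain w where w: "w \<in> F" using F by auto
  then have ij: "i \<in> {1..n}" "j \<in> {1..n}" using * by (auto simp: sep_def)
  show "(i, j) \<in> sep n G F"
  proof (cases "i = j")
    case True
    then show ?thesis using ij by (auto simp: sep_def)
  next
    case False
    then have av: "lf G i \<noteq> v" "lf G j \<noteq> v" "(lf G i, lf G j) \<in> (adj (ie G) (iv G - {v}))\<^sup>*"
      if "v \<in> F" for v using * that by (auto simp: sep_def)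
    obtain par d where r: "rooted (iv G) (ie G) w par d"
      using stable_rooted[OF st] w F by blast
    then interpret rooted "iv G" "ie G" w par d .
    have "(lf G i, lf G j) \<in> (adj (ie G) (iv G - F))\<^sup>*"
    proof (rule connected_avoiding[OF w])
      show "par f \<in> F" if "f \<in> F" "f \<noteq> w" for f
        using connected_imp_par_closed F w that by blast
      show "lf G i \<in> iv G - F" using stable_lf[OF st ij(1)] av(1) by blast
      show "(lf G i, lf G j) \<in> (adj (ie G) (iv G - {v}))\<^sup>*" if "v \<in> F" for v
        using av(3)[OF that] .
    qed
    moreover have "lf G i \<notin> F"
    proof
      assume "lf G i \<in> F"
      from av(1)[OF this] show False by simp
    qed
    moreover have "lf G j \<notin> F"
    proof
      assume "lf G j \<in> F"
      from av(2)[OF this] show False by simp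
    qed
    ultimately show ?thesis using ij unfolding sep_def by simp
  qed
qed

lemma sep_all: "stable_tree n G \<Longrightarrow> sep n G (iv G) = Id_on {1..n}"
  by (auto simp: sep_def dest: stable_lf)

text \<open>Walks avoiding the fibre project to walks avoiding \<open>v'\<close>, steps inside a
  fibre becoming stationary. Conversely a walk below is lifted edge by edge, and connectedness of
  the fibres joins the end of one lifted edge to the start of the next.\<close>

lemma sep_contracts:
  assumes c: "contracts n G G' \<pi>" and v': "v' \<in> iv G'"
  shows "sep n G' {v'} = sep n G {v \<in> iv G. \<pi> v = v'}"
proof -
  let ?F = "{v \<in> iv G. \<pi> v = v'}"
  have st: "stable_tree n G" using c unfolding contracts_def by (elim conjE)
  have im: "\<pi> ` iv G = iv G'" using c unfolding contracts_def by (elim conjE)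
  have fib: "connected_on (ie G) {v \<in> iv G. \<pi> v = u}" if "u \<in> iv G'" for u
    using c that unfolding contracts_def by (elim conjE) (erule bspec)
  have ed: "ie G' = {{\<pi> a, \<pi> b} | a b. {a, b} \<in> ie G \<and> \<pi> a \<noteq> \<pi> b}"
    using c unfolding contracts_def by (elim conjE)
  have l: "lf G' i = \<pi> (lf G i)" if "i \<in> {1..n}" for i
    using c that unfolding contracts_def by (elim conjE) (erule bspec)
  have down: "(\<pi> x, \<pi> y) \<in> (adj (ie G') (iv G' - {v'}))\<^sup>*"
    if "(x, y) \<in> (adj (ie G) (iv G - ?F))\<^sup>*" for x y
    using that
  proof (induction rule: rtrancl_induct)
    case (step y z)
    then have yz: "y \<in> iv G" "\<pi> y \<noteq> v'" "z \<in> iv G" "\<pi> z \<noteq> v'" "{y, z} \<in> ie G"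
      by (auto simp: adj_def)
    show ?case
    proof (cases "\<pi> y = \<pi> z")
      case False
      then have "(\<pi> y, \<pi> z) \<in> adj (ie G') (iv G' - {v'})"
      proof -
        have "\<pi> y \<in> iv G'" "\<pi> z \<in> iv G'" using yz im by blast+
        moreover have "{\<pi> y, \<pi> z} \<in> ie G'" unfolding ed using yz(5) False by blast
        ultimately show ?thesis using yz by (simp add: adj_def)
      qed
      then show ?thesis using step.IH by (rule rtrancl_into_rtrancl[rotated])
    qed (use step.IH in simp)
  qed simp
  have fibc: "(x, y) \<in> (adj (ie G) (iv G - ?F))\<^sup>*"
    if "x \<in> iv G" "y \<in> iv G" "\<pi> x = \<pi> y" "\<pi> x \<noteq> v'" for x y
  proof -
    have "\<pi> x \<in> iv G'" using im that(1) by blast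
    then have "(x, y) \<in> (adj (ie G) {v \<in> iv G. \<pi> v = \<pi> x})\<^sup>*"
      using fib[of "\<pi> x"] that unfolding connected_on_def by simp
    moreover have "{v \<in> iv G. \<pi> v = \<pi> x} \<subseteq> iv G - ?F" using that by auto
    ultimately show ?thesis using adj_mono[of _ _ "ie G"] by (metis (lifting) subsetD)
  qed
  have lift: "(x, y) \<in> (adj (ie G) (iv G - ?F))\<^sup>*"
    if "(p, q) \<in> (adj (ie G') (iv G' - {v'}))\<^sup>*" "x \<in> iv G" "\<pi> x = p" "p \<noteq> v'"
      "y \<in> iv G" "\<pi> y = q" for p q x y
    using that(1,5,6)
  proof (induction arbitrary: y rule: rtrancl_induct)
    case base
    then show ?case using fibc[of x y] that(2-4) by simp
  next
    case (step q r)
    then have qr: "q \<noteq> v'" "r \<noteq> v'" "{q, r} \<in> ie G'" by (auto simp: adj_def)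
    from qr(3) obtain a b where ab: "{q, r} = {\<pi> a, \<pi> b}" "{a, b} \<in> ie G" unfolding ed by blast
    \<comment> \<open>Edges are unordered, so the preimage edge may have to be reversed to follow
      the direction of the walk.\<close>
    have "\<exists>a b. q = \<pi> a \<and> r = \<pi> b \<and> {a, b} \<in> ie G"
    proof (cases "q = \<pi> a")
      case True
      then show ?thesis using ab by (metis doubleton_eq_iff)
    next
      case False
      then have "q = \<pi> b" "r = \<pi> a" using ab(1) by (auto simp: doubleton_eq_iff)
      then show ?thesis using ab(2) by (metis insert_commute)
    qed
    then obtain a b where ab: "q = \<pi> a" "r = \<pi> b" "{a, b} \<in> ie G" by blast
    then have abV: "a \<in> iv G" "b \<in> iv G" using stable_edge[OF st] by blast+
    have "(x, a) \<in> (adj (ie G) (iv G - ?F))\<^sup>*" using step.IH[OF abV(1) ab(1)[symmetric]] .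
    moreover have "(a, b) \<in> adj (ie G) (iv G - ?F)" using ab abV qr by (auto simp: adj_def)
    moreover have "(b, y) \<in> (adj (ie G) (iv G - ?F))\<^sup>*"
      using fibc[of b y] abV ab qr step.prems by simp
    ultimately show ?case by (meson rtrancl_into_rtrancl rtrancl_trans)
  qed
  show ?thesis
  proof (rule set_eqI)
    fix p :: "nat \<times> nat"
    obtain i j where p: "p = (i, j)" by fastforce
    show "p \<in> sep n G' {v'} \<longleftrightarrow> p \<in> sep n G ?F"
    proof (cases "i \<in> {1..n} \<and> j \<in> {1..n}")
      case True
      then have lv: "lf G i \<in> iv G" "lf G j \<in> iv G" using stable_lf[OF st] by auto
      have "(lf G' i, lf G' j) \<in> (adj (ie G') (iv G' - {v'}))\<^sup>* \<longleftrightarrow>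
            (lf G i, lf G j) \<in> (adj (ie G) (iv G - ?F))\<^sup>*" if "lf G' i \<noteq> v'"
      proof
        assume *: "(lf G' i, lf G' j) \<in> (adj (ie G') (iv G' - {v'}))\<^sup>*"
        show "(lf G i, lf G j) \<in> (adj (ie G) (iv G - ?F))\<^sup>*"
          by (rule lift[OF * lv(1) _ _ lv(2)]) (use l True that in simp_all)
      next
        assume "(lf G i, lf G j) \<in> (adj (ie G) (iv G - ?F))\<^sup>*"
        from down[OF this] show "(lf G' i, lf G' j) \<in> (adj (ie G') (iv G' - {v'}))\<^sup>*"
          using l True by simp
      qed
      then show ?thesis unfolding p sep_def using True lv l by auto
    qed (auto simp: p sep_def)
  qed
qed

section \<open>Branches at a vertex and their label sets\<close>

definition branch :: "nat \<Rightarrow> ltree \<Rightarrow> nat \<Rightarrow> nat \<Rightarrow> nat set" where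
  "branch n G w u = {j \<in> {1..n}. lf G j \<in> iv G - {w} \<and>
     (u, lf G j) \<in> (adj (ie G) (iv G - {w}))\<^sup>*}"

text \<open>Different children of the root lie in different components once the root is deleted,
  since a subtree below a child opens only to the root.\<close>

lemma (in rooted) child_connected_eq:
  assumes "a \<in> V - {w}" "b \<in> V - {w}" "par a = w" "par b = w"
    and "(a, b) \<in> (adj E (V - {w}))\<^sup>*"
  shows "a = b"
proof (rule ccontr)
  assume "a \<noteq> b"
  have "b \<in> desc a" using desc_closed[of a b a] assms desc_self by auto
  then show False using desc_par[of b a] \<open>a \<noteq> b\<close> root_notin_desc assms by auto
qed

text \<open>A childless vertex below \<open>u\<close> has at most its parent edge, so degree three
  forces two leaves there.\<close>

lemma card_branch:
  assumes st: "stable_tree n G" and w: "w \<in> iv G" and u: "u \<in> iv G - {w}"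
  shows "2 \<le> card (branch n G w u)"
proof -
  obtain par d where "rooted (iv G) (ie G) w par d" using stable_rooted[OF st w] .
  then interpret rooted "iv G" "ie G" w par d .
  obtain c where c: "c \<in> desc u" "\<And>v. v \<in> iv G \<Longrightarrow> v \<noteq> w \<Longrightarrow> par v \<noteq> c"
    using desc_has_childless u by blast
  have cV: "c \<in> iv G" "desc u \<subseteq> iv G - {w}" "c \<noteq> w"
    using c(1) desc_sub root_notin_desc[of u] u by auto
  have "{e \<in> ie G. c \<in> e} \<subseteq> {{c, par c}}" using c(2) by (auto simp: edges)
  then have "card {e \<in> ie G. c \<in> e} \<le> 1" using card_mono[of "{{c, par c}}"] by fastforce
  moreover have "card {e \<in> ie G. c \<in> e} + card {i \<in> {1..n}. lf G i = c} \<ge> 3"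
    using st cV(1) unfolding stable_tree_def by blast
  ultimately have "2 \<le> card {i \<in> {1..n}. lf G i = c}" by linarith
  moreover have "(u, c) \<in> (adj (ie G) (iv G - {w}))\<^sup>*"
    using desc_connected[OF c(1)] adj_sym adj_mono[OF cV(2)] by blast
  then have "{i \<in> {1..n}. lf G i = c} \<subseteq> branch n G w u"
    using cV by (auto simp: branch_def)
  then have "card {i \<in> {1..n}. lf G i = c} \<le> card (branch n G w u)"
    by (rule card_mono[rotated]) (simp add: branch_def)
  ultimately show ?thesis by linarith
qed

lemma branch_nonempty:
  assumes "stable_tree n G" "w \<in> iv G" "u \<in> iv G - {w}"
  obtains j where "j \<in> branch n G w u"
  using card_branch[OF assms] by (metis card.empty ex_in_conv not_numeral_le_zero)

lemma sep_iff_branch: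
  assumes "j \<in> branch n G w u"
  shows "(j, i) \<in> sep n G {w} \<longleftrightarrow> i \<in> branch n G w u"
proof -
  have j: "j \<in> {1..n}" "lf G j \<in> iv G - {w}" "(u, lf G j) \<in> (adj (ie G) (iv G - {w}))\<^sup>*"
    using assms by (auto simp: branch_def)
  have "(lf G j, lf G i) \<in> (adj (ie G) (iv G - {w}))\<^sup>* \<longleftrightarrow>
        (u, lf G i) \<in> (adj (ie G) (iv G - {w}))\<^sup>*"
    using j(3) adj_sym by (meson rtrancl_trans)
  moreover have "(lf G j, lf G i) \<in> (adj (ie G) (iv G - {w}))\<^sup>* \<Longrightarrow> lf G i \<in> iv G - {w}"
    using adj_rtrancl_in j(2) by metis
  ultimately show ?thesis using j by (auto simp: sep_def branch_def)
qed

lemma branch_eq_class: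
  "j \<in> branch n G w u \<Longrightarrow> branch n G w u = sep n G {w} `` {j}"
  using sep_iff_branch by blast

text \<open>Holds at every internal vertex, not only at the centre of a basic pair, so that all
  vertices can be compared with the given partitions.\<close>

lemma bp_blocks_eq_quotient:
  assumes st: "stable_tree n G" and w: "w \<in> iv G"
  shows "bp_blocks n G w = {1..n} // sep n G {w}"
proof -
  have bp: "bp_blocks n G w = branch n G w ` (iv G - {w}) \<union> (\<lambda>i. {i}) ` {i \<in> {1..n}. lf G i = w}"
    unfolding bp_blocks_def branch_def ..
  show ?thesis unfolding bp
  proof (intro subset_antisym subsetI)
    fix B assume "B \<in> branch n G w ` (iv G - {w}) \<union> (\<lambda>i. {i}) ` {i \<in> {1..n}. lf G i = w}"
    then show "B \<in> {1..n} // sep n G {w}"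
    proof
      assume "B \<in> branch n G w ` (iv G - {w})"
      then obtain u where u: "u \<in> iv G - {w}" "B = branch n G w u" by blast
      then obtain j where j: "j \<in> branch n G w u" using branch_nonempty[OF st w] by blast
      then have "j \<in> {1..n}" by (simp add: branch_def)
      then show ?thesis using branch_eq_class[OF j] u by (auto simp: quotient_def)
    next
      assume "B \<in> (\<lambda>i. {i}) ` {i \<in> {1..n}. lf G i = w}"
      then obtain i where i: "i \<in> {1..n}" "lf G i = w" "B = {i}" by blast
      then have "sep n G {w} `` {i} = {i}" by (auto simp: sep_def)
      then show ?thesis using i by (auto simp: quotient_def)
    qed
  next
    fix B assume "B \<in> {1..n} // sep n G {w}"
    then obtain i where i: "i \<in> {1..n}" "B = sep n G {w} `` {i}" by (rule quotientE)
    show "B \<in> branch n G w ` (iv G - {w}) \<union> (\<lambda>i. {i}) ` {i \<in> {1..n}. lf G i = w}"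
    proof (cases "lf G i = w")
      case True
      then have "B = {i}" using i by (auto simp: sep_def)
      then show ?thesis using i True by blast
    next
      case False
      then have l: "lf G i \<in> iv G - {w}" using stable_lf[OF st i(1)] by blast
      then have "i \<in> branch n G w (lf G i)" using i by (simp add: branch_def)
      then show ?thesis using branch_eq_class i l by blast
    qed
  qed
qed

lemma bp_partition_eq:
  "stable_tree n G \<Longrightarrow> w \<in> iv G \<Longrightarrow> bp_partition n G w = ptype ({1..n} // sep n G {w})"
  unfolding bp_partition_def ptype_def by (simp add: bp_blocks_eq_quotient)

text \<open>The degree condition at \<open>w\<close> in terms of leaves: choose one leaf from the
  branch of every child of \<open>w\<close> and add the leaves at \<open>w\<close> itself. These are
  as many as the degree of \<open>w\<close> and pairwise separated.\<close>

lemma sep_transversal: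
  assumes st: "stable_tree n G" and w: "w \<in> iv G"
  obtains X where "X \<subseteq> {1..n}" "3 \<le> card X"
    "\<And>x y. x \<in> X \<Longrightarrow> y \<in> X \<Longrightarrow> (x, y) \<in> sep n G {w} \<Longrightarrow> x = y"
proof -
  obtain par d where "rooted (iv G) (ie G) w par d" using stable_rooted[OF st w] .
  then interpret rooted "iv G" "ie G" w par d .
  define ch where "ch = {a \<in> iv G - {w}. par a = w}"
  define f where "f a = (SOME j. j \<in> branch n G w a)" for a
  have f: "f a \<in> branch n G w a" if "a \<in> ch" for a
    using branch_nonempty[OF st w, of a] that unfolding f_def ch_def by (metis (mono_tags) CollectD someI)
  have f_eq: "a = b" if "a \<in> ch" "b \<in> ch" "(f a, f b) \<in> sep n G {w}" for a b
  proof -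
    have "f b \<in> branch n G w a" using that f sep_iff_branch by blast
    then have "(a, lf G (f b)) \<in> (adj (ie G) (iv G - {w}))\<^sup>*"
      "(b, lf G (f b)) \<in> (adj (ie G) (iv G - {w}))\<^sup>*"
      using f[OF that(2)] by (auto simp: branch_def)
    then have "(a, b) \<in> (adj (ie G) (iv G - {w}))\<^sup>*" using adj_sym by (meson rtrancl_trans)
    then show ?thesis using child_connected_eq[of a b] that(1,2) unfolding ch_def by simp
  qed
  have f_in: "f a \<in> {1..n}" "lf G (f a) \<noteq> w" if "a \<in> ch" for a
    using f[OF that] by (auto simp: branch_def)
  have inj: "inj_on f ch"
    using f_eq f_in by (intro inj_onI) (auto simp: sep_def)
  define X where "X = f ` ch \<union> {i \<in> {1..n}. lf G i = w}"
  have fin: "finite ch" unfolding ch_def using fin_V by auto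
  have "{e \<in> ie G. w \<in> e} = (\<lambda>v. {v, par v}) ` ch" by (auto simp: edges ch_def)
  moreover have "inj_on (\<lambda>v. {v, par v}) ch" using edge_inj by (rule inj_on_subset) (auto simp: ch_def)
  ultimately have "card {e \<in> ie G. w \<in> e} = card ch" by (simp add: card_image)
  moreover have "card X = card ch + card {i \<in> {1..n}. lf G i = w}"
    unfolding X_def using f_in fin inj by (subst card_Un_disjoint) (auto simp: card_image)
  moreover have "card {e \<in> ie G. w \<in> e} + card {i \<in> {1..n}. lf G i = w} \<ge> 3"
    using st w unfolding stable_tree_def by blast
  ultimately have "3 \<le> card X" by linarith
  moreover have "X \<subseteq> {1..n}" using f_in by (auto simp: X_def)
  moreover have "x = y" if xy: "x \<in> X" "y \<in> X" "(x, y) \<in> sep n G {w}" for x y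
  proof (cases "lf G x = w \<or> lf G y = w")
    case True
    then show ?thesis using xy(3) by (auto simp: sep_def)
  next
    case False
    then show ?thesis using xy f_eq by (auto simp: X_def)
  qed
  ultimately show ?thesis using that by blast
qed

section \<open>Trees of laminar families\<close>

text \<open>A laminar family of subsets of \<open>{1..n}\<close> containing \<open>{1..n}\<close> is the vertex set of a tree rooted
  at \<open>{1..n}\<close>; \<^const>\<open>set_encode\<close> turns the sets into natural numbers.\<close>

definition hull :: "nat set set \<Rightarrow> nat set \<Rightarrow> nat set" where
  "hull L X = \<Inter>{B \<in> L. X \<subseteq> B}"

text \<open>For \<open>A = {1..n}\<close> no member qualifies and the intersection is the whole
  type, hence the exclusion of \<open>{1..n}\<close> in the edges of \<open>htree\<close>.\<close>

definition parent :: "nat set set \<Rightarrow> nat set \<Rightarrow> nat set" where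
  "parent L A = \<Inter>{B \<in> L. A \<subset> B}"

definition htree :: "nat \<Rightarrow> nat set set \<Rightarrow> ltree" where
  "htree n L = (set_encode ` L,
     (\<lambda>A. {set_encode A, set_encode (parent L A)}) ` (L - {{1..n}}),
     \<lambda>i. set_encode (hull L {i}))"

lemma htree_simps [simp]:
  "iv (htree n L) = set_encode ` L"
  "ie (htree n L) = (\<lambda>A. {set_encode A, set_encode (parent L A)}) ` (L - {{1..n}})"
  "lf (htree n L) = (\<lambda>i. set_encode (hull L {i}))"
  by (simp_all add: htree_def iv_def ie_def lf_def)

text \<open>The conditions are tuned to stability. \<open>card2\<close> excludes singletons, which
  would be vertices with a single leaf below them. \<open>three\<close> is the degree condition at
  the root, which has no parent edge: three leaves of which no proper member contains two.\<close>

locale hierarchy =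
  fixes n :: nat and L :: "nat set set"
  assumes sub: "A \<in> L \<Longrightarrow> A \<subseteq> {1..n}"
    and card2: "A \<in> L \<Longrightarrow> 2 \<le> card A"
    and top: "{1..n} \<in> L"
    and laminar: "A \<in> L \<Longrightarrow> B \<in> L \<Longrightarrow> A \<inter> B \<noteq> {} \<Longrightarrow> A \<subseteq> B \<or> B \<subseteq> A"
    and three: "\<exists>X\<subseteq>{1..n}. 3 \<le> card X \<and>
      (\<forall>A\<in>L. A \<noteq> {1..n} \<longrightarrow> (\<forall>x\<in>X. \<forall>y\<in>X. x \<in> A \<and> y \<in> A \<longrightarrow> x = y))"
begin

lemma fin_L: "finite L"
  using sub by (meson Pow_iff finite_Pow_iff finite_atLeastAtMost finite_subset subsetI)

lemma fin_mem: "A \<in> L \<Longrightarrow> finite A"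
  using sub finite_subset by blast

lemma nonempty: "A \<in> L \<Longrightarrow> A \<noteq> {}"
  using card2 by fastforce

lemma enc_eq: "A \<in> L \<Longrightarrow> B \<in> L \<Longrightarrow> set_encode A = set_encode B \<longleftrightarrow> A = B"
  using fin_mem set_encode_eq by blast

lemma dec_enc: "A \<in> L \<Longrightarrow> set_decode (set_encode A) = A"
  using fin_mem by simp

lemma hull_in:
  assumes "X \<noteq> {}" "X \<subseteq> {1..n}"
  shows "hull L X \<in> L"
proof -
  have "\<Inter>{B \<in> L. X \<subseteq> B} \<in> {B \<in> L. X \<subseteq> B}"
  proof (rule finite_Inf_in)
    show "finite {B \<in> L. X \<subseteq> B}" using fin_L by simp
    show "{B \<in> L. X \<subseteq> B} \<noteq> {}" using top assms by auto
    fix A B assume AB: "A \<in> {B \<in> L. X \<subseteq> B}" "B \<in> {B \<in> L. X \<subseteq> B}"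
    then have "A \<inter> B \<noteq> {}" using assms by blast
    then have "A \<subseteq> B \<or> B \<subseteq> A" using laminar AB by blast
    then show "A \<inter> B \<in> {B \<in> L. X \<subseteq> B}" using AB by (auto simp: Int_absorb1 Int_absorb2)
  qed
  then show ?thesis by (simp add: hull_def)
qed

lemma hull_sup: "X \<subseteq> hull L X"
  by (auto simp: hull_def)

lemma hull_least: "B \<in> L \<Longrightarrow> X \<subseteq> B \<Longrightarrow> hull L X \<subseteq> B"
  by (auto simp: hull_def)

lemma hull_self: "A \<in> L \<Longrightarrow> hull L A = A"
  using hull_sup hull_least by blast

lemma parent_in:
  assumes "A \<in> L" "A \<noteq> {1..n}"
  shows "parent L A \<in> L \<and> A \<subset> parent L A"
proof -
  have "\<Inter>{B \<in> L. A \<subset> B} \<in> {B \<in> L. A \<subset> B}"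
  proof (rule finite_Inf_in)
    show "finite {B \<in> L. A \<subset> B}" using fin_L by simp
    show "{B \<in> L. A \<subset> B} \<noteq> {}" using top assms sub by blast
    fix B C assume BC: "B \<in> {B \<in> L. A \<subset> B}" "C \<in> {B \<in> L. A \<subset> B}"
    then have "B \<inter> C \<noteq> {}" using nonempty[OF assms(1)] by blast
    then have "B \<subseteq> C \<or> C \<subseteq> B" using laminar BC by blast
    then show "B \<inter> C \<in> {B \<in> L. A \<subset> B}" using BC by (auto simp: Int_absorb1 Int_absorb2)
  qed
  then show ?thesis by (simp add: parent_def)
qed

lemma parent_least: "B \<in> L \<Longrightarrow> A \<subset> B \<Longrightarrow> parent L A \<subseteq> B"
  by (auto simp: parent_def)

section \<open>Walks in the tree of a laminar family\<close>

lemma card_less: "A \<subset> B \<Longrightarrow> B \<in> L \<Longrightarrow> card A < card B"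
  using fin_mem psubset_card_mono by blast

text \<open>Repeated passage to the parent cannot jump over \<open>B\<close>, since the parent is
  the least proper superset. The walk is confined to the interval from \<open>A\<close> to
  \<open>B\<close> so that one can tell which vertices it avoids.\<close>

lemma walk_up:
  assumes "A \<in> L" "B \<in> L" "A \<subseteq> B"
  shows "(set_encode A, set_encode B) \<in>
    (adj (ie (htree n L)) (set_encode ` {C \<in> L. A \<subseteq> C \<and> C \<subseteq> B}))\<^sup>*"
  using assms
proof (induction "n - card A" arbitrary: A rule: less_induct)
  case less
  show ?case
  proof (cases "A = B")
    case False
    then have A: "A \<subset> B" "A \<noteq> {1..n}" using less.prems sub by blast+
    let ?P = "parent L A"
    have P: "?P \<in> L" "A \<subset> ?P" "?P \<subseteq> B"
      using parent_in[OF less.prems(1) A(2)] parent_least[OF less.prems(2) A(1)] by blast+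
    have "card A < card ?P" using card_less P by blast
    moreover have "card ?P \<le> n" using sub[OF P(1)] card_mono[of "{1..n}" ?P] by simp
    ultimately have "n - card ?P < n - card A" by linarith
    then have "(set_encode ?P, set_encode B) \<in>
        (adj (ie (htree n L)) (set_encode ` {C \<in> L. ?P \<subseteq> C \<and> C \<subseteq> B}))\<^sup>*"
      using less P by blast
    then have "(set_encode ?P, set_encode B) \<in>
        (adj (ie (htree n L)) (set_encode ` {C \<in> L. A \<subseteq> C \<and> C \<subseteq> B}))\<^sup>*"
      by (rule adj_mono') (use P in auto)
    moreover have "{set_encode A, set_encode ?P} \<in> ie (htree n L)"
      using less.prems(1) A(2) by auto
    then have "(set_encode A, set_encode ?P) \<in>
        adj (ie (htree n L)) (set_encode ` {C \<in> L. A \<subseteq> C \<and> C \<subseteq> B})"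
      using P less.prems A unfolding adj_def by blast
    ultimately show ?thesis by (rule converse_rtrancl_into_rtrancl[rotated])
  qed simp
qed

lemma walk_within:
  assumes "A \<in> L" "B \<in> L" "A \<subseteq> B" "{C \<in> L. A \<subseteq> C \<and> C \<subseteq> B} \<subseteq> S"
  shows "(set_encode A, set_encode B) \<in> (adj (ie (htree n L)) (set_encode ` S))\<^sup>*"
  using walk_up[OF assms(1-3)] by (rule adj_mono'[OF _ image_mono[OF assms(4)]])

lemma walk_between:
  assumes "A \<in> L" "A' \<in> L" "B \<in> L" "A \<subseteq> B" "A' \<subseteq> B"
    "\<And>C. C \<in> L \<Longrightarrow> C \<subseteq> B \<Longrightarrow> A \<subseteq> C \<or> A' \<subseteq> C \<Longrightarrow> C \<in> S"
  shows "(set_encode A, set_encode A') \<in> (adj (ie (htree n L)) (set_encode ` S))\<^sup>*"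
proof -
  have "(set_encode A, set_encode B) \<in> (adj (ie (htree n L)) (set_encode ` S))\<^sup>*"
    "(set_encode A', set_encode B) \<in> (adj (ie (htree n L)) (set_encode ` S))\<^sup>*"
    by (rule walk_within[OF assms(1,3,4)], use assms(6) in blast)
      (rule walk_within[OF assms(2,3,5)], use assms(6) in blast)
  then show ?thesis using adj_sym by (meson rtrancl_trans)
qed

section \<open>Degrees and stability\<close>

lemma edge_inj: "inj_on (\<lambda>A. {set_encode A, set_encode (parent L A)}) (L - {{1..n}})"
proof (rule inj_onI, rule ccontr)
  fix A B assume AB: "A \<in> L - {{1..n}}" "B \<in> L - {{1..n}}"
    "{set_encode A, set_encode (parent L A)} = {set_encode B, set_encode (parent L B)}" "A \<noteq> B"
  have p: "parent L A \<in> L" "A \<subset> parent L A" "parent L B \<in> L" "B \<subset> parent L B"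
    using parent_in AB by auto
  have "set_encode A \<noteq> set_encode B" using enc_eq AB by blast
  then have "set_encode A = set_encode (parent L B)" "set_encode B = set_encode (parent L A)"
    using AB(3) by (auto simp: doubleton_eq_iff)
  then have "A = parent L B" "B = parent L A" using enc_eq p AB by blast+
  then show False using p by blast
qed

text \<open>By laminarity the members containing \<open>x\<close> form a chain, so the union of
  those properly inside \<open>A\<close> is the largest of them; \<open>hull L {x}\<close> shows
  that there is one. This is the child of \<open>A\<close> through which \<open>x\<close>
  hangs.\<close>

lemma child_containing:
  assumes "A \<in> L" "x \<in> A" "hull L {x} \<noteq> A"
  obtains C where "C \<in> L" "C \<noteq> {1..n}" "x \<in> C" "C \<subset> A" "parent L C = A"
proof -
  let ?S = "{C \<in> L. x \<in> C \<and> C \<subset> A}"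
  have x: "{x} \<subseteq> {1..n}" using assms sub by blast
  have "hull L {x} \<in> ?S"
    using hull_in[OF _ x] hull_sup[of "{x}"] hull_least[OF assms(1), of "{x}"] assms by auto
  have "\<Union>?S \<in> ?S"
  proof (rule finite_Sup_in)
    show "finite ?S" using fin_L by simp
    show "?S \<noteq> {}" using \<open>hull L {x} \<in> ?S\<close> by blast
    fix B C assume BC: "B \<in> ?S" "C \<in> ?S"
    then have "B \<inter> C \<noteq> {}" by blast
    then have "B \<subseteq> C \<or> C \<subseteq> B" using laminar BC by blast
    then show "B \<union> C \<in> ?S" using BC by (metis (lifting) Un_absorb1 Un_absorb2)
  qed
  then obtain M where M: "M = \<Union>?S" "M \<in> L" "x \<in> M" "M \<subset> A" by blast
  then have Mtop: "M \<noteq> {1..n}" using sub[OF assms(1)] by blast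
  have "parent L M \<subseteq> A" using parent_least assms(1) M by blast
  moreover have "\<not> parent L M \<subset> A"
  proof
    assume "parent L M \<subset> A"
    then have "parent L M \<in> ?S" using parent_in[OF M(2) Mtop] M by blast
    then have "parent L M \<subseteq> M" unfolding M(1) by blast
    then show False using parent_in[OF M(2) Mtop] by blast
  qed
  ultimately have "parent L M = A" by blast
  then show ?thesis using that M Mtop by blast
qed

text \<open>Every element of \<open>Y\<close> either is a leaf at \<open>A\<close> or hangs in a
  child of \<open>A\<close>, and no child takes two of them. So \<open>Y\<close> bounds the degree
  without the parent edge from below.\<close>

lemma card_children:
  assumes A: "A \<in> L" and Y: "Y \<subseteq> A"
    and sep: "\<And>C x y. C \<in> L \<Longrightarrow> C \<subset> A \<Longrightarrow> x \<in> Y \<Longrightarrow> y \<in> Y \<Longrightarrow> x \<in> C \<Longrightarrow> y \<in> C \<Longrightarrow> x = y"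
  shows "card Y \<le> card {C \<in> L - {{1..n}}. parent L C = A} + card {i \<in> {1..n}. hull L {i} = A}"
proof -
  let ?ch = "{C \<in> L - {{1..n}}. parent L C = A}"
  let ?Y1 = "{y \<in> Y. hull L {y} \<noteq> A}" and ?Y2 = "{y \<in> Y. hull L {y} = A}"
  have "finite Y" using Y fin_mem[OF A] finite_subset by blast
  define c where "c y = (SOME C. C \<in> ?ch \<and> y \<in> C \<and> C \<subset> A)" for y
  have c: "c y \<in> ?ch \<and> y \<in> c y \<and> c y \<subset> A" if "y \<in> ?Y1" for y
  proof -
    from that Y have "y \<in> A" "hull L {y} \<noteq> A" by auto
    then obtain C where "C \<in> L" "C \<noteq> {1..n}" "y \<in> C" "C \<subset> A" "parent L C = A"
      using child_containing[OF A] by blast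
    then have "\<exists>C. C \<in> ?ch \<and> y \<in> C \<and> C \<subset> A" by blast
    then show ?thesis unfolding c_def by (rule someI_ex)
  qed
  have "inj_on c ?Y1"
  proof (rule inj_onI)
    fix x y assume xy: "x \<in> ?Y1" "y \<in> ?Y1" "c x = c y"
    have "x \<in> c x" "y \<in> c x" "c x \<in> L" "c x \<subset> A" using c[OF xy(1)] c[OF xy(2)] xy(3) by auto
    then show "x = y" using sep xy by blast
  qed
  moreover have "c ` ?Y1 \<subseteq> ?ch" using c by blast
  moreover have "finite ?ch" using fin_L by simp
  ultimately have "card ?Y1 \<le> card ?ch" by (rule card_inj_on_le)
  moreover have "card ?Y2 \<le> card {i \<in> {1..n}. hull L {i} = A}"
    using Y sub[OF A] by (intro card_mono) auto
  moreover have Y12: "?Y1 \<union> ?Y2 = Y" by auto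
  have "card Y \<le> card ?Y1 + card ?Y2" using card_Un_le[of ?Y1 ?Y2] unfolding Y12 .
  ultimately show ?thesis by linarith
qed

lemma card_edges_at:
  assumes "A \<in> L"
  shows "card {e \<in> ie (htree n L). set_encode A \<in> e} =
    card {C \<in> L - {{1..n}}. parent L C = A} + (if A = {1..n} then 0 else 1)"
proof -
  let ?e = "\<lambda>A. {set_encode A, set_encode (parent L A)}"
  let ?ch = "{C \<in> L - {{1..n}}. parent L C = A}"
  have "set_encode A \<in> ?e C \<longleftrightarrow> C = A \<or> parent L C = A" if "C \<in> L - {{1..n}}" for C
    using enc_eq[OF assms] parent_in[of C] that by auto
  then have "{e \<in> ie (htree n L). set_encode A \<in> e} = ?e ` {C \<in> L - {{1..n}}. C = A \<or> parent L C = A}"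
    by auto
  then have "card {e \<in> ie (htree n L). set_encode A \<in> e} = card {C \<in> L - {{1..n}}. C = A \<or> parent L C = A}"
    by (simp only: card_image[OF inj_on_subset[OF edge_inj Collect_restrict]])
  also have "{C \<in> L - {{1..n}}. C = A \<or> parent L C = A} = ?ch \<union> (if A = {1..n} then {} else {A})"
    using assms by auto
  also have "card \<dots> = card ?ch + (if A = {1..n} then 0 else 1)"
  proof -
    have "A \<notin> ?ch" using parent_in[of A] by auto
    moreover have "finite ?ch" using fin_L by simp
    ultimately have "card (insert A ?ch) = Suc (card ?ch)" by (rule card_insert_disjoint[rotated])
    then show ?thesis
      by (simp only: Un_insert_right Un_empty_right if_False add_0_right Suc_eq_plus1 split: if_split)
        blast
  qed
  finally show ?thesis .
qed

lemma degree:
  assumes A: "A \<in> L"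
  shows "card {e \<in> ie (htree n L). set_encode A \<in> e}
    + card {i \<in> {1..n}. lf (htree n L) i = set_encode A} \<ge> 3"
proof -
  have lf: "lf (htree n L) i = set_encode A \<longleftrightarrow> hull L {i} = A" if "i \<in> {1..n}" for i
    using enc_eq[OF hull_in A, of "{i}"] that by simp
  have *: "{i \<in> {1..n}. lf (htree n L) i = set_encode A} = {i \<in> {1..n}. hull L {i} = A}"
    using lf by blast
  show ?thesis
  proof (cases "A = {1..n}")
    case True
    from three obtain X where X: "X \<subseteq> {1..n}" "3 \<le> card X"
      "\<forall>A\<in>L. A \<noteq> {1..n} \<longrightarrow> (\<forall>x\<in>X. \<forall>y\<in>X. x \<in> A \<and> y \<in> A \<longrightarrow> x = y)" by blast
    have "card X \<le> card {C \<in> L - {{1..n}}. parent L C = A} + card {i \<in> {1..n}. hull L {i} = A}"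
      using X True by (intro card_children[OF A]) blast+
    then show ?thesis using X(2) True unfolding * card_edges_at[OF A] by simp
  next
    case False
    obtain x where x: "x \<in> A" using nonempty[OF A] by blast
    \<comment> \<open>Away from the root the parent edge counts one, so two elements that share no
      smaller member suffice. If \<open>x\<close> is a leaf at \<open>A\<close>, any second element
      will do; otherwise take one outside the child through which \<open>x\<close> hangs, because a
      member containing both would lie strictly between that child and \<open>A\<close>.\<close>
    have "\<exists>y\<in>A. y \<noteq> x \<and> (\<forall>C\<in>L. C \<subset> A \<longrightarrow> \<not> (x \<in> C \<and> y \<in> C))"
    proof (cases "hull L {x} = A")
      case True
      have "A \<noteq> {x}" using card2[OF A] by auto
      then obtain y where "y \<in> A" "y \<noteq> x" using x by blast
      moreover have "\<not> x \<in> C" if "C \<in> L" "C \<subset> A" for C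
        using hull_least[of C "{x}"] that True by blast
      ultimately show ?thesis by blast
    next
      case False
      then obtain C where C: "C \<in> L" "C \<noteq> {1..n}" "x \<in> C" "C \<subset> A" "parent L C = A"
        using child_containing[OF A x] by blast
      then obtain y where y: "y \<in> A" "y \<notin> C" by blast
      have "\<not> (x \<in> D \<and> y \<in> D)" if D: "D \<in> L" "D \<subset> A" for D
      proof
        assume xy: "x \<in> D \<and> y \<in> D"
        then have "C \<subset> D" using laminar[OF C(1) D(1)] C(3) y by blast
        then show False using parent_least[OF D(1)] C(5) D(2) by blast
      qed
      then show ?thesis using y(1) y(2) C(3) by (intro bexI[of _ y] conjI ballI impI) auto
    qed
    then obtain y where y: "y \<in> A" "y \<noteq> x" "\<forall>C\<in>L. C \<subset> A \<longrightarrow> \<not> (x \<in> C \<and> y \<in> C)" by blast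
    have "card {x, y} \<le> card {C \<in> L - {{1..n}}. parent L C = A} + card {i \<in> {1..n}. hull L {i} = A}"
      using x y by (intro card_children[OF A]) blast+
    then show ?thesis using y(2) False unfolding * card_edges_at[OF A] by simp
  qed
qed

lemma stable: "stable_tree n (htree n L)"
  unfolding stable_tree_def
proof (intro conjI ballI)
  show "finite (iv (htree n L))" using fin_L by simp
  show "iv (htree n L) \<noteq> {}" using top by auto
  show "\<exists>a b. a \<noteq> b \<and> a \<in> iv (htree n L) \<and> b \<in> iv (htree n L) \<and> e = {a, b}"
    if e: "e \<in> ie (htree n L)" for e
  proof -
    from e obtain A where A: "A \<in> L" "A \<noteq> {1..n}" "e = {set_encode A, set_encode (parent L A)}" by auto
    then have "parent L A \<in> L" "A \<noteq> parent L A" using parent_in by blast+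
    then show ?thesis using A enc_eq[of A "parent L A"]
      by (intro exI[of _ "set_encode A"] exI[of _ "set_encode (parent L A)"]) simp
  qed
  show "connected_on (ie (htree n L)) (iv (htree n L))"
    unfolding connected_on_def
  proof (intro ballI)
    fix a b assume "a \<in> iv (htree n L)" "b \<in> iv (htree n L)"
    then obtain A B where "A \<in> L" "a = set_encode A" "B \<in> L" "b = set_encode B" by auto
    then show "(a, b) \<in> (adj (ie (htree n L)) (iv (htree n L)))\<^sup>*"
      using walk_between[OF _ _ top, of A B L] sub by simp
  qed
  have "card (ie (htree n L)) = card (L - {{1..n}})" using card_image[OF edge_inj] by simp
  moreover have "card (iv (htree n L)) = card L"
    using enc_eq by (simp add: card_image inj_on_def)
  moreover have "card (L - {{1..n}}) + 1 = card L" using top fin_L card_Suc_Diff1 by fastforce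
  ultimately show "card (ie (htree n L)) + 1 = card (iv (htree n L))" by linarith
  show "lf (htree n L) i \<in> iv (htree n L)" if "i \<in> {1..n}" for i
    using hull_in[of "{i}"] that by simp
  show "3 \<le> card {e \<in> ie (htree n L). v \<in> e} + card {i \<in> {1..n}. lf (htree n L) i = v}"
    if "v \<in> iv (htree n L)" for v
    using degree that by auto
qed

text \<open>Both leaves climb to the common member \<open>A\<close> without meeting
  \<open>X\<close>.\<close>

lemma sep_within:
  assumes X: "X \<in> L" and A: "A \<in> L" "i \<in> A" "j \<in> A"
    and avoid: "\<And>C. C \<in> L \<Longrightarrow> C \<subseteq> A \<Longrightarrow> i \<in> C \<or> j \<in> C \<Longrightarrow> C \<noteq> X"
  shows "(i, j) \<in> sep n (htree n L) {set_encode X}"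
proof -
  have ij: "i \<in> {1..n}" "j \<in> {1..n}" using sub[OF A(1)] A by auto
  have h: "hull L {i} \<in> L" "hull L {j} \<in> L" "hull L {i} \<subseteq> A" "hull L {j} \<subseteq> A"
    "i \<in> hull L {i}" "j \<in> hull L {j}"
    using hull_in ij hull_least[OF A(1)] A hull_sup[of "{i}"] hull_sup[of "{j}"] by simp_all
  have "set_encode ` (L - {X}) \<subseteq> iv (htree n L) - {set_encode X}"
    using enc_eq[OF _ X] by auto
  moreover have "(set_encode (hull L {i}), set_encode (hull L {j})) \<in>
      (adj (ie (htree n L)) (set_encode ` (L - {X})))\<^sup>*"
    using avoid h by (intro walk_between[OF h(1,2) A(1) h(3,4)]) blast
  ultimately have "(set_encode (hull L {i}), set_encode (hull L {j})) \<in>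
      (adj (ie (htree n L)) (iv (htree n L) - {set_encode X}))\<^sup>*"
    by (rule adj_mono'[rotated])
  moreover have "hull L {i} \<noteq> X" "hull L {j} \<noteq> X" using avoid h by blast+
  ultimately show ?thesis using ij h enc_eq[OF _ X] by (simp add: sep_def)
qed

lemma sep_top:
  "sep n (htree n L) {set_encode {1..n}} =
    {(i, j). i \<in> {1..n} \<and> j \<in> {1..n} \<and> (i = j \<or> (\<exists>A\<in>L. A \<noteq> {1..n} \<and> i \<in> A \<and> j \<in> A))}"
proof (intro subset_antisym subrelI)
  fix i j assume ij: "(i, j) \<in> sep n (htree n L) {set_encode {1..n}}"
  show "(i, j) \<in> {(i, j). i \<in> {1..n} \<and> j \<in> {1..n} \<and>
    (i = j \<or> (\<exists>A\<in>L. A \<noteq> {1..n} \<and> i \<in> A \<and> j \<in> A))}"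
  proof (cases "i = j")
    case True
    then show ?thesis using ij by (auto simp: sep_def)
  next
    case False
    then have ij': "i \<in> {1..n}" "j \<in> {1..n}" "hull L {i} \<noteq> {1..n}"
      and walk: "(set_encode (hull L {i}), set_encode (hull L {j})) \<in>
        (adj (ie (htree n L)) (iv (htree n L) - {set_encode {1..n}}))\<^sup>*"
      using ij by (auto simp: sep_def)
    \<comment> \<open>Invariant of a walk from the leaf \<open>i\<close> that avoids the root: the
      current member stays inside some proper member containing \<open>i\<close>. That member may
      have to grow when the walk climbs out of it.\<close>
    let ?C = "{set_encode B | B. B \<in> L \<and> (\<exists>A\<in>L. A \<noteq> {1..n} \<and> B \<subseteq> A \<and> i \<in> A)}"
    have hi: "hull L {i} \<in> L" "hull L {j} \<in> L" using hull_in ij' by simp_all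
    have "set_encode (hull L {j}) \<in> ?C"
      using walk
    proof (rule adj_rtrancl_closed)
      show "set_encode (hull L {i}) \<in> ?C" using hi ij' hull_sup[of "{i}"] by blast
      fix u v assume uv: "(u, v) \<in> adj (ie (htree n L)) (iv (htree n L) - {set_encode {1..n}})"
        and "u \<in> ?C"
      then obtain B A where B: "B \<in> L" "u = set_encode B" "A \<in> L" "A \<noteq> {1..n}" "B \<subseteq> A" "i \<in> A"
        by blast
      from uv obtain D where D: "D \<in> L" "v = set_encode D" "D \<noteq> {1..n}" by (auto simp: adj_def)
      from uv obtain C where C: "C \<in> L" "C \<noteq> {1..n}"
        "{u, v} = {set_encode C, set_encode (parent L C)}" by (auto simp: adj_def)
      note pC = parent_in[OF C(1,2)]
      have "B = C \<and> D = parent L C \<or> B = parent L C \<and> D = C"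
        using C(3) B(1,2) D(1,2) C(1) pC enc_eq by (metis doubleton_eq_iff)
      then show "v \<in> ?C"
      proof
        assume BD: "B = C \<and> D = parent L C"
        show ?thesis
        proof (cases "B = A")
          case True
          then show ?thesis using D B BD pC by blast
        next
          case False
          then have "D \<subseteq> A" using parent_least[of A C] B BD by blast
          then show ?thesis using D B by blast
        qed
      next
        assume "B = parent L C \<and> D = C"
        then show ?thesis using B D pC by blast
      qed
    qed
    then obtain B A where "B \<in> L" "set_encode (hull L {j}) = set_encode B"
      "A \<in> L" "A \<noteq> {1..n}" "B \<subseteq> A" "i \<in> A" by blast
    then have "hull L {j} \<subseteq> A" using enc_eq hi by blast
    then have "j \<in> A" using hull_sup[of "{j}"] by blast
    then show ?thesis using ij' \<open>A \<in> L\<close> \<open>A \<noteq> {1..n}\<close> \<open>i \<in> A\<close> by blast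
  qed
next
  fix i j assume "(i, j) \<in> {(i, j). i \<in> {1..n} \<and> j \<in> {1..n} \<and>
    (i = j \<or> (\<exists>A\<in>L. A \<noteq> {1..n} \<and> i \<in> A \<and> j \<in> A))}"
  then have ij: "i \<in> {1..n}" "j \<in> {1..n}" "i = j \<or> (\<exists>A\<in>L. A \<noteq> {1..n} \<and> i \<in> A \<and> j \<in> A)" by auto
  from ij(3) show "(i, j) \<in> sep n (htree n L) {set_encode {1..n}}"
  proof
    assume "i = j"
    then show ?thesis using ij by (simp add: sep_def)
  next
    assume "\<exists>A\<in>L. A \<noteq> {1..n} \<and> i \<in> A \<and> j \<in> A"
    then obtain A where A: "A \<in> L" "A \<noteq> {1..n}" "i \<in> A" "j \<in> A" by blast
    have "\<not> {1..n} \<subseteq> A" using sub[OF A(1)] A(2) by blast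
    then show ?thesis by (intro sep_within[OF top A(1,3,4)]) blast
  qed
qed

end

text \<open>Removing members from a laminar family contracts edges: each removed set merges into the
  least remaining set above it. Both stars and trees with one further level are obtained in this way
  from a common tree.\<close>

lemma hierarchy_contracts:
  assumes "hierarchy n L" "hierarchy n L'" and sub: "L' \<subseteq> L"
  shows "contracts n (htree n L) (htree n L') (\<lambda>v. set_encode (hull L' (set_decode v)))"
proof -
  interpret L: hierarchy n L by fact
  interpret L': hierarchy n L' by fact
  let ?\<pi> = "\<lambda>v. set_encode (hull L' (set_decode v))"
  have \<pi>: "?\<pi> (set_encode A) = set_encode (hull L' A)" if "A \<in> L" for A
    using L.dec_enc[OF that] by simp
  have h_in: "hull L' A \<in> L'" if "A \<in> L" for A
    using L'.hull_in[OF L.nonempty[OF that] L.sub[OF that]] .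
  have h_mono: "hull L' A \<subseteq> hull L' B" if "A \<subseteq> B" for A B
    using that by (auto simp: hull_def)
  have \<pi>_eq: "?\<pi> (set_encode A) = set_encode B \<longleftrightarrow> hull L' A = B" if "A \<in> L" "B \<in> L'" for A B
    using \<pi> h_in L'.enc_eq that by simp
  show ?thesis
    unfolding contracts_def
  proof (intro conjI ballI)
    show "stable_tree n (htree n L)" "stable_tree n (htree n L')"
      by (rule L.stable, rule L'.stable)
    show "?\<pi> ` iv (htree n L) = iv (htree n L')"
    proof (intro subset_antisym subsetI)
      fix v assume "v \<in> ?\<pi> ` iv (htree n L)"
      then show "v \<in> iv (htree n L')" using \<pi> h_in by auto
    next
      fix v assume "v \<in> iv (htree n L')"
      then obtain A where A: "A \<in> L'" "v = set_encode A" by auto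
      then have "A \<in> L" "?\<pi> (set_encode A) = v" using sub \<pi> L'.hull_self by auto
      then show "v \<in> ?\<pi> ` iv (htree n L)" by force
    qed
    show "connected_on (ie (htree n L)) {v \<in> iv (htree n L). ?\<pi> v = v'}"
      if "v' \<in> iv (htree n L')" for v'
    proof -
      from that obtain B where B: "B \<in> L'" "v' = set_encode B" by auto
      let ?S = "{A \<in> L. hull L' A = B}"
      have fib: "{v \<in> iv (htree n L). ?\<pi> v = v'} = set_encode ` ?S"
        using \<pi>_eq[OF _ B(1)] B(2) by auto
      have "(set_encode A, set_encode A') \<in> (adj (ie (htree n L)) (set_encode ` ?S))\<^sup>*"
        \<comment> \<open>Every \<open>C\<close> between such an \<open>A\<close> and
          \<open>B\<close> is in the fibre too, as its hull is squeezed between the hulls of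
          \<open>A\<close> and of \<open>B\<close>, both equal to \<open>B\<close>.\<close>
        if A: "A \<in> ?S" "A' \<in> ?S" for A A'
      proof (rule L.walk_between)
        show "A \<in> L" "A' \<in> L" "B \<in> L" "A \<subseteq> B" "A' \<subseteq> B"
          using A B sub L'.hull_sup by auto
        show "C \<in> ?S" if "C \<in> L" "C \<subseteq> B" "A \<subseteq> C \<or> A' \<subseteq> C" for C
          using h_mono[of C B] h_mono[of A C] h_mono[of A' C] that A L'.hull_self[OF B(1)] by auto
      qed
      then show ?thesis unfolding fib connected_on_def by blast
    qed
    have "ie (htree n L') \<subseteq> {{?\<pi> a, ?\<pi> b} | a b. {a, b} \<in> ie (htree n L) \<and> ?\<pi> a \<noteq> ?\<pi> b}"
    proof
      fix e assume "e \<in> ie (htree n L')"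
      then obtain A where A: "A \<in> L'" "A \<noteq> {1..n}" "e = {set_encode A, set_encode (parent L' A)}"
        by auto
      have AL: "A \<in> L" using A sub by blast
      note p = L.parent_in[OF AL A(2)] and p' = L'.parent_in[OF A(1,2)]
      have "hull L' (parent L A) = parent L' A"
      proof
        have "parent L A \<subseteq> parent L' A" using L.parent_least p' sub by blast
        then show "hull L' (parent L A) \<subseteq> parent L' A" using L'.hull_least p' by blast
        show "parent L' A \<subseteq> hull L' (parent L A)"
          by (rule L'.parent_least[OF h_in]) (use p L'.hull_sup[of "parent L A"] in blast)+
      qed
      then have "?\<pi> (set_encode A) = set_encode A"
        "?\<pi> (set_encode (parent L A)) = set_encode (parent L' A)"
        using \<pi> AL p L'.hull_self[OF A(1)] by simp_all
      moreover have "set_encode A \<noteq> set_encode (parent L' A)" using L'.enc_eq A(1) p' by blast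
      moreover have "{set_encode A, set_encode (parent L A)} \<in> ie (htree n L)" using AL A(2) by auto
      ultimately show "e \<in> {{?\<pi> a, ?\<pi> b} | a b. {a, b} \<in> ie (htree n L) \<and> ?\<pi> a \<noteq> ?\<pi> b}"
        unfolding A(3) by (intro CollectI exI[of _ "set_encode A"]
            exI[of _ "set_encode (parent L A)"]) simp
    qed
    moreover have "{{?\<pi> a, ?\<pi> b} | a b. {a, b} \<in> ie (htree n L) \<and> ?\<pi> a \<noteq> ?\<pi> b} \<subseteq> ie (htree n L')"
    proof
      fix e assume "e \<in> {{?\<pi> a, ?\<pi> b} | a b. {a, b} \<in> ie (htree n L) \<and> ?\<pi> a \<noteq> ?\<pi> b}"
      then obtain a b where ab: "e = {?\<pi> a, ?\<pi> b}" "{a, b} \<in> ie (htree n L)" "?\<pi> a \<noteq> ?\<pi> b" by blast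
      then obtain A where A: "A \<in> L" "A \<noteq> {1..n}"
        "{a, b} = {set_encode A, set_encode (parent L A)}" by auto
      note p = L.parent_in[OF A(1,2)]
      have "e = ?\<pi> ` {a, b}" using ab(1) by simp
      then have e: "e = {set_encode (hull L' A), set_encode (hull L' (parent L A))}"
        unfolding A(3) using \<pi> A(1) p by simp
      have ne: "hull L' A \<noteq> hull L' (parent L A)"
      proof
        assume "hull L' A = hull L' (parent L A)"
        then have "?\<pi> (set_encode A) = ?\<pi> (set_encode (parent L A))" using \<pi> A(1) p by simp
        then show False using ab(3) A(3) by (metis doubleton_eq_iff)
      qed
      \<comment> \<open>A removed \<open>A\<close> is properly contained in its hull, which
        therefore already contains the parent of \<open>A\<close>; such an edge is collapsed and
        cannot be the present one.\<close>
      have AL': "A \<in> L'"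
      proof (rule ccontr)
        assume "A \<notin> L'"
        then have "A \<noteq> hull L' A" using h_in[OF A(1)] by auto
        then have "A \<subset> hull L' A" using L'.hull_sup by blast
        then have "parent L A \<subseteq> hull L' A" using L.parent_least h_in[OF A(1)] sub by blast
        then have "hull L' (parent L A) \<subseteq> hull L' A" using L'.hull_least h_in[OF A(1)] by blast
        then show False using ne h_mono p by blast
      qed
      have p': "parent L' A \<in> L'" "A \<subset> parent L' A" using L'.parent_in[OF AL' A(2)] by blast+
      have "hull L' (parent L A) = parent L' A"
      proof
        have "parent L A \<subseteq> parent L' A" using L.parent_least p' sub by blast
        then show "hull L' (parent L A) \<subseteq> parent L' A" using L'.hull_least p' by blast
        show "parent L' A \<subseteq> hull L' (parent L A)"
          by (rule L'.parent_least[OF h_in]) (use p L'.hull_sup[of "parent L A"] in blast)+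
      qed
      then have "e = {set_encode A, set_encode (parent L' A)}" using e L'.hull_self[OF AL'] by simp
      then show "e \<in> ie (htree n L')" using AL' A(2) by auto
    qed
    ultimately show "ie (htree n L') =
        {{?\<pi> a, ?\<pi> b} | a b. {a, b} \<in> ie (htree n L) \<and> ?\<pi> a \<noteq> ?\<pi> b}" by (rule subset_antisym)
    show "lf (htree n L') i = ?\<pi> (lf (htree n L) i)" if i: "i \<in> {1..n}" for i
    proof -
      have h: "hull L {i} \<in> L" "hull L' {i} \<in> L'" using L.hull_in L'.hull_in i by simp_all
      have "hull L' (hull L {i}) = hull L' {i}"
      proof
        have "hull L {i} \<subseteq> hull L' {i}" using L.hull_least h sub L'.hull_sup by blast
        then show "hull L' (hull L {i}) \<subseteq> hull L' {i}" using L'.hull_least h by blast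
        show "hull L' {i} \<subseteq> hull L' (hull L {i})" using h_mono L.hull_sup by blast
      qed
      then show ?thesis using \<pi>[OF h(1)] by simp
    qed
  qed
qed

text \<open>Singleton blocks are dropped since they are leaves, not vertices.\<close>

definition fam :: "nat \<Rightarrow> nat set set \<Rightarrow> nat set set" where
  "fam n P = insert {1..n} {B \<in> P. 2 \<le> card B}"

text \<open>For a partition this says that there are at least three blocks. Giving the
  representatives explicitly lets the same \<open>X\<close> serve for every refinement.\<close>

definition transversal :: "nat \<Rightarrow> nat set set \<Rightarrow> nat set \<Rightarrow> bool" where
  "transversal n P X \<longleftrightarrow> X \<subseteq> {1..n} \<and> 3 \<le> card X \<and>
     (\<forall>B\<in>P. \<forall>x\<in>X. \<forall>y\<in>X. x \<in> B \<and> y \<in> B \<longrightarrow> x = y)"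

lemma transversal_proper:
  assumes "transversal n P X" "B \<in> P"
  shows "B \<noteq> {1..n}"
proof
  assume "B = {1..n}"
  with assms have X: "3 \<le> card X" "\<forall>x\<in>X. \<forall>y\<in>X. x = y"
    unfolding transversal_def by blast+
  from X(1) obtain x where "x \<in> X" by fastforce
  then have "X = {x}" using X(2) by blast
  then show False using X(1) by simp
qed

text \<open>A tree with two levels below the root, the blocks of \<open>P\<close> and under them
  those of \<open>P0\<close>. It contracts to the stars of both partitions and so carries
  information from one to the other.\<close>

lemma hierarchy_fam:
  assumes P: "partition_on {1..n} P" and P0: "partition_on {1..n} P0"
    and ref: "\<And>C. C \<in> P0 \<Longrightarrow> \<exists>B\<in>P. C \<subseteq> B" and X: "transversal n P X"
  shows "hierarchy n (fam n (P0 \<union> P))"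
proof
  have X': "transversal n (P0 \<union> P) X"
    unfolding transversal_def
  proof (intro conjI ballI impI)
    show "X \<subseteq> {1..n}" "3 \<le> card X" using X by (simp_all add: transversal_def)
    fix B x y assume B: "B \<in> P0 \<union> P" "x \<in> X" "y \<in> X" "x \<in> B \<and> y \<in> B"
    then obtain B' where "B' \<in> P" "B \<subseteq> B'" using ref by blast
    then show "x = y" using X B unfolding transversal_def by blast
  qed
  show "A \<subseteq> {1..n}" if "A \<in> fam n (P0 \<union> P)" for A
    using that partition_mem(1)[OF P] partition_mem(1)[OF P0] unfolding fam_def by blast
  show "2 \<le> card A" if "A \<in> fam n (P0 \<union> P)" for A
  proof -
    have "X \<subseteq> {1..n}" "3 \<le> card X" using X by (simp_all add: transversal_def)
    then have "3 \<le> card {1..n}" using card_mono[of "{1..n}" X] by simp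
    then show ?thesis using that by (auto simp: fam_def)
  qed
  show "{1..n} \<in> fam n (P0 \<union> P)" by (simp add: fam_def)
  show "A \<subseteq> B \<or> B \<subseteq> A" if AB: "A \<in> fam n (P0 \<union> P)" "B \<in> fam n (P0 \<union> P)" "A \<inter> B \<noteq> {}" for A B
  proof -
    have mixed: "C \<subseteq> D" if CD: "C \<in> P0" "D \<in> P" "C \<inter> D \<noteq> {}" for C D
    proof -
      obtain D' where D': "D' \<in> P" "C \<subseteq> D'" using ref[OF CD(1)] by blast
      then have "D' = D" using partition_mem(3)[OF P D'(1) CD(2)] CD(3) by blast
      then show ?thesis using D' by simp
    qed
    have top: "A \<subseteq> {1..n}" "B \<subseteq> {1..n}"
      using AB partition_mem(1)[OF P] partition_mem(1)[OF P0] unfolding fam_def by blast+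
    from AB(1,2) consider "A = {1..n} \<or> B = {1..n}" | "A \<in> P" "B \<in> P" | "A \<in> P0" "B \<in> P0"
      | "A \<in> P0" "B \<in> P" | "A \<in> P" "B \<in> P0" unfolding fam_def by blast
    then show ?thesis
    proof cases
      case 1 then show ?thesis using top by blast
    next
      case 2 then show ?thesis using partition_mem(3)[OF P 2 AB(3)] by simp
    next
      case 3 then show ?thesis using partition_mem(3)[OF P0 3 AB(3)] by simp
    next
      case 4 then show ?thesis using mixed[OF 4 AB(3)] by simp
    next
      case 5 then show ?thesis using mixed[OF 5(2,1)] AB(3) by blast
    qed
  qed
  show "\<exists>X\<subseteq>{1..n}. 3 \<le> card X \<and>
      (\<forall>A\<in>fam n (P0 \<union> P). A \<noteq> {1..n} \<longrightarrow> (\<forall>x\<in>X. \<forall>y\<in>X. x \<in> A \<and> y \<in> A \<longrightarrow> x = y))"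
    using X' unfolding transversal_def fam_def by (intro exI[of _ X]) blast
qed

lemma transversal_refine:
  assumes "\<And>C. C \<in> P0 \<Longrightarrow> \<exists>B\<in>P. C \<subseteq> B" "transversal n P X"
  shows "transversal n P0 X"
  unfolding transversal_def
proof (intro conjI ballI impI)
  show "X \<subseteq> {1..n}" "3 \<le> card X" using assms(2) by (simp_all add: transversal_def)
  fix B x y assume B: "B \<in> P0" "x \<in> X" "y \<in> X" "x \<in> B \<and> y \<in> B"
  then obtain B' where "B' \<in> P" "B \<subseteq> B'" using assms(1) by blast
  then show "x = y" using assms(2) B unfolding transversal_def by blast
qed

lemma hierarchy_star:
  assumes "partition_on {1..n} P" "transversal n P X"
  shows "hierarchy n (fam n P)"
proof -
  have "hierarchy n (fam n (P \<union> P))" by (rule hierarchy_fam[OF assms(1,1) _ assms(2)]) blast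
  then show ?thesis by simp
qed

lemma fam_mono: "P \<subseteq> P' \<Longrightarrow> fam n P \<subseteq> fam n P'"
  by (auto simp: fam_def)

text \<open>Singleton blocks are no members of \<open>fam n P\<close>; they come back as the
  diagonal of \<open>sep\<close>.\<close>

lemma sep_star:
  assumes P: "partition_on {1..n} P" and X: "transversal n P X"
  shows "{1..n} // sep n (htree n (fam n P)) {set_encode {1..n}} = P"
proof (rule quotient_eqI[OF P sep_equiv])
  interpret hierarchy n "fam n P" by (rule hierarchy_star[OF P X])
  fix x y
  show "(x, y) \<in> sep n (htree n (fam n P)) {set_encode {1..n}} \<longleftrightarrow> (\<exists>B\<in>P. x \<in> B \<and> y \<in> B)"
  proof
    assume "(x, y) \<in> sep n (htree n (fam n P)) {set_encode {1..n}}"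
    then have xy: "x \<in> {1..n}" "x = y \<or> (\<exists>A\<in>fam n P. A \<noteq> {1..n} \<and> x \<in> A \<and> y \<in> A)"
      unfolding sep_top by auto
    from xy(2) show "\<exists>B\<in>P. x \<in> B \<and> y \<in> B"
    proof
      assume "x = y"
      then show ?thesis using xy(1) partition_onD1[OF P] by blast
    next
      assume "\<exists>A\<in>fam n P. A \<noteq> {1..n} \<and> x \<in> A \<and> y \<in> A"
      then show ?thesis unfolding fam_def by blast
    qed
  next
    assume "\<exists>B\<in>P. x \<in> B \<and> y \<in> B"
    then obtain B where B: "B \<in> P" "x \<in> B" "y \<in> B" by blast
    then have xy: "x \<in> {1..n}" "y \<in> {1..n}" "B \<noteq> {1..n}" "finite B"
      using partition_mem(1)[OF P B(1)] transversal_proper[OF X B(1)] finite_subset by blast+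
    have "2 \<le> card B" if "x \<noteq> y"
    proof -
      have "card {x, y} \<le> card B" using B xy(4) by (intro card_mono) auto
      then show ?thesis using that by simp
    qed
    then have "x = y \<or> (\<exists>A\<in>fam n P. A \<noteq> {1..n} \<and> x \<in> A \<and> y \<in> A)"
      using B xy unfolding fam_def by blast
    then show "(x, y) \<in> sep n (htree n (fam n P)) {set_encode {1..n}}"
      unfolding sep_top using xy by blast
  qed
qed

section \<open>Contraction to a star\<close>

lemma sep_partition: "partition_on {1..n} ({1..n} // sep n G F)"
  by (rule partition_on_quotient[OF sep_equiv])

lemma sep_quotient_transversal:
  assumes "stable_tree n G" "w \<in> iv G"
  obtains X where "transversal n ({1..n} // sep n G {w}) X"
proof -
  obtain X where X: "X \<subseteq> {1..n}" "3 \<le> card X"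
    "\<And>x y. x \<in> X \<Longrightarrow> y \<in> X \<Longrightarrow> (x, y) \<in> sep n G {w} \<Longrightarrow> x = y"
    using sep_transversal[OF assms] by blast
  have "transversal n ({1..n} // sep n G {w}) X"
    unfolding transversal_def
  proof (intro conjI ballI impI)
    show "X \<subseteq> {1..n}" "3 \<le> card X" by fact+
    fix B x y assume "B \<in> {1..n} // sep n G {w}" "x \<in> X" "y \<in> X" "x \<in> B \<and> y \<in> B"
    then show "x = y" using X(3) quotient_rel[OF sep_equiv, of x y n G "{w}"] by blast
  qed
  then show ?thesis by (rule that)
qed

lemma branch_eq:
  assumes "(a, b) \<in> (adj (ie G) (iv G - {w}))\<^sup>*"
  shows "branch n G w a = branch n G w b"
  using assms adj_sym[OF assms] unfolding branch_def by (auto intro: rtrancl_trans)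

lemma (in rooted) below_child:
  assumes "u \<in> V - {w}"
  shows "\<exists>a\<in>V - {w}. par a = w \<and> u \<in> desc a"
  using assms
proof (induction "d u" arbitrary: u rule: less_induct)
  case less
  show ?case
  proof (cases "par u = w")
    case True
    then show ?thesis using less.prems desc_self by blast
  next
    case False
    then obtain a where a: "a \<in> V - {w}" "par a = w" "par u \<in> desc a"
      using less.hyps[of "par u"] less.prems par_less par_in by blast
    have "(u, par u) \<in> up" using less.prems by (auto simp: up_def)
    then have "u \<in> desc a" using a(3) less.prems
      by (auto simp: desc_def intro: converse_rtrancl_into_rtrancl)
    then show ?thesis using a by blast
  qed
qed

text \<open>Each branch collapses to the vertex named by its label set. The fibre over the centre is
  \<open>w\<close> alone, so an extremal assignment contains \<open>w\<close> exactly if it contains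
  the centre of the star.\<close>

lemma star_contracts:
  assumes st: "stable_tree n G" and w: "w \<in> iv G"
  obtains \<pi> where "contracts n G (htree n (fam n ({1..n} // sep n G {w}))) \<pi>"
    "\<And>v. v \<in> iv G \<Longrightarrow> \<pi> v = set_encode {1..n} \<longleftrightarrow> v = w"
proof -
  let ?P = "{1..n} // sep n G {w}"
  let ?L = "fam n ?P"
  let ?E = "ie G"
  note P = sep_partition[of n G "{w}"]
  obtain X where X: "transversal n ?P X" using sep_quotient_transversal[OF st w] .
  interpret hierarchy n ?L by (rule hierarchy_star[OF P X])
  let ?\<pi> = "\<lambda>u. if u = w then set_encode {1..n} else set_encode (branch n G w u)"
  have br: "branch n G w u \<in> ?P" if "u \<in> iv G - {w}" for u
  proof -
    have "branch n G w u \<in> bp_blocks n G w"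
      using that unfolding bp_blocks_def branch_def by blast
    then show ?thesis using bp_blocks_eq_quotient[OF st w] by simp
  qed
  have brL: "branch n G w u \<in> ?L" "branch n G w u \<noteq> {1..n}" if "u \<in> iv G - {w}" for u
    using br[OF that] card_branch[OF st w that] transversal_proper[OF X br[OF that]]
    unfolding fam_def by blast+
  have Lbr: "\<exists>u\<in>iv G - {w}. A = branch n G w u" if "A \<in> ?L" "A \<noteq> {1..n}" for A
  proof -
    have "A \<in> bp_blocks n G w" "2 \<le> card A"
      using that bp_blocks_eq_quotient[OF st w] unfolding fam_def by auto
    then show ?thesis unfolding bp_blocks_def branch_def by auto
  qed
  have \<pi>w: "?\<pi> v = set_encode {1..n} \<longleftrightarrow> v = w" if "v \<in> iv G" for v
    using brL[of v] enc_eq[OF _ top] that by auto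
  \<comment> \<open>The proper members are blocks of one partition, hence pairwise disjoint and
    never nested.\<close>
  have par: "parent ?L A = {1..n}" if A: "A \<in> ?L" "A \<noteq> {1..n}" for A
  proof (rule ccontr)
    assume B: "parent ?L A \<noteq> {1..n}"
    have p: "parent ?L A \<in> ?L" "A \<subset> parent ?L A" using parent_in[OF A] by blast+
    then have "parent ?L A \<in> ?P" "A \<in> ?P" using A B unfolding fam_def by blast+
    moreover have "A \<inter> parent ?L A \<noteq> {}" using nonempty[OF A(1)] p(2) by blast
    ultimately have "A = parent ?L A" using partition_mem(3)[OF P] by blast
    then show False using p by blast
  qed
  have "contracts n G (htree n ?L) ?\<pi>"
    unfolding contracts_def
  proof (intro conjI ballI)
    show "stable_tree n G" "stable_tree n (htree n ?L)" by (rule st, rule stable)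
    show "?\<pi> ` iv G = iv (htree n ?L)"
    proof (intro subset_antisym subsetI)
      fix v assume "v \<in> ?\<pi> ` iv G"
      then obtain u where "u \<in> iv G" "v = ?\<pi> u" by blast
      then show "v \<in> iv (htree n ?L)" using brL(1)[of u] top by auto
    next
      fix v assume "v \<in> iv (htree n ?L)"
      then obtain A where A: "A \<in> ?L" "v = set_encode A" by auto
      show "v \<in> ?\<pi> ` iv G"
      proof (cases "A = {1..n}")
        case True
        then have "v = ?\<pi> w" using A by simp
        then show ?thesis using w by blast
      next
        case False
        then obtain u where "u \<in> iv G - {w}" "A = branch n G w u" using Lbr A by blast
        then have "v = ?\<pi> u" "u \<in> iv G" using A by auto
        then show ?thesis by blast
      qed
    qed
    show "connected_on ?E {v \<in> iv G. ?\<pi> v = v'}" if "v' \<in> iv (htree n ?L)" for v'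
      unfolding connected_on_def
    proof (intro ballI)
      fix a b assume a: "a \<in> {v \<in> iv G. ?\<pi> v = v'}" and b: "b \<in> {v \<in> iv G. ?\<pi> v = v'}"
      show "(a, b) \<in> (adj ?E {v \<in> iv G. ?\<pi> v = v'})\<^sup>*"
      proof (cases "a = w \<or> b = w")
        case True
        then have "v' = set_encode {1..n}" using a b by auto
        then have "a = w" "b = w" using a b \<pi>w by auto
        then show ?thesis by simp
      next
        case False
        then have ab: "a \<in> iv G - {w}" "b \<in> iv G - {w}"
          "set_encode (branch n G w a) = v'" "set_encode (branch n G w b) = v'"
          using a b by auto
        then have eq: "branch n G w a = branch n G w b" using enc_eq brL by metis
        obtain j where "j \<in> branch n G w a" using branch_nonempty[OF st w ab(1)] .
        then have "(a, lf G j) \<in> (adj ?E (iv G - {w}))\<^sup>*" "(b, lf G j) \<in> (adj ?E (iv G - {w}))\<^sup>*"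
          using eq by (auto simp: branch_def)
        then have "(a, b) \<in> (adj ?E (iv G - {w}))\<^sup>*" using adj_sym by (meson rtrancl_trans)
        then show ?thesis
        proof (induction rule: rtrancl_induct)
          case (step y z)
          then have yz: "y \<in> iv G - {w}" "z \<in> iv G - {w}" "{y, z} \<in> ?E" by (auto simp: adj_def)
          have "(a, z) \<in> (adj ?E (iv G - {w}))\<^sup>*" using step(1,2) by (rule rtrancl_into_rtrancl)
          then have "branch n G w a = branch n G w y" "branch n G w a = branch n G w z"
            using branch_eq step(1) by blast+
          then have "(y, z) \<in> adj ?E {v \<in> iv G. ?\<pi> v = v'}"
            using yz ab(3) by (simp add: adj_def)
          then show ?case using step.IH by (rule rtrancl_into_rtrancl[rotated])
        qed simp
      qed
    qed
    have "ie (htree n ?L) \<subseteq> {{?\<pi> a, ?\<pi> b} | a b. {a, b} \<in> ?E \<and> ?\<pi> a \<noteq> ?\<pi> b}"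
    proof
      fix e assume "e \<in> ie (htree n ?L)"
      then obtain A where A: "A \<in> ?L" "A \<noteq> {1..n}" "e = {set_encode A, set_encode (parent ?L A)}"
        by auto
      then obtain u where u: "u \<in> iv G - {w}" "A = branch n G w u" using Lbr by blast
      \<comment> \<open>The edge of the star is the image of the edge joining \<open>w\<close> to
        the child of \<open>w\<close> above \<open>u\<close>.\<close>
      obtain par d where "rooted (iv G) ?E w par d" using stable_rooted[OF st w] .
      then interpret rooted "iv G" ?E w par d .
      obtain a where a: "a \<in> iv G - {w}" "par a = w" "u \<in> desc a" using below_child[OF u(1)] by blast
      have "desc a \<subseteq> iv G - {w}" using desc_sub root_notin_desc a by blast
      then have "(u, a) \<in> (adj ?E (iv G - {w}))\<^sup>*" using desc_connected[OF a(3)] adj_mono' by blast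
      then have "branch n G w u = branch n G w a" by (rule branch_eq)
      then have e: "e = {?\<pi> a, ?\<pi> w}" using A u a par[OF A(1,2)] by simp
      have "{a, w} \<in> ?E" using a edges by auto
      moreover have "?\<pi> a \<noteq> ?\<pi> w" using \<pi>w[of a] a by simp
      ultimately show "e \<in> {{?\<pi> a, ?\<pi> b} | a b. {a, b} \<in> ?E \<and> ?\<pi> a \<noteq> ?\<pi> b}" using e by blast
    qed
    moreover have "{{?\<pi> a, ?\<pi> b} | a b. {a, b} \<in> ?E \<and> ?\<pi> a \<noteq> ?\<pi> b} \<subseteq> ie (htree n ?L)"
    proof
      fix e assume "e \<in> {{?\<pi> a, ?\<pi> b} | a b. {a, b} \<in> ?E \<and> ?\<pi> a \<noteq> ?\<pi> b}"
      then obtain a b where ab: "e = {?\<pi> a, ?\<pi> b}" "{a, b} \<in> ?E" "?\<pi> a \<noteq> ?\<pi> b" by blast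
      then have abV: "a \<in> iv G" "b \<in> iv G" using stable_edge[OF st] by blast+
      have edge: "{set_encode (branch n G w c), set_encode {1..n}} \<in> ie (htree n ?L)"
        if "c \<in> iv G - {w}" for c
      proof -
        have "branch n G w c \<in> ?L - {{1..n}}" using brL[OF that] by blast
        moreover have "{set_encode (branch n G w c), set_encode {1..n}} =
            {set_encode (branch n G w c), set_encode (parent ?L (branch n G w c))}"
          using par brL[OF that] by simp
        ultimately show ?thesis unfolding htree_simps by (rule image_eqI[rotated])
      qed
      \<comment> \<open>An edge that avoids \<open>w\<close> stays within one branch and is
        collapsed.\<close>
      have "a = w \<or> b = w"
      proof (rule ccontr)
        assume "\<not> (a = w \<or> b = w)"
        then have "(a, b) \<in> adj ?E (iv G - {w})" "a \<noteq> w" "b \<noteq> w" using ab(2) abV by (auto simp: adj_def)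
        then show False using branch_eq[OF r_into_rtrancl] ab(3) by metis
      qed
      then show "e \<in> ie (htree n ?L)"
      proof
        assume "a = w"
        then have "b \<noteq> w" "e = {set_encode (branch n G w b), set_encode {1..n}}" using ab by auto
        then show ?thesis using edge[of b] abV by simp
      next
        assume "b = w"
        then have "a \<noteq> w" "e = {set_encode (branch n G w a), set_encode {1..n}}" using ab by auto
        then show ?thesis using edge[of a] abV by simp
      qed
    qed
    ultimately show "ie (htree n ?L) = {{?\<pi> a, ?\<pi> b} | a b. {a, b} \<in> ?E \<and> ?\<pi> a \<noteq> ?\<pi> b}"
      by (rule subset_antisym)
    show "lf (htree n ?L) i = ?\<pi> (lf G i)" if i: "i \<in> {1..n}" for i
    proof (cases "lf G i = w")
      case True
      have h: "hull ?L {i} \<in> ?L" using hull_in i by simp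
      have "hull ?L {i} = {1..n}"
      proof (rule ccontr)
        assume "hull ?L {i} \<noteq> {1..n}"
        then obtain u where "hull ?L {i} = branch n G w u" using Lbr[OF h] by blast
        then have "i \<in> branch n G w u" using hull_sup[of "{i}"] by blast
        then show False using True by (simp add: branch_def)
      qed
      then show ?thesis using True by simp
    next
      case False
      then have l: "lf G i \<in> iv G - {w}" using stable_lf[OF st i] by blast
      let ?B = "branch n G w (lf G i)"
      have iB: "i \<in> ?B" using i l by (simp add: branch_def)
      have "hull ?L {i} = ?B"
      proof
        show "hull ?L {i} \<subseteq> ?B" using hull_least brL(1)[OF l] iB by simp
        have h: "hull ?L {i} \<in> ?L" using hull_in i by simp
        show "?B \<subseteq> hull ?L {i}"
        proof (cases "hull ?L {i} = {1..n}")
          case True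
          then show ?thesis using sub[OF brL(1)[OF l]] by simp
        next
          case False
          then have "hull ?L {i} \<in> ?P" using h unfolding fam_def by blast
          moreover have "?B \<inter> hull ?L {i} \<noteq> {}" using iB hull_sup[of "{i}"] by blast
          ultimately have "?B = hull ?L {i}" using partition_mem(3)[OF P br[OF l]] by blast
          then show ?thesis by simp
        qed
      qed
      then show ?thesis using False by simp
    qed
  qed
  then show ?thesis using that \<pi>w by blast
qed

section \<open>Atomic extremal assignments\<close>

lemma extremalD:
  assumes "extremal n Z" "contracts n G G' \<pi>" "v' \<in> iv G'"
  shows "v' \<in> Z G' \<longleftrightarrow> (\<forall>v\<in>iv G. \<pi> v = v' \<longrightarrow> v \<in> Z G)"
  using assms unfolding extremal_def by blast

lemma extremal_star:
  assumes "extremal n Z" "stable_tree n G" "w \<in> iv G"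
  shows "w \<in> Z G \<longleftrightarrow> set_encode {1..n} \<in> Z (htree n (fam n ({1..n} // sep n G {w})))"
proof -
  obtain \<pi> where \<pi>: "contracts n G (htree n (fam n ({1..n} // sep n G {w}))) \<pi>"
    "\<And>v. v \<in> iv G \<Longrightarrow> \<pi> v = set_encode {1..n} \<longleftrightarrow> v = w"
    using star_contracts[OF assms(2,3)] by blast
  have "set_encode {1..n} \<in> iv (htree n (fam n ({1..n} // sep n G {w})))" by (simp add: fam_def)
  from extremalD[OF assms(1) \<pi>(1) this] show ?thesis using \<pi>(2) assms(3) by blast
qed

text \<open>The two-level tree \<open>?K\<close> contracts to the stars of both partitions. The
  fibre over the centre of the finer star contains the root of \<open>?K\<close>, so assignedness
  passes up to the root; over the centre of the coarser star there is nothing but the root, so it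
  passes down again.\<close>

lemma extremal_coarsen:
  assumes Z: "extremal n Z" and G: "stable_tree n G" "v \<in> iv G" and H: "stable_tree n H" "w \<in> iv H"
    and le: "sep n G {v} \<subseteq> sep n H {w}" and v: "v \<in> Z G"
  shows "w \<in> Z H"
proof -
  let ?N = "{1..n} // sep n G {v}" and ?P = "{1..n} // sep n H {w}"
  let ?K = "htree n (fam n (?N \<union> ?P))" and ?r = "set_encode {1..n}"
  have ref: "\<exists>B\<in>?P. C \<subseteq> B" if "C \<in> ?N" for C
    using bspec[OF refines_iff[OF sep_equiv sep_equiv, THEN iffD2, OF le] that] .
  obtain X where X: "transversal n ?P X" using sep_quotient_transversal[OF H] .
  have hK: "hierarchy n (fam n (?N \<union> ?P))" using hierarchy_fam[OF sep_partition sep_partition ref X] .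
  have hP: "hierarchy n (fam n ?P)" using hierarchy_star[OF sep_partition X] .
  have hP0: "hierarchy n (fam n ?N)"
    using hierarchy_star[OF sep_partition transversal_refine[OF ref X]] .
  interpret K: hierarchy n "fam n (?N \<union> ?P)" by fact
  interpret S: hierarchy n "fam n ?P" by fact
  interpret S0: hierarchy n "fam n ?N" by fact
  have c0: "contracts n ?K (htree n (fam n ?N)) (\<lambda>v. set_encode (hull (fam n ?N) (set_decode v)))"
    by (rule hierarchy_contracts[OF hK hP0]) (rule fam_mono, blast)
  have c: "contracts n ?K (htree n (fam n ?P)) (\<lambda>v. set_encode (hull (fam n ?P) (set_decode v)))"
    by (rule hierarchy_contracts[OF hK hP]) (rule fam_mono, blast)
  have "?r \<in> Z (htree n (fam n ?N))" using extremal_star[OF Z G] v by blast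
  then have rK: "?r \<in> Z ?K"
    using extremalD[OF Z c0, of ?r] S0.top K.top S0.hull_self[OF S0.top] by simp
  \<comment> \<open>A block of \<open>?N\<close> lies in a block of \<open>?P\<close>, hence every
    member except the root is absorbed by a proper vertex of the coarser star.\<close>
  have rS: "u = ?r" if u: "u \<in> iv ?K" "set_encode (hull (fam n ?P) (set_decode u)) = ?r" for u
  proof -
    from u(1) obtain A where A: "A \<in> fam n (?N \<union> ?P)" "u = set_encode A" by auto
    have "hull (fam n ?P) A \<in> fam n ?P" using S.hull_in[OF K.nonempty[OF A(1)] K.sub[OF A(1)]] .
    then have hA: "hull (fam n ?P) A = {1..n}"
      using u(2) A S.enc_eq[OF _ S.top] K.dec_enc by simp
    have "A = {1..n}"
    proof (rule ccontr)
      assume ne: "A \<noteq> {1..n}"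
      then obtain B where B: "B \<in> ?P" "A \<subseteq> B" using A(1) ref unfolding fam_def by blast
      have "finite B" using partition_mem(1)[OF sep_partition B(1)] finite_subset by blast
      then have "2 \<le> card B" using card_mono[OF _ B(2)] K.card2[OF A(1)] by simp
      then have "B \<in> fam n ?P" using B by (simp add: fam_def)
      then have "{1..n} \<subseteq> B" using S.hull_least[OF _ B(2)] hA by simp
      then have "B = {1..n}" using partition_mem(1)[OF sep_partition B(1)] by blast
      then show False using transversal_proper[OF X B(1)] by blast
    qed
    then show ?thesis using A by simp
  qed
  have "?r \<in> iv (htree n (fam n ?P))" using S.top by simp
  moreover have "\<forall>u\<in>iv ?K. set_encode (hull (fam n ?P) (set_decode u)) = ?r \<longrightarrow> u \<in> Z ?K"
    using rS rK by metis
  ultimately have "?r \<in> Z (htree n (fam n ?P))" using extremalD[OF Z c] by blast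
  then show ?thesis using extremal_star[OF Z H] by blast
qed

section \<open>The explicit atomic assignment\<close>

lemma contracts_fibre:
  assumes "contracts n G G' \<pi>" "v' \<in> iv G'"
  shows "{v \<in> iv G. \<pi> v = v'} \<noteq> {}" "connected_on (ie G) {v \<in> iv G. \<pi> v = v'}"
proof -
  have "\<pi> ` iv G = iv G'" using assms(1) unfolding contracts_def by (elim conjE)
  with assms(2) have "v' \<in> \<pi> ` iv G" by simp
  then obtain v where "v' = \<pi> v" "v \<in> iv G" by (rule imageE)
  then show "{v \<in> iv G. \<pi> v = v'} \<noteq> {}" by auto
  show "connected_on (ie G) {v \<in> iv G. \<pi> v = v'}"
    using assms unfolding contracts_def by (elim conjE) (erule bspec)
qed

lemma contracts_stable: "contracts n G G' \<pi> \<Longrightarrow> stable_tree n G \<and> stable_tree n G'"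
  unfolding contracts_def by (elim conjE) (rule conjI)

text \<open>Being contained in an intersection means being contained in each term: condition (b) in
  its abstract form.\<close>

lemma contracts_sep_iff:
  assumes c: "contracts n G G' \<pi>" and v': "v' \<in> iv G'"
  shows "R \<subseteq> sep n G' {v'} \<longleftrightarrow> (\<forall>v\<in>iv G. \<pi> v = v' \<longrightarrow> R \<subseteq> sep n G {v})"
proof -
  let ?F = "{v \<in> iv G. \<pi> v = v'}"
  have sep: "(i, j) \<in> sep n G' {v'} \<longleftrightarrow> (\<forall>v\<in>?F. (i, j) \<in> sep n G {v})" for i j
    unfolding sep_contracts[OF c v']
    using contracts_stable[OF c] contracts_fibre[OF c v'] by (intro sep_Inter) auto
  show ?thesis
  proof (intro iffI ballI impI subrelI)
    fix v i j assume "R \<subseteq> sep n G' {v'}" "v \<in> iv G" "\<pi> v = v'" "(i, j) \<in> R"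
    then show "(i, j) \<in> sep n G {v}" using sep[of i j] by blast
  next
    fix i j assume "\<forall>v\<in>iv G. \<pi> v = v' \<longrightarrow> R \<subseteq> sep n G {v}" "(i, j) \<in> R"
    then show "(i, j) \<in> sep n G' {v'}" unfolding sep by blast
  qed
qed

text \<open>If every vertex were assigned, \<open>R\<close> would lie in the intersection over the
  whole tree, which is the diagonal. With \<open>R\<close> the relation of a basic pair, this is the
  competitor that bounds the atomic assignment from above.\<close>

lemma extremal_coarsenings:
  assumes "\<not> R \<subseteq> Id"
  shows "extremal n (\<lambda>H. {w \<in> iv H. R \<subseteq> sep n H {w}})"
  unfolding extremal_def
proof (intro conjI allI impI ballI)
  fix G assume G: "stable_tree n G"
  show "{w \<in> iv G. R \<subseteq> sep n G {w}} \<subseteq> iv G" by blast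
  show "{w \<in> iv G. R \<subseteq> sep n G {w}} \<noteq> iv G"
  proof
    assume all: "{w \<in> iv G. R \<subseteq> sep n G {w}} = iv G"
    have "iv G \<noteq> {}" "connected_on (ie G) (iv G)"
      using G unfolding stable_tree_def by simp_all
    note I = sep_Inter[OF G subset_refl this]
    have "R \<subseteq> sep n G (iv G)"
    proof (rule subrelI)
      fix i j assume "(i, j) \<in> R"
      then show "(i, j) \<in> sep n G (iv G)" unfolding I using all by blast
    qed
    then show False using assms sep_all[OF G] by auto
  qed
next
  fix G G' \<pi> v' assume "contracts n G G' \<pi>" "v' \<in> iv G'"
  from contracts_sep_iff[OF this, of R] this(2)
  show "v' \<in> {w \<in> iv G'. R \<subseteq> sep n G' {w}} \<longleftrightarrow>
      (\<forall>v\<in>iv G. \<pi> v = v' \<longrightarrow> v \<in> {w \<in> iv G. R \<subseteq> sep n G {w}})" by blast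
qed

text \<open>A second internal vertex gives a branch, and every branch has two leaves.\<close>

lemma basic_pair_sep_nontrivial:
  assumes "basic_pair n G v"
  shows "\<not> sep n G {v} \<subseteq> Id"
proof -
  have G: "stable_tree n G" "2 \<le> card (iv G)" "v \<in> iv G" using assms by (auto simp: basic_pair_def)
  have "iv G \<noteq> {v}" using G(2) by auto
  then obtain u where u: "u \<in> iv G - {v}" using G(3) by blast
  let ?B = "branch n G v u"
  obtain j where j: "j \<in> ?B" using branch_nonempty[OF G(1,3) u] .
  have "?B \<noteq> {j}" using card_branch[OF G(1,3) u] by auto
  then obtain i where "i \<in> ?B" "i \<noteq> j" using j by blast
  then show ?thesis using sep_iff_branch[OF j] by auto
qed

text \<open>Minimality against \<open>extremal_coarsenings\<close> gives one inclusion; the other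
  holds in any extremal assignment by \<open>extremal_coarsen\<close>.\<close>

lemma atomic_iff:
  assumes "basic_pair n G v" "atomic n G v Z" "stable_tree n H"
  shows "w \<in> Z H \<longleftrightarrow> w \<in> iv H \<and> sep n G {v} \<subseteq> sep n H {w}"
proof
  have G: "stable_tree n G" "v \<in> iv G" using assms(1) by (auto simp: basic_pair_def)
  have Z: "extremal n Z" "v \<in> Z G"
    "\<And>Z' H. extremal n Z' \<Longrightarrow> v \<in> Z' G \<Longrightarrow> stable_tree n H \<Longrightarrow> Z H \<subseteq> Z' H"
    using assms(2) unfolding atomic_def by blast+
  show "w \<in> iv H \<and> sep n G {v} \<subseteq> sep n H {w}" if "w \<in> Z H"
    using Z(3)[OF extremal_coarsenings[OF basic_pair_sep_nontrivial[OF assms(1)]] _ assms(3)] G that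
    by blast
  show "w \<in> Z H" if "w \<in> iv H \<and> sep n G {v} \<subseteq> sep n H {w}"
    using extremal_coarsen[OF Z(1) G assms(3)] that Z(2) by blast
qed

section \<open>Assignments given by integer partitions\<close>

definition stype :: "nat \<Rightarrow> ltree \<Rightarrow> nat set \<Rightarrow> nat multiset" where
  "stype n G F = ptype ({1..n} // sep n G F)"

text \<open>On stable trees this will be the union of the orbits, so that extremality and special
  families are compared through it.\<close>

definition assign :: "nat \<Rightarrow> nat multiset set \<Rightarrow> ltree \<Rightarrow> nat set" where
  "assign n \<F> H = {w \<in> iv H. \<exists>p\<in>\<F>. pleq (stype n H {w}) p}"

lemma pleq_stype_mono:
  assumes "sep n G F \<subseteq> sep n H F'"
  shows "pleq (stype n H F') (stype n G F)"
  unfolding stype_def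
proof (rule pleq_ptype_refines[OF _ sep_partition sep_partition])
  show "\<exists>B\<in>{1..n} // sep n H F'. C \<subseteq> B" if "C \<in> {1..n} // sep n G F" for C
    using bspec[OF refines_iff[OF sep_equiv sep_equiv, THEN iffD2, OF assms] that] .
qed simp

lemma pleq_stype_partition:
  assumes P: "partition_on {1..n} P"
    and rel: "\<And>C x y. C \<in> P \<Longrightarrow> x \<in> C \<Longrightarrow> y \<in> C \<Longrightarrow> x \<noteq> y \<Longrightarrow> (x, y) \<in> sep n G F"
  shows "pleq (stype n G F) (ptype P)"
  unfolding stype_def
proof (rule pleq_ptype_refines[OF _ sep_partition P])
  fix C assume C: "C \<in> P"
  then obtain x where x: "x \<in> C" using partition_mem(2)[OF P C] by blast
  then have "x \<in> {1..n}" using partition_mem(1)[OF P C] by blast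
  then have "sep n G F `` {x} \<in> {1..n} // sep n G F" "(x, x) \<in> sep n G F"
    by (rule quotientI, simp add: sep_def)
  moreover have "C \<subseteq> sep n G F `` {x}"
  proof
    fix y assume "y \<in> C"
    then show "y \<in> sep n G F `` {x}"
      using rel[OF C x] \<open>(x, x) \<in> sep n G F\<close> by (cases "x = y") auto
  qed
  ultimately show "\<exists>B\<in>{1..n} // sep n G F. C \<subseteq> B" by blast
qed simp

text \<open>Trade the part \<open>sum_mset b\<close> for parts of \<open>p2\<close>. The parts of
  \<open>b\<close> themselves need not occur in a member of the family, so the step inserts the
  portion \<open>r2\<close> of \<open>p2\<close> that refines \<open>b\<close>, and the result is
  coarsened back afterwards.\<close>

lemma special_merge:
  assumes F: "special_family \<F>" and p: "p1 \<in> \<F>" "p2 \<in> \<F>"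
    and 1: "pleq (a + {#sum_mset b#}) p1" and 2: "pleq ({#sum_mset a#} + b) p2"
  shows "\<exists>p\<in>\<F>. pleq (a + b) p"
proof -
  obtain r1 r2 where r: "p2 = r1 + r2" "pleq b r2" using pleq_addD[OF 2] by blast
  have "sum_mset {#sum_mset b#} = sum_mset r2" using pleq_sum[OF r(2)] by simp
  moreover have "r2 \<subseteq># p2" using r(1) by simp
  moreover have "a + r2 = a + {#sum_mset b#} - {#sum_mset b#} + r2" by simp
  ultimately have "one_step \<F> (a + {#sum_mset b#}) (a + r2)"
    unfolding one_step_def using p(2)
    by (intro exI[of _ "{#sum_mset b#}"] exI[of _ r2] exI[of _ p2]) simp
  then have "replacement \<F> (a + r2)"
    unfolding replacement_def using p(1) 1 by blast
  then obtain p where "p \<in> \<F>" "pleq (a + r2) p" using F unfolding special_family_def by blast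
  moreover have "pleq (a + b) (a + r2)" using pleq_add[OF pleq_refl r(2)] .
  ultimately show ?thesis using pleq_trans by blast
qed

text \<open>The situation at an edge: \<open>X\<close> and \<open>A - X\<close> are the label sets on its two sides, \<open>R\<close> and
  \<open>R'\<close> belong to its ends and \<open>R \<inter> R'\<close> to the contracted vertex.\<close>

lemma ptype_merge:
  assumes A: "finite A" and R: "equiv A R" "equiv A R'" and X: "X \<in> A // R" "A - X \<in> A // R'"
  obtains a b where "ptype (A // R) = a + {#sum_mset b#}" "ptype (A // R') = {#sum_mset a#} + b"
    "ptype (A // (R \<inter> R')) = a + b"
proof -
  let ?P = "A // R - {X}" and ?Q = "A // R' - {A - X}"
  note P = partition_on_quotient[OF R(1)] and Q = partition_on_quotient[OF R(2)]
  have XA: "X \<subseteq> A" using partition_mem(1)[OF P X(1)] .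
  have p: "partition_on (A - X) ?P" using partition_on_Diff[OF P, of "{X}"] X by simp
  have q: "partition_on X ?Q"
    using partition_on_Diff[OF Q, of "{A - X}"] X XA by (simp add: double_diff)
  have fin: "finite (A // R)" "finite (A // R')" using finite_elements[OF A] P Q by blast+
  have "sum_mset (ptype ?P) = card (A - X)" "sum_mset (ptype ?Q) = card X"
    using sum_ptype[OF _ p] sum_ptype[OF _ q] A XA finite_subset by auto
  moreover have "ptype (insert X ?P) = add_mset (card X) (ptype ?P)"
    "ptype (insert (A - X) ?Q) = add_mset (card (A - X)) (ptype ?Q)"
    using fin by (intro ptype_insert; simp)+
  moreover have "insert X ?P = A // R" "insert (A - X) ?Q = A // R'" using X by blast+
  ultimately have 1: "ptype (A // R) = ptype ?P + {#sum_mset (ptype ?Q)#}"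
    "ptype (A // R') = {#sum_mset (ptype ?P)#} + ptype ?Q" by simp_all
  have disj: "?P \<inter> ?Q = {}"
  proof (rule ccontr)
    assume "?P \<inter> ?Q \<noteq> {}"
    then obtain B where B: "B \<in> ?P" "B \<in> ?Q" by blast
    show False using partition_mem(1)[OF p B(1)] partition_mem(1,2)[OF q B(2)] by blast
  qed
  have "A // (R \<inter> R') = ?P \<union> ?Q"
  proof (rule quotient_eqI)
    show "partition_on A (?P \<union> ?Q)"
    proof (rule partition_onI)
      have "\<Union>(?P \<union> ?Q) = (A - X) \<union> X"
        unfolding Union_Un_distrib partition_onD1[OF p, symmetric] partition_onD1[OF q, symmetric] ..
      then show "\<Union>(?P \<union> ?Q) = A" using XA by blast
      show "{} \<notin> ?P \<union> ?Q" using partition_onD3[OF p] partition_onD3[OF q] by blast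
      fix B C assume BC: "B \<in> ?P \<union> ?Q" "C \<in> ?P \<union> ?Q" "B \<noteq> C"
      show "disjnt B C"
      proof (rule ccontr)
        assume "\<not> disjnt B C"
        then have ne: "B \<inter> C \<noteq> {}" by (simp add: disjnt_def)
        from BC(1,2) consider "B \<in> ?P" "C \<in> ?P" | "B \<in> ?Q" "C \<in> ?Q" | "B \<in> ?P" "C \<in> ?Q"
          | "B \<in> ?Q" "C \<in> ?P" by blast
        then show False
        proof cases
          case 1 then show ?thesis using partition_mem(3)[OF p 1 ne] BC(3) by simp
        next
          case 2 then show ?thesis using partition_mem(3)[OF q 2 ne] BC(3) by simp
        next
          case 3 then show ?thesis using partition_mem(1)[OF p 3(1)] partition_mem(1)[OF q 3(2)] ne by blast
        next
          case 4 then show ?thesis using partition_mem(1)[OF q 4(1)] partition_mem(1)[OF p 4(2)] ne by blast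
        qed
      qed
    qed
    show "equiv A (R \<inter> R')"
      using R unfolding equiv_def refl_on_def sym_def trans_def by blast
    fix x y
    show "(x, y) \<in> R \<inter> R' \<longleftrightarrow> (\<exists>B\<in>?P \<union> ?Q. x \<in> B \<and> y \<in> B)"
    proof
      assume xy: "(x, y) \<in> R \<inter> R'"
      then have "(x, y) \<in> R" "(x, y) \<in> R'" by simp_all
      obtain B where B: "B \<in> A // R" "x \<in> B" "y \<in> B" using quotient_relE[OF R(1) \<open>(x, y) \<in> R\<close>] .
      obtain C where C: "C \<in> A // R'" "x \<in> C" "y \<in> C" using quotient_relE[OF R(2) \<open>(x, y) \<in> R'\<close>] .
      \<comment> \<open>Inside \<open>X\<close> the class of \<open>R'\<close> is the block wanted,
        outside \<open>X\<close> the class of \<open>R\<close>; the remaining class on either side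
        is the excluded one.\<close>
      show "\<exists>B\<in>?P \<union> ?Q. x \<in> B \<and> y \<in> B"
      proof (cases "x \<in> X")
        case True
        then have "C \<noteq> A - X" using C by blast
        then show ?thesis using C by blast
      next
        case False
        then have "B \<noteq> X" using B by blast
        then show ?thesis using B by blast
      qed
    next
      assume "\<exists>B\<in>?P \<union> ?Q. x \<in> B \<and> y \<in> B"
      then obtain B where B: "B \<in> ?P \<or> B \<in> ?Q" "x \<in> B" "y \<in> B" by blast
      from B(1) show "(x, y) \<in> R \<inter> R'"
      proof
        assume BP: "B \<in> ?P"
        then have "x \<in> A - X" "y \<in> A - X" using partition_mem(1)[OF p BP] B by blast+
        then have "(x, y) \<in> R'" by (rule quotient_relI[OF R(2) X(2)])
        moreover have "(x, y) \<in> R" using BP B by (intro quotient_relI[OF R(1), of B]) simp_all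
        ultimately show ?thesis by blast
      next
        assume BQ: "B \<in> ?Q"
        then have "x \<in> X" "y \<in> X" using partition_mem(1)[OF q BQ] B by blast+
        then have "(x, y) \<in> R" by (rule quotient_relI[OF R(1) X(1)])
        moreover have "(x, y) \<in> R'" using BQ B by (intro quotient_relI[OF R(2), of B]) simp_all
        ultimately show ?thesis by blast
      qed
    qed
  qed
  then have "ptype (A // (R \<inter> R')) = ptype ?P + ptype ?Q"
    using ptype_union[OF _ _ disj] fin by simp
  then show ?thesis using that 1 by blast
qed

section \<open>From one edge to connected sets of vertices\<close>

lemma (in rooted) par_closed_connected:
  assumes F: "F \<subseteq> V" "w \<in> F" "\<And>f. f \<in> F \<Longrightarrow> f \<noteq> w \<Longrightarrow> par f \<in> F"
  shows "connected_on E F"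
proof -
  have "(u, w) \<in> (adj E F)\<^sup>*" if "u \<in> F" for u
    using that
  proof (induction "d u" arbitrary: u rule: less_induct)
    case less
    show ?case
    proof (cases "u = w")
      case False
      have u: "u \<in> V" using less.prems F(1) by blast
      have "par u \<in> F" using F(3) less.prems False .
      moreover have "(u, par u) \<in> up" using u False by (auto simp: up_def)
      ultimately have "(u, par u) \<in> adj E F" "(par u, w) \<in> (adj E F)\<^sup>*"
        using less adj_iff[OF F(1)] par_less[OF u False] by auto
      then show ?thesis by (rule converse_rtrancl_into_rtrancl)
    qed simp
  qed
  then show ?thesis unfolding connected_on_def using adj_sym by (meson rtrancl_trans)
qed

text \<open>The vertex \<open>v\<close> hangs on \<open>F\<close> by its parent edge. Seen from
  \<open>F\<close>, the leaves below \<open>v\<close> form one branch; seen from \<open>v\<close>,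
  all other leaves form the branch towards the root. These are the hypotheses of
  \<open>ptype_merge\<close>.\<close>

lemma sep_remove_leaf:
  assumes st: "stable_tree n G" and r: "rooted (iv G) (ie G) w par d"
    and F: "F \<subseteq> iv G" "w \<in> F" "\<And>f. f \<in> F \<Longrightarrow> f \<noteq> w \<Longrightarrow> par f \<in> F"
    and v: "v \<in> iv G" "v \<notin> F" "par v \<in> F"
  obtains X where "X \<in> {1..n} // sep n G F" "{1..n} - X \<in> {1..n} // sep n G {v}"
proof -
  interpret rooted "iv G" "ie G" w par d by fact
  let ?V = "iv G" and ?E = "ie G"
  have vw: "v \<noteq> w" using v F by blast
  define X where "X = {j \<in> {1..n}. lf G j \<in> desc v}"
  have av: "desc v \<inter> F = {}" using desc_avoids[of F v] F(3) v(2) vw by blast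
  have pv: "par v \<in> ?V" "v \<in> ?V - {par v}" using par_in[OF v(1) vw] par_neq[OF v(1) vw] v(1) by auto
  \<comment> \<open>A leaf below \<open>v\<close>, taken from the branch of \<open>v\<close> at its
    parent; it represents the class \<open>X\<close>.\<close>
  obtain j where j: "j \<in> branch n G (par v) v" using branch_nonempty[OF st pv] .
  then have j': "j \<in> {1..n}" "lf G j \<in> desc v"
    using desc_closed[OF _ desc_self[OF v(1)]] by (auto simp: branch_def)
  have inX: "(j, i) \<in> sep n G F \<longleftrightarrow> i \<in> X" for i
  proof
    assume ji: "(j, i) \<in> sep n G F"
    show "i \<in> X"
    proof (cases "i = j")
      case True
      then show ?thesis using j' by (simp add: X_def)
    next
      case False
      then have "i \<in> {1..n}" "(lf G j, lf G i) \<in> (adj ?E (?V - F))\<^sup>*"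
        using ji by (auto simp: sep_def)
      moreover have "?V - F \<subseteq> ?V - {par v}" using v(3) by blast
      ultimately show ?thesis using desc_closed[OF adj_mono' j'(2)] by (simp add: X_def)
    qed
  next
    assume "i \<in> X"
    then have i: "i \<in> {1..n}" "lf G i \<in> desc v" by (auto simp: X_def)
    have "desc v \<subseteq> ?V - F" using av desc_sub by blast
    then have "(lf G j, v) \<in> (adj ?E (?V - F))\<^sup>*" "(lf G i, v) \<in> (adj ?E (?V - F))\<^sup>*"
      using adj_mono'[OF desc_connected[OF j'(2)]] adj_mono'[OF desc_connected[OF i(2)]] by simp_all
    then have "(lf G j, lf G i) \<in> (adj ?E (?V - F))\<^sup>*" using adj_sym by (meson rtrancl_trans)
    then show "(j, i) \<in> sep n G F" using i j' av by (auto simp: sep_def)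
  qed
  have 1: "X \<in> {1..n} // sep n G F"
  proof -
    have "sep n G F `` {j} = X" using inX by blast
    then show ?thesis using j'(1) by (metis quotientI)
  qed
  have "w \<in> ?V - {v}" using vw root_in by blast
  then obtain k where k: "k \<in> branch n G v w" using branch_nonempty[OF st v(1)] by blast
  then have k': "k \<in> {1..n}" "lf G k \<in> ?V - {v}" "(w, lf G k) \<in> (adj ?E (?V - {v}))\<^sup>*"
    by (auto simp: branch_def)
  have kX: "lf G k \<notin> desc v"
    using desc_minus_closed[OF adj_sym[OF k'(3)]] k'(2) root_notin_desc[OF vw] by blast
  have dv: "?V - desc v \<subseteq> ?V - {v}" using desc_self[OF v(1)] by blast
  have outX: "(k, i) \<in> sep n G {v} \<longleftrightarrow> i \<in> {1..n} - X" for i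
  proof
    assume ki: "(k, i) \<in> sep n G {v}"
    show "i \<in> {1..n} - X"
    proof (cases "i = k")
      case True
      then show ?thesis using k' kX by (simp add: X_def)
    next
      case False
      then have i: "i \<in> {1..n}" "lf G i \<noteq> v" "(lf G k, lf G i) \<in> (adj ?E (?V - {v}))\<^sup>*"
        using ki by (auto simp: sep_def)
      have "lf G i \<notin> desc v"
        using desc_minus_closed[OF adj_sym[OF i(3)]] i(2) kX by blast
      then show ?thesis using i by (simp add: X_def)
    qed
  next
    assume "i \<in> {1..n} - X"
    then have i: "i \<in> {1..n}" "lf G i \<in> ?V - desc v" using stable_lf[OF st] by (auto simp: X_def)
    have "(lf G i, w) \<in> (adj ?E (?V - {v}))\<^sup>*"
      using outside_desc_connected[OF v(1) vw i(2)] dv by (rule adj_mono')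
    then have "(lf G k, lf G i) \<in> (adj ?E (?V - {v}))\<^sup>*" using k'(3) adj_sym by (meson rtrancl_trans)
    then show "(k, i) \<in> sep n G {v}" using i k' dv by (auto simp: sep_def)
  qed
  have 2: "{1..n} - X \<in> {1..n} // sep n G {v}"
  proof -
    have "sep n G {v} `` {k} = {1..n} - X" using outX by blast
    then show ?thesis using k'(1) by (metis quotientI)
  qed
  show ?thesis using that 1 2 .
qed

text \<open>Peel off a vertex of \<open>F\<close> farthest from a root in \<open>F\<close> as
  measured by \<open>d\<close>, and glue it back by \<open>special_merge\<close>.\<close>

lemma special_connected:
  assumes sp: "special_family \<F>" and st: "stable_tree n G"
    and F: "F \<subseteq> iv G" "F \<noteq> {}" "connected_on (ie G) F" "F \<subseteq> assign n \<F> G"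
  shows "\<exists>p\<in>\<F>. pleq (stype n G F) p"
proof -
  obtain w where w: "w \<in> F" using F(2) by blast
  obtain par d where r: "rooted (iv G) (ie G) w par d" using stable_rooted[OF st] w F(1) by blast
  then interpret rooted "iv G" "ie G" w par d .
  have "par f \<in> F" if "f \<in> F" "f \<noteq> w" for f using connected_imp_par_closed[OF F(1) w F(3) that] .
  \<comment> \<open>The induction runs over sets closed under parents rather than connected ones, a
    property that visibly survives the removal of a vertex with maximal \<open>d\<close>.\<close>
  moreover have "\<exists>p\<in>\<F>. pleq (stype n G F) p"
    if "F \<subseteq> iv G" "w \<in> F" "\<And>f. f \<in> F \<Longrightarrow> f \<noteq> w \<Longrightarrow> par f \<in> F" "F \<subseteq> assign n \<F> G" for F
    using that
  proof (induction "card F" arbitrary: F rule: less_induct)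
    case less
    have finF: "finite F" using less.prems(1) fin_V finite_subset by blast
    show ?case
    proof (cases "F = {w}")
      case True
      then show ?thesis using less.prems(4) by (auto simp: assign_def)
    next
      case False
      then have ne: "F - {w} \<noteq> {}" using less.prems(2) by blast
      then have "Max (d ` (F - {w})) \<in> d ` (F - {w})" using finF by simp
      then obtain v where "v \<in> F - {w}" and dv: "d v = Max (d ` (F - {w}))" by (metis imageE)
      then have v: "v \<in> F" "v \<noteq> w" by simp_all
      have max: "d u \<le> d v" if "u \<in> F" "u \<noteq> w" for u
        unfolding dv using that finF by (intro Max_ge) auto
      let ?F = "F - {v}"
      have F': "?F \<subseteq> iv G" "w \<in> ?F" "?F \<subseteq> assign n \<F> G" using less.prems v by blast+
      have cl: "par f \<in> ?F" if "f \<in> ?F" "f \<noteq> w" for f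
      proof -
        have "f \<in> iv G" using that F' by blast
        then have "d (par f) < d f" using par_less that by blast
        then have "par f \<noteq> v" using max[of f] that by auto
        then show ?thesis using less.prems(3)[of f] that by blast
      qed
      have "card ?F < card F" using v finF by (meson card_Diff1_less)
      then obtain p1 where p1: "p1 \<in> \<F>" "pleq (stype n G ?F) p1"
        using less.hyps[OF _ F'(1,2) cl F'(3)] by blast
      obtain p2 where p2: "p2 \<in> \<F>" "pleq (stype n G {v}) p2"
        using less.prems(4) v by (auto simp: assign_def)
      have vV: "v \<in> iv G" "v \<notin> ?F" using v less.prems(1) by blast+
      have pvF: "par v \<in> ?F" using less.prems(3)[OF v] par_neq[OF vV(1) v(2)] by blast
      obtain X where X: "X \<in> {1..n} // sep n G ?F" "{1..n} - X \<in> {1..n} // sep n G {v}"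
        using sep_remove_leaf[OF st r F'(1,2) cl vV pvF] .
      have "connected_on (ie G) F" "connected_on (ie G) ?F"
        using par_closed_connected[OF less.prems(1-3)] par_closed_connected[OF F'(1,2) cl] by blast+
      note I = sep_Inter[OF st less.prems(1) _ this(1)] sep_Inter[OF st F'(1) _ this(2)]
      have int: "sep n G F = sep n G ?F \<inter> sep n G {v}"
      proof (rule set_eqI)
        fix p :: "nat \<times> nat"
        obtain i j where p: "p = (i, j)" by fastforce
        have "F \<noteq> {}" "?F \<noteq> {}" using F'(2) by blast+
        then show "p \<in> sep n G F \<longleftrightarrow> p \<in> sep n G ?F \<inter> sep n G {v}"
          unfolding p Int_iff using I[of i j] v(1) by blast
      qed
      obtain a b where ab: "stype n G ?F = a + {#sum_mset b#}" "stype n G {v} = {#sum_mset a#} + b"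
        "stype n G F = a + b"
        using ptype_merge[OF finite_atLeastAtMost sep_equiv sep_equiv X] unfolding stype_def int by blast
      show ?thesis
        using special_merge[OF sp p1(1) p2(1)] p1(2) p2(2) unfolding ab by blast
    qed
  qed
  ultimately show ?thesis using F w by blast
qed

lemma ptype_Id:
  "\<forall>x\<in>#ptype (A // Id_on A). x = 1"
proof -
  have "card B = 1" if "B \<in> A // Id_on A" for B
  proof -
    from that obtain x where "x \<in> A" "B = Id_on A `` {x}" by (rule quotientE)
    then have "B = {x}" by auto
    then show ?thesis by simp
  qed
  then show ?thesis by (cases "finite (A // Id_on A)") (auto simp: ptype_def)
qed

text \<open>Both conditions come from \<open>special_connected\<close>, applied to a fibre for (b)
  and to the whole tree for properness. In the latter case the type consists of ones, and a member
  of the family above it would consist of ones as well.\<close>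

lemma special_imp_extremal:
  assumes sp: "special_family \<F>" and F: "\<And>p. p \<in> \<F> \<Longrightarrow> 0 \<notin># p \<and> (\<exists>x\<in>#p. x \<noteq> 1)"
  shows "extremal n (assign n \<F>)"
  unfolding extremal_def
proof (intro conjI allI impI ballI)
  fix G assume G: "stable_tree n G"
  show "assign n \<F> G \<subseteq> iv G" by (auto simp: assign_def)
  show "assign n \<F> G \<noteq> iv G"
  proof
    assume all: "assign n \<F> G = iv G"
    have "iv G \<noteq> {}" "connected_on (ie G) (iv G)"
      using G unfolding stable_tree_def by simp_all
    then obtain p where p: "p \<in> \<F>" "pleq (stype n G (iv G)) p"
      using special_connected[OF sp G subset_refl] all by blast
    have "\<forall>x\<in>#p. x = 1"
      using pleq_ones[OF p(2)] ptype_Id F[OF p(1)] unfolding stype_def sep_all[OF G] by blast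
    then show False using F[OF p(1)] by blast
  qed
next
  fix G G' \<pi> v' assume c: "contracts n G G' \<pi>" and v': "v' \<in> iv G'"
  let ?F = "{v \<in> iv G. \<pi> v = v'}"
  show "v' \<in> assign n \<F> G' \<longleftrightarrow> (\<forall>v\<in>iv G. \<pi> v = v' \<longrightarrow> v \<in> assign n \<F> G)"
  proof (intro iffI ballI impI)
    fix v assume *: "v' \<in> assign n \<F> G'" "v \<in> iv G" "\<pi> v = v'"
    then obtain p where p: "p \<in> \<F>" "pleq (stype n G' {v'}) p" by (auto simp: assign_def)
    have "sep n G' {v'} \<subseteq> sep n G {v}" using contracts_sep_iff[OF c v', of "sep n G' {v'}"] * by blast
    then have "pleq (stype n G {v}) p" using pleq_trans[OF pleq_stype_mono p(2)] by blast
    then show "v \<in> assign n \<F> G" using p(1) *(2) by (auto simp: assign_def)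
  next
    assume *: "\<forall>v\<in>iv G. \<pi> v = v' \<longrightarrow> v \<in> assign n \<F> G"
    have "?F \<subseteq> iv G" by blast
    moreover have "?F \<subseteq> assign n \<F> G" using * by blast
    ultimately have "\<exists>p\<in>\<F>. pleq (stype n G ?F) p"
      using special_connected[OF sp _ _ contracts_fibre[OF c v']] contracts_stable[OF c] by blast
    then show "v' \<in> assign n \<F> G'"
      using v' sep_contracts[OF c v'] by (simp add: assign_def stype_def)
  qed
qed

section \<open>From extremal assignments to special families\<close>

lemma exists_transversal:
  assumes P: "partition_on {1..n} P" and c: "3 \<le> card P"
  obtains X where "transversal n P X"
proof -
  define f where "f B = (SOME x. x \<in> B)" for B :: "nat set"
  have f: "f B \<in> B" if "B \<in> P" for B
    using partition_mem(2)[OF P that] unfolding f_def by (simp add: some_in_eq)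
  have f_eq: "B = C" if "B \<in> P" "C \<in> P" "f C \<in> B" for B C
    using partition_mem(3)[OF P that(1,2)] f[OF that(2)] that(3) by blast
  have "inj_on f P" using f_eq f by (intro inj_onI) metis
  then have "3 \<le> card (f ` P)" using c by (simp add: card_image)
  moreover have "f ` P \<subseteq> {1..n}" using f partition_mem(1)[OF P] by blast
  moreover have "\<forall>B\<in>P. \<forall>x\<in>f ` P. \<forall>y\<in>f ` P. x \<in> B \<and> y \<in> B \<longrightarrow> x = y" using f_eq by blast
  ultimately show ?thesis using that unfolding transversal_def by blast
qed

lemma card_ge_2_mem:
  assumes "partition_on {1..n::nat} P" "C \<in> P" "x \<in> C" "y \<in> C" "x \<noteq> y"
  shows "2 \<le> card C"
proof -
  have "finite C" using partition_mem(1)[OF assms(1,2)] finite_subset by blast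
  then have "card {x, y} \<le> card C" using assms by (intro card_mono) auto
  then show ?thesis using assms(5) by simp
qed

text \<open>The exchange is realised by an edge. Take \<open>N\<close> of type \<open>a + b\<close>,
  let \<open>X\<close> be the union of its blocks of type \<open>b\<close>, and hang these under a
  new vertex \<open>X\<close>. Then the types at the root and at \<open>X\<close> are bounded by the
  two hypotheses, and collapsing the edge gives the star of \<open>N\<close>. The root has
  \<open>size a + 1\<close> branches and \<open>X\<close> has \<open>size b + 1\<close>, so two
  parts on each side are what stability needs.\<close>

lemma extremal_merge:
  assumes Z: "extremal n (assign n \<F>)" and p: "p1 \<in> \<F>" "p2 \<in> \<F>"
    and ab: "0 \<notin># a" "0 \<notin># b" "2 \<le> size a" "2 \<le> size b" "sum_mset a + sum_mset b = n"
    and 1: "pleq (a + {#sum_mset b#}) p1" and 2: "pleq ({#sum_mset a#} + b) p2"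
  shows "\<exists>p\<in>\<F>. pleq (a + b) p"
proof -
  let ?r = "set_encode {1..n}"
  obtain N where N: "partition_on {1..n} N" "ptype N = a + b"
    using exists_partition_of_type[of "{1..n}" "a + b"] ab by auto
  have finN: "finite N" using finite_elements[OF _ N(1)] by simp
  obtain S where S: "S \<subseteq> N" "ptype (N - S) = a" "ptype S = b" using ptype_subset[OF finN N(2)] .
  define X where "X = \<Union>S"
  define P where "P = insert X (N - S)"
  have pS: "partition_on X S" and pD: "partition_on ({1..n} - X) (N - S)"
    unfolding X_def using partition_on_subset_Union[OF N(1) S(1)] partition_on_Diff[OF N(1) S(1)] .
  have XN: "X \<subseteq> {1..n}" unfolding X_def using S(1) partition_onD1[OF N(1)] by blast
  have finX: "finite X" using XN finite_subset by blast
  have cX: "card X = sum_mset b" "card ({1..n} - X) = sum_mset a"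
    using sum_ptype[OF finX pS] sum_ptype[OF _ pD] S by simp_all
  have cS: "card S = size b" "card (N - S) = size a" using size_ptype S by metis+
  have X0: "X \<noteq> {}" "{1..n} - X \<noteq> {}"
    using cS ab(3,4) partition_on_empty pS pD by (metis card.empty not_numeral_le_zero)+
  \<comment> \<open>Two blocks below \<open>X\<close> make it different from all blocks of
    \<open>N\<close>; otherwise there would be no edge to collapse.\<close>
  have XnotN: "C \<noteq> X" if "C \<in> N" for C
  proof
    assume CX: "C = X"
    have "C \<in> S"
    proof (rule ccontr)
      assume "C \<notin> S"
      then have "C \<subseteq> {1..n} - X" using partition_mem(1)[OF pD] that by blast
      then show False using CX X0 by blast
    qed
    have "S \<subseteq> {C}"
    proof
      fix D assume D: "D \<in> S"
      have "D \<inter> C \<noteq> {}" using partition_mem(1,2)[OF pS D] CX by blast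
      then show "D \<in> {C}" using partition_mem(3)[OF pS D \<open>C \<in> S\<close>] by simp
    qed
    then have "card S \<le> 1" using card_mono[of "{C}" S] by simp
    then show False using cS ab(4) by simp
  qed
  have P: "partition_on {1..n} P"
  proof -
    have "disjnt X (\<Union>(N - S))" using partition_onD1[OF pD] by (auto simp: disjnt_def)
    then show ?thesis unfolding P_def using partition_on_insert pD XN X0 by blast
  qed
  have tP: "ptype P = a + {#sum_mset b#}"
    unfolding P_def using ptype_insert[of "N - S" X] finN XnotN S(2) cX by force
  have "card P = size a + 1" using size_ptype[of P] tP by simp
  then obtain Y where Y: "transversal n P Y" using exists_transversal[OF P] ab(3) by auto
  have ref: "\<exists>B\<in>P. C \<subseteq> B" if "C \<in> N" for C
  proof (cases "C \<in> S")
    case True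
    then show ?thesis using partition_mem(1)[OF pS] unfolding P_def by blast
  next
    case False
    then show ?thesis using that unfolding P_def by blast
  qed
  have YN: "transversal n N Y" using transversal_refine[OF ref Y] .
  have hL: "hierarchy n (fam n (N \<union> P))" using hierarchy_fam[OF P N(1) ref Y] .
  have hN: "hierarchy n (fam n N)" using hierarchy_star[OF N(1) YN] .
  interpret L: hierarchy n "fam n (N \<union> P)" by fact
  interpret M: hierarchy n "fam n N" by fact
  let ?K = "htree n (fam n (N \<union> P))" and ?S = "htree n (fam n N)"
  let ?\<pi> = "\<lambda>v. set_encode (hull (fam n N) (set_decode v))"
  have c: "contracts n ?K ?S ?\<pi>"
    by (rule hierarchy_contracts[OF hL hN]) (rule fam_mono, blast)
  have "pleq (stype n ?K {?r}) (ptype P)"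
  proof (rule pleq_stype_partition[OF P])
    fix C x y assume C: "C \<in> P" "x \<in> C" "y \<in> C" "x \<noteq> y"
    then have "C \<in> fam n (N \<union> P)" using card_ge_2_mem[OF P C] by (simp add: fam_def)
    moreover have "\<not> {1..n} \<subseteq> C"
      using transversal_proper[OF Y C(1)] partition_mem(1)[OF P C(1)] by blast
    ultimately show "(x, y) \<in> sep n ?K {?r}"
      using C by (intro L.sep_within[OF L.top, of C]) blast+
  qed
  then have rK: "?r \<in> assign n \<F> ?K"
    using pleq_trans[OF _ 1] p(1) L.top unfolding tP assign_def by auto
  have XK: "set_encode X \<in> assign n \<F> ?K" if XL: "X \<in> fam n (N \<union> P)"
  proof -
    let ?Q = "insert ({1..n} - X) S"
    have "disjnt ({1..n} - X) (\<Union>S)" by (auto simp: disjnt_def X_def)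
    moreover have "{1..n} - ({1..n} - X) = X" using XN by blast
    ultimately have Q: "partition_on {1..n} ?Q"
      using partition_on_insert[of "{1..n} - X" S "{1..n}"] pS X0 by simp
    have "{1..n} - X \<notin> S" using partition_mem(1)[OF pS] X0 by blast
    then have tQ: "ptype ?Q = {#sum_mset a#} + b"
      using ptype_insert[of S "{1..n} - X"] finN S finite_subset cX by auto
    have "pleq (stype n ?K {set_encode X}) (ptype ?Q)"
    proof (rule pleq_stype_partition[OF Q])
      fix C x y assume C: "C \<in> ?Q" "x \<in> C" "y \<in> C" "x \<noteq> y"
      show "(x, y) \<in> sep n ?K {set_encode X}"
      proof (cases "C \<in> S")
        case True
        then have CN: "C \<in> N" using S(1) by blast
        then have "C \<in> fam n (N \<union> P)" using card_ge_2_mem[OF Q C] by (simp add: fam_def)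
        moreover have "\<not> X \<subseteq> C" using XnotN[OF CN] partition_mem(1)[OF pS True] by blast
        ultimately show ?thesis using C by (intro L.sep_within[OF XL, of C]) blast+
      next
        case False
        then have "x \<in> {1..n} - X" "y \<in> {1..n} - X" using C by blast+
        then show ?thesis by (intro L.sep_within[OF XL L.top]) blast+
      qed
    qed
    then show ?thesis using pleq_trans[OF _ 2] p(2) XL unfolding tQ assign_def by auto
  qed
  \<comment> \<open>Only the root and \<open>X\<close> are collapsed to the centre of the star,
    since all other members survive.\<close>
  have "u \<in> assign n \<F> ?K" if u: "u \<in> iv ?K" "?\<pi> u = ?r" for u
  proof -
    from u(1) obtain A where A: "A \<in> fam n (N \<union> P)" "u = set_encode A" by auto
    have "hull (fam n N) A \<in> fam n N" using M.hull_in[OF L.nonempty[OF A(1)] L.sub[OF A(1)]] .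
    then have hA: "hull (fam n N) A = {1..n}"
      using u(2) A M.enc_eq[OF _ M.top] L.dec_enc by simp
    show ?thesis
    proof (cases "A = {1..n}")
      case True
      then show ?thesis using rK A by simp
    next
      case False
      then have "A \<notin> fam n N" using hA M.hull_self by blast
      then have "A = X" using A(1) unfolding fam_def P_def by blast
      then show ?thesis using XK A by simp
    qed
  qed
  moreover have rS: "?r \<in> iv ?S" using M.top by simp
  ultimately have "?r \<in> assign n \<F> ?S" using extremalD[OF Z c rS] by blast
  moreover have "stype n ?S {?r} = a + b" unfolding stype_def sep_star[OF N(1) YN] N(2) ..
  ultimately show ?thesis by (simp add: assign_def)
qed

text \<open>The kept parts, without zeros, form \<open>a\<close>, and the inserted parts play the
  role of \<open>b\<close>. In \<open>p1\<close> the parts refining \<open>L\<close> have the sum of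
  \<open>M\<close>; in \<open>p2\<close> the parts outside \<open>M\<close> have the sum of
  \<open>a\<close>. This yields the two comparisons at the ends of an edge.\<close>

lemma extremal_step:
  assumes Z: "extremal n (assign n \<F>)" and F: "\<And>p. p \<in> \<F> \<Longrightarrow> 0 \<notin># p \<and> sum_mset p = n"
    and q: "p1 \<in> \<F>" "pleq q p1" and step: "one_step \<F> q r"
  shows "\<exists>p\<in>\<F>. pleq r p"
proof -
  from step obtain L M p2 where p2: "p2 \<in> \<F>" "L \<subseteq># q" "M \<subseteq># p2" "sum_mset L = sum_mset M"
    and r: "r = q - L + M" unfolding one_step_def by blast
  let ?nz = "filter_mset (\<lambda>x::nat. x \<noteq> 0)"
  define a where "a = ?nz (q - L)"
  have M0: "0 \<notin># M" using F[OF p2(1)] mset_subset_eqD[OF p2(3)] by blast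
  have "?nz M = M" using M0 by (induction M) auto
  then have nzr: "?nz r = a + M" by (simp add: r a_def)
  have a0: "0 \<notin># a" unfolding a_def set_mset_filter by blast
  have sa: "sum_mset (q - L) = sum_mset a" unfolding a_def by (rule sum_filter_nonzero[symmetric])
  have qL: "q = (q - L) + L" using p2(2) by simp
  have pM: "p2 = (p2 - M) + M" using p2(3) by simp
  have "sum_mset q = n" using pleq_sum[OF q(2)] F[OF q(1)] by simp
  then have sum: "sum_mset a + sum_mset M = n"
    using arg_cong[OF qL, of sum_mset] p2(4) unfolding sum_mset.union sa by simp
  have "sum_mset p2 = n" using F[OF p2(1)] by simp
  then have sumpM: "sum_mset (p2 - M) = sum_mset a"
    using arg_cong[OF pM, of sum_mset] sum unfolding sum_mset.union by simp
  have "pleq ((q - L) + L) p1" using q(2) qL by simp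
  then obtain r1 r2 where s: "p1 = r1 + r2" "pleq (q - L) r1" "pleq L r2" by (rule pleq_addD)
  have s0: "0 \<notin># r1" "0 \<notin># r2" using F[OF q(1)] s(1) by auto
  have 1: "pleq (a + {#sum_mset M#}) p1"
    unfolding s(1)
  proof (rule pleq_add)
    show "pleq a r1" unfolding a_def by (rule pleq_drop_zeros[OF s(2) s0(1)])
    show "pleq {#sum_mset M#} r2" using pleq_sum[OF s(3)] p2(4) by (intro pleq_single) simp
  qed
  have 2: "pleq ({#sum_mset a#} + M) p2"
    using pleq_add[OF pleq_single[OF sumpM] pleq_refl, of M] p2(3) by simp
  have "\<exists>p\<in>\<F>. pleq (a + M) p"
  proof -
    \<comment> \<open>With fewer than two parts on a side there is no stable edge, but nothing is to
      be done: a single part equals its own sum, so one of the two comparisons is already the claim,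
      and an empty side leaves all of \<open>p2\<close> or a coarsening of
      \<open>p1\<close>.\<close>
    consider "a = {#}" | "M = {#}" | x where "a = {#x#}" | x where "M = {#x#}"
      | "2 \<le> size a" "2 \<le> size M"
    proof -
      have "a = {#} \<or> (\<exists>x. a = {#x#}) \<or> 2 \<le> size a" "M = {#} \<or> (\<exists>x. M = {#x#}) \<or> 2 \<le> size M"
        by (metis One_nat_def Suc_1 Suc_leI le_neq_implies_less less_one not_less size_1_singleton_mset
            size_eq_0_iff_empty)+
      then show ?thesis using that by blast
    qed
    then show ?thesis
    proof cases
      case 1
      then have "p2 - M = {#}"
        using sumpM F[OF p2(1)] in_diffD by (intro sum_zero_empty) fastforce+
      then show ?thesis using p2(1) pM 1 pleq_refl by (metis add_0)
    next
      case 2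
      then have "r2 = {#}" using s0(2) pleq_sum[OF s(3)] p2(4) by (intro sum_zero_empty) simp_all
      then show ?thesis using pleq_drop_zeros[OF s(2) s0(1)] s(1) q(1) 2 unfolding a_def by auto
    next
      case 3
      then show ?thesis using 2 p2(1) by auto
    next
      case 4
      then show ?thesis using 1 q(1) by auto
    next
      case 5
      then show ?thesis using extremal_merge[OF Z q(1) p2(1) a0 M0 5 sum 1 2] by blast
    qed
  qed
  then show ?thesis unfolding nzr[symmetric] using pleq_nonzero[of r] by metis
qed

lemma extremal_imp_special:
  assumes Z: "extremal n (assign n \<F>)" and F: "\<And>p. p \<in> \<F> \<Longrightarrow> 0 \<notin># p \<and> sum_mset p = n"
  shows "special_family \<F>"
  unfolding special_family_def
proof (intro allI impI)
  fix r assume "replacement \<F> r"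
  then obtain p q where p: "p \<in> \<F>" "pleq q p" and steps: "(one_step \<F>)\<^sup>*\<^sup>* q r"
    unfolding replacement_def by blast
  from steps show "\<exists>p\<in>\<F>. pleq r p"
  proof (induction rule: rtranclp_induct)
    case base
    then show ?case using p by blast
  next
    case (step q r)
    then show ?case using extremal_step[OF Z F] by blast
  qed
qed

section \<open>Relabelling\<close>

lemma relabel_simps [simp]:
  "iv (relabel \<tau> G) = iv G" "ie (relabel \<tau> G) = ie G" "lf (relabel \<tau> G) = lf G \<circ> inv \<tau>"
  by (simp_all add: relabel_def iv_def ie_def lf_def)

lemma permutes_inv_inv: "\<sigma> permutes A \<Longrightarrow> inv (inv \<sigma>) = \<sigma>"
  by (simp add: inv_inv_eq permutes_bij)

lemma stable_relabel:
  assumes st: "stable_tree n G" and \<sigma>: "\<sigma> permutes {1..n}"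
  shows "stable_tree n (relabel (inv \<sigma>) G)"
proof -
  have "card {i \<in> {1..n}. lf G (\<sigma> i) = v} = card {i \<in> {1..n}. lf G i = v}" for v
  proof -
    have "{i \<in> {1..n}. lf G i = v} = \<sigma> ` {i \<in> {1..n}. lf G (\<sigma> i) = v}"
    proof (intro subset_antisym subsetI)
      fix i assume i: "i \<in> {i \<in> {1..n}. lf G i = v}"
      then obtain j where "j \<in> {1..n}" "i = \<sigma> j" using permutes_image[OF \<sigma>] by blast
      then show "i \<in> \<sigma> ` {i \<in> {1..n}. lf G (\<sigma> i) = v}" using i by blast
    next
      fix i assume "i \<in> \<sigma> ` {i \<in> {1..n}. lf G (\<sigma> i) = v}"
      then show "i \<in> {i \<in> {1..n}. lf G i = v}" using permutes_in_image[OF \<sigma>] by auto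
    qed
    then show ?thesis using card_image[OF permutes_inj_on[OF \<sigma>]] by metis
  qed
  moreover have "lf G (\<sigma> i) \<in> iv G" if "i \<in> {1..n}" for i
    using stable_lf[OF st] permutes_in_image[OF \<sigma>] that by blast
  ultimately show ?thesis
    using st unfolding stable_tree_def relabel_simps permutes_inv_inv[OF \<sigma>] o_def by simp
qed

lemma sep_relabel:
  assumes \<sigma>: "\<sigma> permutes {1..n}"
  shows "(x, y) \<in> sep n (relabel (inv \<sigma>) G) F \<longleftrightarrow> (\<sigma> x, \<sigma> y) \<in> sep n G F"
  using permutes_in_image[OF \<sigma>] permutes_inj[OF \<sigma>]
  unfolding sep_def relabel_simps permutes_inv_inv[OF \<sigma>] o_def by (auto simp: inj_eq)

text \<open>The value of \<open>\<sigma>\<close> acting on \<open>Z\<close> at \<open>H\<close> is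
  \<open>Z\<close> at \<open>H\<close> relabelled by \<open>inv \<sigma>\<close>. By
  \<open>atomic_iff\<close> it contains \<open>w\<close> iff \<open>\<sigma>\<close> carries the
  blocks of the basic pair into blocks at \<open>w\<close>, and \<open>pleq_ptype_iff\<close>
  removes \<open>\<sigma>\<close>.\<close>

lemma orbit_iff:
  assumes bp: "basic_pair n G v" and at: "atomic n G v Z" and H: "stable_tree n H"
  shows "(\<exists>\<sigma>. \<sigma> permutes {1..n} \<and> w \<in> Z (relabel (inv \<sigma>) H)) \<longleftrightarrow>
    w \<in> iv H \<and> pleq (stype n H {w}) (stype n G {v})"
proof -
  have mem: "w \<in> Z (relabel (inv \<sigma>) H) \<longleftrightarrow>
      w \<in> iv H \<and> (\<forall>C\<in>{1..n} // sep n G {v}. \<exists>B\<in>{1..n} // sep n H {w}. \<sigma> ` C \<subseteq> B)"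
    if \<sigma>: "\<sigma> permutes {1..n}" for \<sigma>
  proof -
    have "sep n G {v} \<subseteq> sep n (relabel (inv \<sigma>) H) {w} \<longleftrightarrow>
        (\<forall>C\<in>{1..n} // sep n G {v}. \<exists>B\<in>{1..n} // sep n H {w}. \<sigma> ` C \<subseteq> B)"
    proof
      assume *: "sep n G {v} \<subseteq> sep n (relabel (inv \<sigma>) H) {w}"
      show "\<forall>C\<in>{1..n} // sep n G {v}. \<exists>B\<in>{1..n} // sep n H {w}. \<sigma> ` C \<subseteq> B"
      proof
        fix C assume "C \<in> {1..n} // sep n G {v}"
        then obtain x where x: "x \<in> {1..n}" "C = sep n G {v} `` {x}" by (rule quotientE)
        have "\<sigma> ` C \<subseteq> sep n H {w} `` {\<sigma> x}" using * x sep_relabel[OF \<sigma>] by blast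
        moreover have "\<sigma> x \<in> {1..n}" using permutes_in_image[OF \<sigma>] x by blast
        ultimately show "\<exists>B\<in>{1..n} // sep n H {w}. \<sigma> ` C \<subseteq> B" by (meson quotientI)
      qed
    next
      assume *: "\<forall>C\<in>{1..n} // sep n G {v}. \<exists>B\<in>{1..n} // sep n H {w}. \<sigma> ` C \<subseteq> B"
      show "sep n G {v} \<subseteq> sep n (relabel (inv \<sigma>) H) {w}"
      proof (rule subrelI)
        fix x y assume "(x, y) \<in> sep n G {v}"
        then obtain C where C: "C \<in> {1..n} // sep n G {v}" "x \<in> C" "y \<in> C"
          by (rule quotient_relE[OF sep_equiv])
        then obtain B where "B \<in> {1..n} // sep n H {w}" "\<sigma> ` C \<subseteq> B" using * by blast
        then show "(x, y) \<in> sep n (relabel (inv \<sigma>) H) {w}"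
          unfolding sep_relabel[OF \<sigma>]
          using C by (intro quotient_relI[OF sep_equiv, of B]) blast+
      qed
    qed
    then show ?thesis using atomic_iff[OF bp at stable_relabel[OF H \<sigma>]] by simp
  qed
  have "pleq (stype n H {w}) (stype n G {v}) \<longleftrightarrow> (\<exists>\<sigma>. \<sigma> permutes {1..n} \<and>
      (\<forall>C\<in>{1..n} // sep n G {v}. \<exists>B\<in>{1..n} // sep n H {w}. \<sigma> ` C \<subseteq> B))"
    unfolding stype_def by (rule pleq_ptype_iff[OF _ sep_partition sep_partition]) simp
  then show ?thesis using mem by blast
qed

text \<open>Assignments are total functions on all triples, but \<open>extremal\<close> inspects
  only stable trees.\<close>

lemma extremal_cong:
  assumes "\<And>H. stable_tree n H \<Longrightarrow> Z H = Z' H"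
  shows "extremal n Z \<longleftrightarrow> extremal n Z'"
proof -
  have "extremal n Z'" if Z: "extremal n Z" and eq: "\<And>H. stable_tree n H \<Longrightarrow> Z H = Z' H" for Z Z'
    unfolding extremal_def
  proof (intro conjI allI impI ballI)
    fix G assume G: "stable_tree n G"
    have "Z G \<subseteq> iv G \<and> Z G \<noteq> iv G" using Z G unfolding extremal_def by blast
    then show "Z' G \<subseteq> iv G" "Z' G \<noteq> iv G" using eq[OF G] by simp_all
  next
    fix G G' \<pi> v' assume "contracts n G G' \<pi>" "v' \<in> iv G'"
    then show "v' \<in> Z' G' \<longleftrightarrow> (\<forall>v\<in>iv G. \<pi> v = v' \<longrightarrow> v \<in> Z' G)"
      using extremalD[OF Z] contracts_stable eq by metis
  qed
  then show ?thesis using assms by metis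
qed

section \<open>Types of basic pairs and the union of their orbits\<close>

lemma stype_props:
  assumes "basic_pair n G v"
  shows "0 \<notin># stype n G {v}" "sum_mset (stype n G {v}) = n" "\<exists>x\<in>#stype n G {v}. x \<noteq> 1"
proof -
  have fin: "finite {1..n}" by simp
  show "0 \<notin># stype n G {v}" unfolding stype_def by (rule zero_notin_ptype[OF fin sep_partition])
  show "sum_mset (stype n G {v}) = n" unfolding stype_def using sum_ptype[OF fin sep_partition] by simp
  obtain x y where "(x, y) \<in> sep n G {v}" "x \<noteq> y" using basic_pair_sep_nontrivial[OF assms] by auto
  obtain C where C: "C \<in> {1..n} // sep n G {v}" "x \<in> C" "y \<in> C"
    using quotient_relE[OF sep_equiv \<open>(x, y) \<in> sep n G {v}\<close>] .
  have "card C \<noteq> 1" using card_ge_2_mem[OF sep_partition C \<open>x \<noteq> y\<close>] by simp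
  moreover have "finite ({1..n} // sep n G {v})" using finite_elements[OF fin sep_partition] .
  then have "card C \<in># stype n G {v}" using C(1) by (auto simp: stype_def ptype_def)
  ultimately show "\<exists>x\<in>#stype n G {v}. x \<noteq> 1" by blast
qed

theorem theorem9p6:
  fixes n k :: nat and Gs :: "nat \<Rightarrow> ltree" and vs :: "nat \<Rightarrow> nat"
    and Zs :: "nat \<Rightarrow> ltree \<Rightarrow> nat set"
  assumes "0 < k"
    and "\<forall>i<k. basic_pair n (Gs i) (vs i)"
    and "\<forall>i<k. atomic n (Gs i) (vs i) (Zs i)"
  shows "extremal n (\<lambda>H. \<Union>i<k. \<Union>\<sigma>\<in>{\<sigma>. \<sigma> permutes {1..n}}. Zs i (relabel (inv \<sigma>) H))
         \<longleftrightarrow> special_family ((\<lambda>i. bp_partition n (Gs i) (vs i)) ` {..<k})"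
proof -
  let ?F = "(\<lambda>i. bp_partition n (Gs i) (vs i)) ` {..<k}"
  have bp: "bp_partition n (Gs i) (vs i) = stype n (Gs i) {vs i}" if "i < k" for i
    using assms(2) that bp_partition_eq by (auto simp: basic_pair_def stype_def)
  have F: "0 \<notin># p" "sum_mset p = n" "\<exists>x\<in>#p. x \<noteq> 1" if "p \<in> ?F" for p
  proof -
    from that obtain i where i: "i < k" "p = stype n (Gs i) {vs i}" using bp by auto
    show "0 \<notin># p" "sum_mset p = n" "\<exists>x\<in>#p. x \<noteq> 1"
      using stype_props[of n "Gs i" "vs i"] assms(2) i by blast+
  qed
  have "(\<Union>i<k. \<Union>\<sigma>\<in>{\<sigma>. \<sigma> permutes {1..n}}. Zs i (relabel (inv \<sigma>) H)) = assign n ?F H"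
    if H: "stable_tree n H" for H
  proof (rule set_eqI)
    fix w
    have "w \<in> (\<Union>i<k. \<Union>\<sigma>\<in>{\<sigma>. \<sigma> permutes {1..n}}. Zs i (relabel (inv \<sigma>) H)) \<longleftrightarrow>
        (\<exists>i<k. \<exists>\<sigma>. \<sigma> permutes {1..n} \<and> w \<in> Zs i (relabel (inv \<sigma>) H))" by blast
    also have "\<dots> \<longleftrightarrow> (\<exists>i<k. w \<in> iv H \<and> pleq (stype n H {w}) (stype n (Gs i) {vs i}))"
      using orbit_iff[OF _ _ H] assms(2,3) by blast
    also have "\<dots> \<longleftrightarrow> w \<in> assign n ?F H"
      using bp by (auto simp: assign_def)
    finally show "w \<in> (\<Union>i<k. \<Union>\<sigma>\<in>{\<sigma>. \<sigma> permutes {1..n}}. Zs i (relabel (inv \<sigma>) H)) \<longleftrightarrow>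
        w \<in> assign n ?F H" .
  qed
  then have "extremal n (\<lambda>H. \<Union>i<k. \<Union>\<sigma>\<in>{\<sigma>. \<sigma> permutes {1..n}}. Zs i (relabel (inv \<sigma>) H))
      \<longleftrightarrow> extremal n (assign n ?F)" by (rule extremal_cong)
  also have "\<dots> \<longleftrightarrow> special_family ?F"
  proof
    assume "extremal n (assign n ?F)"
    then show "special_family ?F" by (rule extremal_imp_special) (intro conjI F(1,2))
  next
    assume "special_family ?F"
    then show "extremal n (assign n ?F)" by (rule special_imp_extremal) (intro conjI F(1,3))
  qed
  finally show ?thesis .
qed

end
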